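(* Let $n \geq 2$, $G = F_{n,\infty}$, and let $(G_s)_{s \geq 1}$ be a sequence of subgroups of finite index in $G$ such that $[G : G_s] \to \infty$ as $s \to \infty$. Then $\lim_{s \to \infty} \mathrm{def}(G_s)/[G : G_s] = 0$.
   Context: For $n \geq 2$, $F_{n,\infty} = \langle x_0, x_1, \ldots \mid x_i^{x_j} = x_{i+n-1} \text{ for } i > j \geq 0 \rangle$, where $x^y = y^{-1}xy$; it is finitely presented, and so are its finite index subgroups. For a finitely presented group $H$, the deficiency $\mathrm{def}(H)$ is the supremum, over all finite presentations of $H$, of the number of generators minus the number of relators. *)

theory Defs
  imports "HOL-Analysis.Analysis" "HOL-Algebra.Coset" "HOL-Library.Extended_Real"
begin

text \<open>Words in a free group: a letter (False, x) stands for the generator x,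
  (True, x) for its inverse.\<close>
type_synonym 'a word = "(bool \<times> 'a) list"

definition inv_letter :: "bool \<times> 'a \<Rightarrow> bool \<times> 'a" where
  "inv_letter a = (\<not> fst a, snd a)"

definition words_on :: "'a set \<Rightarrow> 'a word set" where
  "words_on X = {w. \<forall>a\<in>set w. snd a \<in> X}"

inductive pres_eq :: "'a word set \<Rightarrow> 'a word \<Rightarrow> 'a word \<Rightarrow> bool" for R where
  pres_refl: "pres_eq R w w"
| pres_sym: "pres_eq R u v \<Longrightarrow> pres_eq R v u"
| pres_trans: "pres_eq R u v \<Longrightarrow> pres_eq R v w \<Longrightarrow> pres_eq R u w"
| pres_cancel: "pres_eq R (u @ [a, inv_letter a] @ v) (u @ v)"
| pres_rel: "r \<in> R \<Longrightarrow> pres_eq R (u @ r @ v) (u @ v)"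

definition pres_class :: "'a set \<Rightarrow> 'a word set \<Rightarrow> 'a word \<Rightarrow> 'a word set" where
  "pres_class X R u = {v \<in> words_on X. pres_eq R u v}"

definition pres_group :: "'a set \<Rightarrow> 'a word set \<Rightarrow> ('a word set) monoid" where
  "pres_group X R =
     \<lparr> carrier = {pres_class X R u | u. u \<in> words_on X},
       mult = (\<lambda>A B. {w \<in> words_on X. \<exists>u\<in>A. \<exists>v\<in>B. pres_eq R (u @ v) w}),
       one = pres_class X R [] \<rparr>"

definition F_rels :: "nat \<Rightarrow> nat word set" where
  "F_rels n = {[(True, j), (False, i), (False, j), (True, i + n - 1)] | i j. j < i}"

definition F_inf :: "nat \<Rightarrow> (nat word set) monoid" where
  "F_inf n = pres_group UNIV (F_rels n)"

definition deficiency :: "('b, 'm) monoid_scheme \<Rightarrow> ereal" where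
  "deficiency H = (SUP p \<in> {(k, R). finite R \<and> R \<subseteq> words_on {..<k} \<and>
        pres_group {..<k} R \<cong> H}. ereal (real (fst p) - real (card (snd p))))"

definition group_index :: "('b, 'm) monoid_scheme \<Rightarrow> 'b set \<Rightarrow> nat" where
  "group_index G H = card (rcosets\<^bsub>G\<^esub> H)"

end

theory Submission
  imports Defs
begin

text \<open>
  Call the cost of a group the least number of generators plus relators of a presentation. Counting
  homomorphisms to the group of order two shows that the deficiency is at most the cost in absolute value,
  so it suffices that the cost of a subgroup of index \<open>N\<close> is \<open>o(N)\<close>. A subgroup of finite index is the
  kernel of a homomorphism \<open>\<pi>\<close> to a finite abelian group. If \<open>N\<close> is large, then at least one of the
  following elements has large order, in the quotient indicated, and the Reidemeister--Schreier bound is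
  improved by that order:

  \<^item> \<open>x\<^sub>0\<close>, modulo the image of \<open>\<phi>(F)\<close>, where \<open>\<phi>\<close> shifts the generators: \<open>F\<close> is an ascending HNN extension
    of \<open>\<phi>(F)\<close> with stable letter \<open>x\<^sub>0\<close>, and so is the kernel, with a power of \<open>x\<^sub>0\<close> as stable letter;
  \<^item> \<open>x\<^sub>0\<close>, modulo the image of \<open>\<theta>(F)\<close>, where \<open>\<theta>\<close> is conjugation by an infinite right spine in the forest
    picture: \<open>F\<close> is also an ascending HNN extension of \<open>\<theta>(F)\<close> with stable letter \<open>x\<^sub>0\<^sup>-\<^sup>1\<close>;
  \<^item> a shift of \<open>c = x\<^sub>0 x\<^sub>1\<^sup>-\<^sup>1\<close>, which commutes with \<open>\<phi>\<^sup>2(F)\<close>: the kernel meets \<open>\<langle>c\<rangle> \<times> \<phi>\<^sup>2(F)\<close> in a central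
    extension of small cost, and finitely many further generators and relators, controlled by the rank of
    that subgroup, present the kernel.

  The maps \<open>\<phi>\<close> and \<open>\<theta>\<close> are shown to be injective by means of the piecewise linear action of \<open>F\<close> on the line.
\<close>

section \<open>Presentations of subgroups\<close>

subsection \<open>Evaluation of words\<close>

text \<open>Rewriting alone bounds the cost linearly in the index \<open>N\<close>; a gain by an
  arbitrary fixed factor \<open>M\<close> is required. In an ascending HNN extension the kernel is
  presented from its base, where the index is only \<open>N / m\<close> if the stable letter has
  order \<open>m\<close> modulo the image of the base. The listed elements account for the whole
  finite quotient. Modulo the image of \<open>\<phi>(F)\<close> it is generated by
  \<open>x 0\<close>. On \<open>\<phi>(F)\<close> the images of the generators repeat with period
  \<open>n - 1\<close>, so that \<open>x 0\<close> is no longer independent of the later generators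
  and \<open>\<phi>\<close> yields nothing more; this is why \<open>\<theta>\<close> enters. There
  the image of \<open>\<theta>(F)\<close> is generated by the quotients of the images of
  \<open>x i\<close> and \<open>x 0\<close>, which are products of \<open>n - 1\<close> shifts of
  \<open>c\<close>, and again only \<open>x 0\<close> is left over. If all these orders are below
  \<open>M\<close>, then \<open>N\<close> is at most \<open>M ^ (n + 1)\<close>. Beyond that the
  cost is at most \<open>A * N / M + B\<close> with constants that depend on \<open>n\<close> alone,
  and \<open>M\<close> is fixed before \<open>N\<close> grows.\<close>

primrec ev :: "('g, 'm) monoid_scheme \<Rightarrow> ('x \<Rightarrow> 'g) \<Rightarrow> 'x word \<Rightarrow> 'g" where
  "ev G y [] = \<one>\<^bsub>G\<^esub>"
| "ev G y (a # w) = (if fst a then inv\<^bsub>G\<^esub> (y (snd a)) else y (snd a)) \<otimes>\<^bsub>G\<^esub> ev G y w"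

definition inv_word :: "'x word \<Rightarrow> 'x word" where
  "inv_word w = rev (map inv_letter w)"

definition rename :: "('x \<Rightarrow> 'z) \<Rightarrow> 'x word \<Rightarrow> 'z word" where
  "rename b w = map (map_prod id b) w"

lemma words_on_simps [simp]:
  "[] \<in> words_on X"
  "a # w \<in> words_on X \<longleftrightarrow> snd a \<in> X \<and> w \<in> words_on X"
  "u @ v \<in> words_on X \<longleftrightarrow> u \<in> words_on X \<and> v \<in> words_on X"
  "w \<in> words_on UNIV"
  by (auto simp: words_on_def)

lemma snd_inv_letter [simp]: "snd (inv_letter a) = snd a"
  and fst_inv_letter [simp]: "fst (inv_letter a) = (\<not> fst a)"
  by (auto simp: inv_letter_def)

lemma inv_letter_inv_letter [simp]: "inv_letter (inv_letter a) = a"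
  by (simp add: inv_letter_def)

lemma inv_word_simps [simp]:
  "inv_word [] = []"
  "inv_word (a # w) = inv_word w @ [inv_letter a]"
  "inv_word (u @ v) = inv_word v @ inv_word u"
  by (auto simp: inv_word_def)

lemma inv_word_words_on [simp]: "inv_word w \<in> words_on X \<longleftrightarrow> w \<in> words_on X"
  by (induction w) auto

lemma replicate_words_on [simp]: "snd a \<in> X \<Longrightarrow> replicate k a \<in> words_on X"
  by (induction k) auto

lemma rename_simps [simp]:
  "rename b [] = []"
  "rename b (a # w) = (fst a, b (snd a)) # rename b w"
  "rename b (u @ v) = rename b u @ rename b v"
  by (auto simp: rename_def map_prod_def split_beta)

lemma rename_words_on: "w \<in> words_on X \<Longrightarrow> b ` X \<subseteq> Z \<Longrightarrow> rename b w \<in> words_on Z"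
  by (induction w) auto

lemma rename_inv: "inj_on b X \<Longrightarrow> w \<in> words_on X \<Longrightarrow> rename (inv_into X b) (rename b w) = w"
  by (induction w) auto

lemma ev_cong: "(\<And>x. x \<in> X \<Longrightarrow> y x = y' x) \<Longrightarrow> w \<in> words_on X \<Longrightarrow> ev G y w = ev G y' w"
  by (induction w) auto

lemma ev_rename: "ev G y (rename b w) = ev G (y \<circ> b) w"
  by (induction w) auto

context group
begin

lemma cancel_left [simp]:
  assumes "x \<in> carrier G" "y \<in> carrier G"
  shows "inv x \<otimes> (x \<otimes> y) = y" "x \<otimes> (inv x \<otimes> y) = y"
  using assms by (simp_all add: m_assoc [symmetric])

lemmas group_word = m_assoc inv_mult_group

lemma ev_closed:
  assumes "subgroup A G" "y ` X \<subseteq> A" "w \<in> words_on X"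
  shows "ev G y w \<in> A"
  using assms(3)
proof (induction w)
  case Nil
  then show ?case using assms by (simp add: subgroup.one_closed)
next
  case (Cons a w)
  then show ?case using assms by (auto intro!: subgroup.m_closed subgroup.m_inv_closed)
qed

lemma ev_carrier [simp]:
  assumes "range y \<subseteq> carrier G" shows "ev G y w \<in> carrier G"
  using ev_closed [OF subgroup_self assms] by simp

lemma ev_in_carrier:
  assumes "y ` X \<subseteq> carrier G" "w \<in> words_on X" shows "ev G y w \<in> carrier G"
  using ev_closed [OF subgroup_self assms] .

lemma ev_append:
  assumes "y ` X \<subseteq> carrier G" "u \<in> words_on X" "v \<in> words_on X"
  shows "ev G y (u @ v) = ev G y u \<otimes> ev G y v"
  using assms(2)
proof (induction u)
  case Nil
  then show ?case using assms by (simp add: ev_in_carrier)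
next
  case (Cons a u)
  have "y (snd a) \<in> carrier G" using Cons assms(1) by auto
  then show ?case using Cons assms by (auto simp: m_assoc ev_in_carrier)
qed

lemma ev_inv_word:
  assumes "y ` X \<subseteq> carrier G" "u \<in> words_on X"
  shows "ev G y (inv_word u) = inv (ev G y u)"
  using assms(2)
proof (induction u)
  case Nil
  then show ?case by simp
next
  case (Cons a u)
  have "y (snd a) \<in> carrier G" using Cons assms(1) by auto
  moreover have "[inv_letter a] \<in> words_on X" using Cons by auto
  ultimately show ?case using Cons assms
    by (auto simp: ev_append [OF assms(1)] inv_mult_group ev_in_carrier)
qed

lemma ev_replicate:
  assumes "y x \<in> carrier G"
  shows "ev G y (replicate k (False, x)) = y x [^] k"
    and "ev G y (replicate k (True, x)) = inv (y x [^] k)"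
proof -
  show "ev G y (replicate k (False, x)) = y x [^] k"
    using assms by (induction k) (simp_all flip: nat_pow_Suc2)
  show "ev G y (replicate k (True, x)) = inv (y x [^] k)"
    using assms by (induction k) (simp_all add: inv_mult_group [symmetric])
qed

text \<open>Derivations under \<open>pres_eq\<close> may insert and delete letters of the whole
  type, not only generators; this is why \<open>y\<close> sends every letter into the
  carrier.\<close>

lemma pres_eq_ev:
  assumes y: "range y \<subseteq> carrier G" and R: "\<And>r. r \<in> R \<Longrightarrow> ev G y r = \<one>" and "pres_eq R u v"
  shows "ev G y u = ev G y v"
  using assms(3)
proof induction
  case (pres_cancel u a v)
  have "y (snd a) \<in> carrier G" using y by auto
  then show ?case using y by (auto simp: ev_append [OF y])
next
  case (pres_rel r u v)
  then show ?case using y R by (simp add: ev_append [OF y])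
qed auto

end

subsection \<open>Homomorphisms defined on a subgroup\<close>

text \<open>Subgroups remain sets inside one ambient group, so that towers of subgroups share a
  single multiplication and inverse. Values outside \<open>A\<close> are unconstrained.\<close>

definition homs :: "('g, 'm) monoid_scheme \<Rightarrow> 'g set \<Rightarrow> ('e, 'n) monoid_scheme \<Rightarrow> ('g \<Rightarrow> 'e) set" where
  "homs G A E = {F. F ` A \<subseteq> carrier E \<and> (\<forall>a\<in>A. \<forall>b\<in>A. F (a \<otimes>\<^bsub>G\<^esub> b) = F a \<otimes>\<^bsub>E\<^esub> F b)}"

locale homs_on = G: group G + E: group E for G (structure) and E (structure) +
  fixes A F
  assumes sub: "subgroup A G" and F: "F \<in> homs G A E"
begin

lemma A_carrier: "a \<in> A \<Longrightarrow> a \<in> carrier G"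
  using sub subgroup.mem_carrier by metis

lemma closed [simp]: "a \<in> A \<Longrightarrow> F a \<in> carrier E"
  using F by (auto simp: homs_def)

lemma mult: "a \<in> A \<Longrightarrow> b \<in> A \<Longrightarrow> F (a \<otimes> b) = F a \<otimes>\<^bsub>E\<^esub> F b"
  using F by (auto simp: homs_def)

lemma one [simp]: "F \<one> = \<one>\<^bsub>E\<^esub>"
proof -
  have "\<one> \<in> A" using sub by (simp add: subgroup.one_closed)
  then have "F \<one> \<otimes>\<^bsub>E\<^esub> F \<one> = F \<one>" using mult [of \<one> \<one>] by simp
  then show ?thesis using \<open>\<one> \<in> A\<close> E.r_cancel_one by auto
qed

lemma inv: "a \<in> A \<Longrightarrow> F (inv a) = inv\<^bsub>E\<^esub> (F a)"
proof -
  assume a: "a \<in> A"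
  then have "inv a \<in> A" using sub by (simp add: subgroup.m_inv_closed)
  with a have "F (inv a) \<otimes>\<^bsub>E\<^esub> F a = \<one>\<^bsub>E\<^esub>" using mult [of "inv a" a] A_carrier by simp
  then show ?thesis using \<open>inv a \<in> A\<close> a by (simp add: E.inv_equality)
qed

lemma ev: "y ` X \<subseteq> A \<Longrightarrow> w \<in> words_on X \<Longrightarrow> F (ev G y w) = ev E (F \<circ> y) w"
proof (induction w)
  case (Cons a w)
  have "y (snd a) \<in> A" using Cons by auto
  moreover have "ev G y w \<in> A" using Cons G.ev_closed [OF sub] by auto
  ultimately show ?case using Cons sub by (auto simp: mult inv subgroup.m_inv_closed)
qed simp

lemma pow: "a \<in> A \<Longrightarrow> F (a [^] (k::nat)) = F a [^]\<^bsub>E\<^esub> k"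
proof (induction k)
  case (Suc k)
  have "a [^] k \<in> A" for k :: nat
    using Suc.prems sub by (induction k) (auto simp: subgroup.one_closed subgroup.m_closed)
  then show ?case using Suc by (simp add: mult)
qed simp

end

lemma (in group) homs_onI: "group E \<Longrightarrow> subgroup A G \<Longrightarrow> F \<in> homs G A E \<Longrightarrow> homs_on G E A F"
  by (simp add: homs_on_def homs_on_axioms_def group_axioms)

lemma (in group) pow_mem: "subgroup A G \<Longrightarrow> a \<in> A \<Longrightarrow> a [^] (k::nat) \<in> A"
  by (induction k) (auto simp: subgroup.one_closed subgroup.m_closed)

lemma homs_carrier: "homs G (carrier G) E = hom G E"
  by (auto simp: homs_def hom_def)

lemma homs_mono: "F \<in> homs G A E \<Longrightarrow> B \<subseteq> A \<Longrightarrow> F \<in> homs G B E"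
  by (auto simp: homs_def)

subsection \<open>The group given by a presentation\<close>

lemma pres_eq_append_right: "pres_eq R u v \<Longrightarrow> pres_eq R (u @ w) (v @ w)"
proof (induction rule: pres_eq.induct)
  case (pres_cancel u a v)
  then show ?case using pres_eq.pres_cancel [of R u a "v @ w"] by simp
next
  case (pres_rel r u v)
  then show ?case using pres_eq.pres_rel [of r R u "v @ w"] by simp
qed (auto intro: pres_eq.intros)

lemma pres_eq_append_left: "pres_eq R u v \<Longrightarrow> pres_eq R (w @ u) (w @ v)"
proof (induction rule: pres_eq.induct)
  case (pres_cancel u a v)
  then show ?case using pres_eq.pres_cancel [of R "w @ u" a v] by simp
next
  case (pres_rel r u v)
  then show ?case using pres_eq.pres_rel [of r R "w @ u" v] by simp
qed (auto intro: pres_eq.intros)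

lemma pres_eq_append: "pres_eq R u u' \<Longrightarrow> pres_eq R v v' \<Longrightarrow> pres_eq R (u @ v) (u' @ v')"
  by (meson pres_eq_append_left pres_eq_append_right pres_trans)

lemma pres_eq_inv_right: "pres_eq R (w @ inv_word w) []"
proof (induction w)
  case (Cons a w)
  have "pres_eq R ([a] @ (w @ inv_word w) @ [inv_letter a]) ([a] @ [] @ [inv_letter a])"
    using Cons by (intro pres_eq_append_left pres_eq_append_right)
  also have "pres_eq R ([a] @ [] @ [inv_letter a]) []"
    using pres_cancel [of R "[]" a "[]"] by simp
  finally (pres_trans) show ?case by simp
qed (simp add: pres_refl)

lemma inv_word_inv_word [simp]: "inv_word (inv_word w) = w"
  by (induction w) auto

lemma pres_eq_inv_left: "pres_eq R (inv_word w @ w) []"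
  using pres_eq_inv_right [of R "inv_word w"] by simp

lemma pres_eq_relator: "r \<in> R \<Longrightarrow> pres_eq R r []"
  using pres_rel [of r R "[]" "[]"] by simp

lemma pres_class_eq_iff:
  assumes "u \<in> words_on X" "v \<in> words_on X"
  shows "pres_class X R u = pres_class X R v \<longleftrightarrow> pres_eq R u v"
  using assms by (auto simp: pres_class_def intro: pres_eq.intros)

lemma pres_class_in_carrier: "u \<in> words_on X \<Longrightarrow> pres_class X R u \<in> carrier (pres_group X R)"
  by (auto simp: pres_group_def)

lemma pres_class_mult:
  assumes "u \<in> words_on X" "v \<in> words_on X"
  shows "pres_class X R u \<otimes>\<^bsub>pres_group X R\<^esub> pres_class X R v = pres_class X R (u @ v)"
proof -
  have "pres_eq R (u @ v) w" if "u' \<in> pres_class X R u" "v' \<in> pres_class X R v" "pres_eq R (u' @ v') w" for u' v' w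
    using that by (auto simp: pres_class_def intro: pres_trans pres_eq_append)
  moreover have "u \<in> pres_class X R u" "v \<in> pres_class X R v"
    using assms by (auto simp: pres_class_def pres_refl)
  ultimately show ?thesis by (auto simp: pres_group_def pres_class_def)
qed

lemma pres_group_one: "\<one>\<^bsub>pres_group X R\<^esub> = pres_class X R []"
  by (simp add: pres_group_def)

lemma pres_group_cases:
  assumes "c \<in> carrier (pres_group X R)"
  obtains u where "u \<in> words_on X" "c = pres_class X R u"
  using assms by (auto simp: pres_group_def)

lemma group_pres_group: "group (pres_group X R)"
proof (rule groupI)
  fix x y assume xy: "x \<in> carrier (pres_group X R)" "y \<in> carrier (pres_group X R)"
  then show "x \<otimes>\<^bsub>pres_group X R\<^esub> y \<in> carrier (pres_group X R)"
    by (auto elim!: pres_group_cases simp: pres_class_mult pres_class_in_carrier)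
  fix z assume "z \<in> carrier (pres_group X R)"
  with xy show "x \<otimes>\<^bsub>pres_group X R\<^esub> y \<otimes>\<^bsub>pres_group X R\<^esub> z = x \<otimes>\<^bsub>pres_group X R\<^esub> (y \<otimes>\<^bsub>pres_group X R\<^esub> z)"
    by (auto elim!: pres_group_cases simp: pres_class_mult)
next
  show "\<one>\<^bsub>pres_group X R\<^esub> \<in> carrier (pres_group X R)"
    by (simp add: pres_group_one pres_class_in_carrier)
next
  fix x assume "x \<in> carrier (pres_group X R)"
  then obtain u where u: "u \<in> words_on X" "x = pres_class X R u" by (rule pres_group_cases)
  then show "\<one>\<^bsub>pres_group X R\<^esub> \<otimes>\<^bsub>pres_group X R\<^esub> x = x"
    by (simp add: pres_group_one pres_class_mult)
  have "pres_class X R (inv_word u) \<otimes>\<^bsub>pres_group X R\<^esub> x = \<one>\<^bsub>pres_group X R\<^esub>"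
    using u by (simp add: pres_group_one pres_class_mult pres_class_eq_iff pres_eq_inv_left)
  then show "\<exists>y\<in>carrier (pres_group X R). y \<otimes>\<^bsub>pres_group X R\<^esub> x = \<one>\<^bsub>pres_group X R\<^esub>"
    using u by (metis inv_word_words_on pres_class_in_carrier)
qed

text \<open>Outside \<open>X\<close> the class of a letter may be empty, so the generator is set to the identity.\<close>

definition pgen :: "'x set \<Rightarrow> 'x word set \<Rightarrow> 'x \<Rightarrow> 'x word set" where
  "pgen X R x = (if x \<in> X then pres_class X R [(False, x)] else \<one>\<^bsub>pres_group X R\<^esub>)"

lemma pgen_in_carrier [simp]: "pgen X R x \<in> carrier (pres_group X R)"
  by (simp add: pgen_def pres_class_in_carrier pres_group_one)

lemma range_pgen: "range (pgen X R) \<subseteq> carrier (pres_group X R)"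
  by auto

lemma inv_pres_class:
  assumes "u \<in> words_on X"
  shows "inv\<^bsub>pres_group X R\<^esub> (pres_class X R u) = pres_class X R (inv_word u)"
  using assms
  by (intro group.inv_equality [OF group_pres_group])
    (simp_all add: pres_group_one pres_class_mult pres_class_eq_iff pres_eq_inv_left pres_class_in_carrier)

lemma ev_pgen:
  "w \<in> words_on X \<Longrightarrow> ev (pres_group X R) (pgen X R) w = pres_class X R w"
proof (induction w)
  case Nil
  then show ?case by (simp add: pres_group_one)
next
  case (Cons a w)
  obtain s x where a: "a = (s, x)" by force
  have "ev (pres_group X R) (pgen X R) [a] = pres_class X R [a]"
    using Cons a by (cases s)
      (auto simp: pgen_def inv_pres_class pres_class_mult pres_class_in_carrier inv_letter_def pres_group_one)
  moreover have "ev (pres_group X R) (pgen X R) (a # w) =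
      ev (pres_group X R) (pgen X R) [a] \<otimes>\<^bsub>pres_group X R\<^esub> ev (pres_group X R) (pgen X R) w"
    by (metis append_Cons append_Nil group.ev_append group_pres_group range_pgen words_on_simps(4))
  ultimately show ?case using Cons by (simp add: pres_class_mult)
qed

subsection \<open>Presentations\<close>

definition generates :: "('g, 'm) monoid_scheme \<Rightarrow> 'g set \<Rightarrow> ('x \<Rightarrow> 'g) \<Rightarrow> 'x set \<Rightarrow> bool" where
  "generates G A y X \<longleftrightarrow> y ` X \<subseteq> A \<and> (\<forall>g\<in>A. \<exists>w\<in>words_on X. ev G y w = g)"

text \<open>A derivation under \<open>pres_eq\<close> may pass through letters outside
  \<open>X\<close>. Deleting those letters turns it into a derivation over \<open>X\<close>, so this
  is the usual notion of a presentation.\<close>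

definition presents ::
  "('g, 'm) monoid_scheme \<Rightarrow> 'g set \<Rightarrow> ('x \<Rightarrow> 'g) \<Rightarrow> 'x set \<Rightarrow> 'x word set \<Rightarrow> bool" where
  "presents G A y X R \<longleftrightarrow> generates G A y X \<and> R \<subseteq> words_on X \<and> (\<forall>r\<in>R. ev G y r = \<one>\<^bsub>G\<^esub>) \<and>
     (\<forall>w\<in>words_on X. ev G y w = \<one>\<^bsub>G\<^esub> \<longrightarrow> pres_eq R w [])"

lemma generatesD:
  assumes "generates G A y X"
  shows "y ` X \<subseteq> A" "g \<in> A \<Longrightarrow> \<exists>w\<in>words_on X. ev G y w = g"
  using assms by (auto simp: generates_def)

lemma presentsD:
  assumes "presents G A y X R"
  shows "generates G A y X" "y ` X \<subseteq> A" "R \<subseteq> words_on X" "r \<in> R \<Longrightarrow> ev G y r = \<one>\<^bsub>G\<^esub>"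
    "w \<in> words_on X \<Longrightarrow> ev G y w = \<one>\<^bsub>G\<^esub> \<Longrightarrow> pres_eq R w []"
    "g \<in> A \<Longrightarrow> \<exists>w\<in>words_on X. ev G y w = g"
  using assms by (auto simp: presents_def generates_def)

context group
begin

text \<open>The image of an element is read off from any word for it: two words with the same value
  differ by a consequence of the relators, which \<open>f\<close> kills.\<close>

lemma presents_hom:
  assumes A: "subgroup A G" and P: "presents G A y X R" and E: "group E"
    and f: "f ` X \<subseteq> carrier E" "\<And>r. r \<in> R \<Longrightarrow> ev E f r = \<one>\<^bsub>E\<^esub>"
  obtains F where "F \<in> homs G A E" "\<And>x. x \<in> X \<Longrightarrow> F (y x) = f x"
    "\<And>w. w \<in> words_on X \<Longrightarrow> F (ev G y w) = ev E f w"
proof -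
  interpret E: group E by fact
  \<comment> \<open>Extended by the identity off \<open>X\<close>, the map is total, as
    \<open>pres_eq_ev\<close> demands.\<close>
  define f' where "f' x = (if x \<in> X then f x else \<one>\<^bsub>E\<^esub>)" for x
  have f': "range f' \<subseteq> carrier E" using f by (auto simp: f'_def)
  have ff': "ev E f w = ev E f' w" if "w \<in> words_on X" for w
    using that by (intro ev_cong [of X]) (auto simp: f'_def)
  have yX: "y ` X \<subseteq> carrier G" using presentsD(2) [OF P] subgroup.subset [OF A] by blast
  have wd: "ev E f u = ev E f v" if u: "u \<in> words_on X" and v: "v \<in> words_on X" and eq: "ev G y u = ev G y v" for u v
  proof -
    have "ev G y (u @ inv_word v) = \<one>"
      using u v eq yX by (simp add: ev_append [OF yX] ev_inv_word [OF yX] ev_in_carrier)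
    then have "pres_eq R (u @ inv_word v) []" using presentsD(5) [OF P] u v by simp
    moreover have "ev E f' r = \<one>\<^bsub>E\<^esub>" if "r \<in> R" for r
      using f(2) [OF that] ff' [of r] presentsD(3) [OF P] that by auto
    ultimately have "ev E f' (u @ inv_word v) = ev E f' []"
      using E.pres_eq_ev [OF f', of R] by blast
    then have "ev E f u \<otimes>\<^bsub>E\<^esub> inv\<^bsub>E\<^esub> (ev E f v) = \<one>\<^bsub>E\<^esub>"
      using u v f by (simp add: E.ev_append [OF f'] E.ev_inv_word [OF f'] ff')
    then have "ev E f u \<otimes>\<^bsub>E\<^esub> inv\<^bsub>E\<^esub> (ev E f v) \<otimes>\<^bsub>E\<^esub> ev E f v = ev E f v"
      using E.ev_in_carrier [OF f(1) v] by simp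
    then show ?thesis using E.ev_in_carrier [OF f(1) u] E.ev_in_carrier [OF f(1) v]
      by (simp add: E.m_assoc)
  qed
  define wd' where "wd' g = (SOME w. w \<in> words_on X \<and> ev G y w = g)" for g
  define F where "F g = ev E f (wd' g)" for g
  have wd': "wd' g \<in> words_on X \<and> ev G y (wd' g) = g" if "g \<in> A" for g
    unfolding wd'_def using presentsD(6) [OF P that] by (metis (mono_tags, lifting) someI_ex)
  have Fev: "F (ev G y w) = ev E f w" if "w \<in> words_on X" for w
  proof -
    have "ev G y w \<in> A" using ev_closed [OF A presentsD(2) [OF P] that] .
    then show ?thesis unfolding F_def using wd [OF _ that] wd' by auto
  qed
  show ?thesis
  proof
    show "F \<in> homs G A E"
    proof -
      have "F a \<in> carrier E" if "a \<in> A" for a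
        unfolding F_def using wd' [OF that] E.ev_in_carrier [OF f(1)] by auto
      moreover have "F (a \<otimes> b) = F a \<otimes>\<^bsub>E\<^esub> F b" if "a \<in> A" "b \<in> A" for a b
      proof -
        obtain u where u: "u \<in> words_on X" "ev G y u = a" using presentsD(6) [OF P \<open>a \<in> A\<close>] by auto
        obtain v where v: "v \<in> words_on X" "ev G y v = b" using presentsD(6) [OF P \<open>b \<in> A\<close>] by auto
        have "F (a \<otimes> b) = F (ev G y (u @ v))" using ev_append [OF yX u(1) v(1)] u(2) v(2) by simp
        also have "\<dots> = ev E f u \<otimes>\<^bsub>E\<^esub> ev E f v"
          using Fev [of "u @ v"] E.ev_append [OF f(1) u(1) v(1)] u(1) v(1) by simp
        also have "\<dots> = F a \<otimes>\<^bsub>E\<^esub> F b" using Fev [OF u(1)] Fev [OF v(1)] u(2) v(2) by simp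
        finally show ?thesis .
      qed
      ultimately show ?thesis by (auto simp: homs_def)
    qed
    fix x assume "x \<in> X"
    then show "F (y x) = f x"
      using Fev [of "[(False, x)]"] f(1) yX by (simp add: image_subset_iff)
  qed (use Fev in auto)
qed

text \<open>To prove that relators suffice it is enough to map the group back to the presented group.\<close>

lemma presentsI:
  assumes A: "subgroup A G" and y: "generates G A y X" and R: "R \<subseteq> words_on X" "\<And>r. r \<in> R \<Longrightarrow> ev G y r = \<one>"
    and F: "F \<in> homs G A (pres_group X R)" "\<And>x. x \<in> X \<Longrightarrow> F (y x) = pgen X R x"
  shows "presents G A y X R"
proof -
  interpret homs_on G "pres_group X R" A F
    by (rule homs_onI [OF group_pres_group A F(1)])
  have "pres_eq R w []" if w: "w \<in> words_on X" "ev G y w = \<one>" for w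
  proof -
    have "\<one>\<^bsub>pres_group X R\<^esub> = ev (pres_group X R) (F \<circ> y) w"
      using ev [OF generatesD(1) [OF y] w(1)] w(2) by simp
    also have "\<dots> = pres_class X R w"
      using ev_cong [of X "F \<circ> y" "pgen X R" w "pres_group X R"] w(1) assms(6) by (simp add: ev_pgen)
    finally show ?thesis using w(1) by (simp add: pres_group_one pres_class_eq_iff pres_sym)
  qed
  then show ?thesis using y R by (auto simp: presents_def)
qed

lemma homs_eq:
  assumes A: "subgroup A G" and y: "generates G A y X" and E: "group E"
    and F: "F \<in> homs G A E" "F' \<in> homs G A E" "\<And>x. x \<in> X \<Longrightarrow> F (y x) = F' (y x)" and g: "g \<in> A"
  shows "F g = F' g"
proof -
  obtain w where w: "w \<in> words_on X" "ev G y w = g" using generatesD(2) [OF y g] by auto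
  have "F (ev G y w) = F' (ev G y w)"
    using homs_on.ev [OF homs_onI [OF E A F(1)] generatesD(1) [OF y] w(1)]
      homs_on.ev [OF homs_onI [OF E A F(2)] generatesD(1) [OF y] w(1)] F(3) w(1)
      ev_cong [of X "F \<circ> y" "F' \<circ> y" w E] by simp
  then show ?thesis using w by simp
qed

lemma subgroup_ev:
  assumes "y ` X \<subseteq> carrier G"
  shows "subgroup (ev G y ` words_on X) G"
proof (rule subgroupI)
  show "ev G y ` words_on X \<subseteq> carrier G" using assms by (auto simp: ev_in_carrier)
  show "ev G y ` words_on X \<noteq> {}" using words_on_simps(1) by blast
  fix a assume "a \<in> ev G y ` words_on X"
  then obtain u where u: "u \<in> words_on X" "a = ev G y u" by auto
  then show "inv a \<in> ev G y ` words_on X"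
    by (metis assms ev_inv_word imageI inv_word_words_on)
  fix b assume "b \<in> ev G y ` words_on X"
  then obtain v where v: "v \<in> words_on X" "b = ev G y v" by auto
  have "a \<otimes> b = ev G y (u @ v)" using u v assms by (simp add: ev_append)
  then show "a \<otimes> b \<in> ev G y ` words_on X" using u v by auto
qed

lemma generates_subset:
  assumes "generates G A y X" "subgroup B G" "y ` X \<subseteq> B"
  shows "A \<subseteq> B"
proof
  fix g assume "g \<in> A"
  then obtain w where "w \<in> words_on X" "ev G y w = g" using generatesD(2) [OF assms(1)] by blast
  then show "g \<in> B" using ev_closed [OF assms(2,3)] by blast
qed

lemma generatesI:
  assumes "subgroup A G" "y ` X \<subseteq> A" "\<And>B. subgroup B G \<Longrightarrow> y ` X \<subseteq> B \<Longrightarrow> A \<subseteq> B"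
  shows "generates G A y X"
proof -
  have yX: "y ` X \<subseteq> carrier G" using assms subgroup.subset by blast
  have "y ` X \<subseteq> ev G y ` words_on X"
  proof
    fix g assume "g \<in> y ` X"
    then obtain x where "x \<in> X" "g = y x" by auto
    then have "g = ev G y [(False, x)]" "[(False, x)] \<in> words_on X" using yX by auto
    then show "g \<in> ev G y ` words_on X" by blast
  qed
  then have "A \<subseteq> ev G y ` words_on X"
    using assms(3) [OF subgroup_ev [OF yX]] by auto
  then show ?thesis using assms(2) by (auto simp: generates_def)
qed

end

lemma presents_pres_group:
  assumes "R \<subseteq> words_on X"
  shows "presents (pres_group X R) (carrier (pres_group X R)) (pgen X R) X R"
proof -
  have "pres_eq R w []" if "w \<in> words_on X" "ev (pres_group X R) (pgen X R) w = \<one>\<^bsub>pres_group X R\<^esub>" for w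
    using that by (simp add: ev_pgen pres_group_one pres_class_eq_iff)
  moreover have "ev (pres_group X R) (pgen X R) r = \<one>\<^bsub>pres_group X R\<^esub>" if "r \<in> R" for r
    using that assms by (simp add: ev_pgen pres_group_one pres_class_eq_iff pres_eq_relator subset_eq)
  moreover have "\<exists>w\<in>words_on X. ev (pres_group X R) (pgen X R) w = g" if "g \<in> carrier (pres_group X R)" for g
    using that by (auto elim!: pres_group_cases simp: ev_pgen)
  ultimately show ?thesis using assms by (auto simp: presents_def generates_def)
qed

lemma pres_eq_rename:
  assumes "pres_eq R u v"
  shows "pres_eq (rename b ` R) (rename b u) (rename b v)"
  using assms
proof induction
  case (pres_cancel u a v)
  have "(fst (inv_letter a), b (snd (inv_letter a))) = inv_letter (fst a, b (snd a))"
    by (simp add: inv_letter_def)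
  then show ?case using pres_eq.pres_cancel [of "rename b ` R" "rename b u" "(fst a, b (snd a))" "rename b v"]
    by simp
next
  case (pres_rel r u v)
  then show ?case using pres_eq.pres_rel [of "rename b r" "rename b ` R" "rename b u" "rename b v"] by simp
qed (auto intro: pres_eq.intros)

lemma generates_rename:
  assumes "inj_on b X" "generates G A y X"
  shows "generates G A (y \<circ> inv_into X b) (b ` X)"
proof -
  have "\<exists>w\<in>words_on (b ` X). ev G (y \<circ> inv_into X b) w = g" if g: "g \<in> A" for g
  proof -
    obtain w where w: "w \<in> words_on X" "ev G y w = g" using generatesD(2) [OF assms(2) g] by auto
    have "rename b w \<in> words_on (b ` X)" using w by (auto intro: rename_words_on)
    moreover have "ev G (y \<circ> inv_into X b) (rename b w) = g"
      using w rename_inv [OF assms(1) w(1)] by (metis ev_rename)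
    ultimately show ?thesis by auto
  qed
  then show ?thesis using assms by (auto simp: generates_def)
qed

lemma presents_rename:
  assumes b: "inj_on b X" and P: "presents G A y X R"
  shows "presents G A (y \<circ> inv_into X b) (b ` X) (rename b ` R)"
proof -
  have ev: "ev G (y \<circ> inv_into X b) (rename b w) = ev G y w" if "w \<in> words_on X" for w
    using rename_inv [OF b that] by (metis ev_rename)
  have "pres_eq (rename b ` R) w []" if w: "w \<in> words_on (b ` X)" "ev G (y \<circ> inv_into X b) w = \<one>\<^bsub>G\<^esub>" for w
  proof -
    let ?u = "rename (inv_into X b) w"
    have u: "?u \<in> words_on X" using w(1) b by (auto intro!: rename_words_on [OF w(1)])
    have "rename b ?u = w" using w(1)
      by (induction w) (auto simp: f_inv_into_f)
    moreover have "pres_eq R ?u []"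
      using presentsD(5) [OF P u] w(2) by (simp add: ev_rename)
    ultimately show ?thesis using pres_eq_rename [of R ?u "[]" b] by simp
  qed
  moreover have "rename b ` R \<subseteq> words_on (b ` X)"
    using presentsD(3) [OF P] by (auto intro: rename_words_on)
  moreover have "ev G (y \<circ> inv_into X b) r = \<one>\<^bsub>G\<^esub>" if "r \<in> rename b ` R" for r
    using that ev presentsD(3,4) [OF P] by auto
  ultimately show ?thesis
    using generates_rename [OF b presentsD(1) [OF P]] by (auto simp: presents_def)
qed

text \<open>Generators are indexed by natural numbers because a definition cannot quantify over
  types; \<open>rank_leI\<close> and \<open>cost_leI\<close> rename any finite index set.\<close>

definition rank_le :: "('g, 'm) monoid_scheme \<Rightarrow> 'g set \<Rightarrow> nat \<Rightarrow> bool" where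
  "rank_le G A d \<longleftrightarrow> (\<exists>(X::nat set) y. finite X \<and> card X \<le> d \<and> generates G A y X)"

definition cost_le :: "('g, 'm) monoid_scheme \<Rightarrow> 'g set \<Rightarrow> nat \<Rightarrow> bool" where
  "cost_le G A c \<longleftrightarrow> (\<exists>(X::nat set) R y. finite X \<and> finite R \<and> card X + card R \<le> c \<and> presents G A y X R)"

lemma rank_leI:
  assumes "finite X" "card X \<le> d" "generates G A y X"
  shows "rank_le G A d"
proof -
  obtain b :: "'a \<Rightarrow> nat" where b: "inj_on b X" using assms(1) finite_imp_inj_to_nat_seg by blast
  show ?thesis unfolding rank_le_def
    using generates_rename [OF b assms(3)] assms(1,2) card_image [OF b] by (metis finite_imageI)
qed

lemma cost_leI:
  assumes "finite X" "finite R" "card X + card R \<le> c" "presents G A y X R"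
  shows "cost_le G A c"
proof -
  obtain b :: "'a \<Rightarrow> nat" where b: "inj_on b X" using assms(1) finite_imp_inj_to_nat_seg by blast
  have "card (rename b ` R) \<le> card R" using assms(2) by (rule card_image_le)
  then show ?thesis unfolding cost_le_def
    using presents_rename [OF b assms(4)] assms(1,2,3) card_image [OF b]
    by (metis (no_types, lifting) add_le_mono1 finite_imageI le_trans nat_add_left_cancel_le)
qed

lemma cost_le_mono: "cost_le G A c \<Longrightarrow> c \<le> c' \<Longrightarrow> cost_le G A c'"
  unfolding cost_le_def by (meson le_trans)

lemma cost_le_rank_le: "cost_le G A c \<Longrightarrow> rank_le G A c"
  unfolding cost_le_def rank_le_def by (meson add_leD1 presentsD(1))

context group
begin

lemma generates_image:
  assumes A: "subgroup A G" and E: "group E" and h: "h \<in> homs G A E" and P: "generates G A y X"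
  shows "generates E (h ` A) (h \<circ> y) X"
proof -
  interpret homs_on G E A h by (rule homs_onI [OF E A h])
  show ?thesis using P ev [OF generatesD(1) [OF P]]
    by (fastforce simp: generates_def)
qed

lemma presents_image:
  assumes A: "subgroup A G" and E: "group E" and h: "h \<in> homs G A E" "inj_on h A"
    and P: "presents G A y X R"
  shows "presents E (h ` A) (h \<circ> y) X R"
proof -
  interpret homs_on G E A h by (rule homs_onI [OF E A h(1)])
  have e: "ev E (h \<circ> y) w = \<one>\<^bsub>E\<^esub> \<longleftrightarrow> ev G y w = \<one>" if "w \<in> words_on X" for w
    using ev [OF presentsD(2) [OF P] that, symmetric] ev_closed [OF A presentsD(2) [OF P] that]
      subgroup.one_closed [OF A] h(2) one by (metis inj_on_eq_iff)
  show ?thesis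
    using generates_image [OF A E h(1) presentsD(1) [OF P]] presentsD(3,4,5) [OF P] e
    by (fastforce simp: presents_def)
qed

lemma cost_le_image:
  assumes "subgroup A G" "group E" "h \<in> homs G A E" "inj_on h A" "cost_le G A c"
  shows "cost_le E (h ` A) c"
proof -
  obtain X :: "nat set" and R y where "finite X" "finite R" "card X + card R \<le> c" "presents G A y X R"
    using assms(5) by (auto simp: cost_le_def)
  then show ?thesis using presents_image [OF assms(1-4)] by (intro cost_leI)
qed

lemma rank_le_image:
  assumes "subgroup A G" "group E" "h \<in> homs G A E" "rank_le G A c"
  shows "rank_le E (h ` A) c"
proof -
  obtain X :: "nat set" and y where "finite X" "card X \<le> c" "generates G A y X"
    using assms(4) by (auto simp: rank_le_def)
  then show ?thesis using generates_image [OF assms(1-3)] by (intro rank_leI)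
qed

end

section \<open>Ascending HNN extensions\<close>

text \<open>An internal description of an ascending HNN extension with base \<open>B\<close> and
  stable letter \<open>t\<close>: conjugation by \<open>t\<close> is an endomorphism of
  \<open>B\<close>, every element has the normal form of such an extension, and \<open>t\<close> has
  infinite order modulo \<open>B\<close>. The universal property is derived in
  \<open>asc_hom\<close>.\<close>

definition asc :: "('g, 'm) monoid_scheme \<Rightarrow> 'g set \<Rightarrow> 'g set \<Rightarrow> 'g \<Rightarrow> bool" where
  "asc G A B t \<longleftrightarrow> subgroup A G \<and> subgroup B G \<and> B \<subseteq> A \<and> t \<in> A \<and>
     (\<forall>b\<in>B. inv\<^bsub>G\<^esub> t \<otimes>\<^bsub>G\<^esub> b \<otimes>\<^bsub>G\<^esub> t \<in> B) \<and>
     (\<forall>g\<in>A. \<exists>(i::nat) (j::nat). \<exists>b\<in>B. g = t [^]\<^bsub>G\<^esub> i \<otimes>\<^bsub>G\<^esub> b \<otimes>\<^bsub>G\<^esub> inv\<^bsub>G\<^esub> (t [^]\<^bsub>G\<^esub> j)) \<and>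
     (\<forall>k::nat. k > 0 \<longrightarrow> t [^]\<^bsub>G\<^esub> k \<notin> B)"

lemma ascD:
  assumes "asc G A B t"
  shows "subgroup A G" "subgroup B G" "B \<subseteq> A" "t \<in> A"
    "b \<in> B \<Longrightarrow> inv\<^bsub>G\<^esub> t \<otimes>\<^bsub>G\<^esub> b \<otimes>\<^bsub>G\<^esub> t \<in> B"
    "k > 0 \<Longrightarrow> t [^]\<^bsub>G\<^esub> (k::nat) \<notin> B"
  using assms by (auto simp: asc_def)

lemma ascE:
  assumes "asc G A B t" "g \<in> A"
  obtains i j :: nat and b where "b \<in> B" "g = t [^]\<^bsub>G\<^esub> i \<otimes>\<^bsub>G\<^esub> b \<otimes>\<^bsub>G\<^esub> inv\<^bsub>G\<^esub> (t [^]\<^bsub>G\<^esub> j)"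
  using assms by (auto simp: asc_def)

lemma asc_carrier:
  assumes "asc G A B t"
  shows "t \<in> carrier G" "b \<in> B \<Longrightarrow> b \<in> carrier G" "a \<in> A \<Longrightarrow> a \<in> carrier G"
  using assms by (auto simp: asc_def subgroup.mem_carrier)

context group
begin

lemma conj_hom:
  assumes "t \<in> carrier G" "a \<in> carrier G" "b \<in> carrier G"
  shows "inv t \<otimes> (a \<otimes> b) \<otimes> t = (inv t \<otimes> a \<otimes> t) \<otimes> (inv t \<otimes> b \<otimes> t)"
  using assms by (simp add: group_word)

lemma conj_pow_Suc:
  assumes "t \<in> carrier G" "b \<in> carrier G"
  shows "inv (t [^] Suc k) \<otimes> b \<otimes> t [^] Suc k = inv t \<otimes> (inv (t [^] k) \<otimes> b \<otimes> t [^] k) \<otimes> t"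
  using assms by (simp add: group_word)

lemma conj_pow_mem:
  assumes "subgroup B G" "t \<in> carrier G" "\<And>b. b \<in> B \<Longrightarrow> inv t \<otimes> b \<otimes> t \<in> B" "b \<in> B"
  shows "inv (t [^] (k::nat)) \<otimes> b \<otimes> t [^] k \<in> B"
proof (induction k)
  case 0
  then show ?case using assms subgroup.mem_carrier by fastforce
next
  case (Suc k)
  then show ?case using assms conj_pow_Suc [of t b k] subgroup.mem_carrier [of B G b] by simp
qed

lemma rep_shift:
  assumes "t \<in> carrier G" "b \<in> carrier G"
  shows "t [^] (i::nat) \<otimes> b \<otimes> inv (t [^] (j::nat)) =
    t [^] (i + p) \<otimes> (inv (t [^] (p::nat)) \<otimes> b \<otimes> t [^] p) \<otimes> inv (t [^] (j + p))"
  using assms by (simp add: group_word flip: nat_pow_mult)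

lemma rep_mult:
  assumes "t \<in> carrier G" "b \<in> carrier G" "b' \<in> carrier G"
  shows "(t [^] (i::nat) \<otimes> b \<otimes> inv (t [^] (j::nat))) \<otimes> (t [^] (i'::nat) \<otimes> b' \<otimes> inv (t [^] (j'::nat))) =
    t [^] (i + i') \<otimes> ((inv (t [^] i') \<otimes> b \<otimes> t [^] i') \<otimes> (inv (t [^] j) \<otimes> b' \<otimes> t [^] j)) \<otimes> inv (t [^] (j' + j))"
proof -
  have "t [^] j \<otimes> t [^] i' = t [^] i' \<otimes> t [^] j"
    using assms(1) by (simp add: nat_pow_mult add.commute)
  then have "t [^] j \<otimes> t [^] i' \<otimes> inv (t [^] j) = t [^] i'"
    using assms(1) by (simp add: m_assoc)
  then have "inv (t [^] j) \<otimes> (t [^] j \<otimes> t [^] i' \<otimes> inv (t [^] j)) = inv (t [^] j) \<otimes> t [^] i'"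
    by simp
  then have c: "t [^] i' \<otimes> inv (t [^] j) = inv (t [^] j) \<otimes> t [^] i'"
    using assms(1) by (simp add: group_word)
  have "t [^] i' \<otimes> (inv (t [^] j) \<otimes> z) = inv (t [^] j) \<otimes> (t [^] i' \<otimes> z)" if "z \<in> carrier G" for z
    using c that assms(1) by (simp flip: m_assoc)
  then show ?thesis using assms by (simp add: group_word flip: nat_pow_mult)
qed

text \<open>Cancelling leaves a power of \<open>t\<close> equal to an element of \<open>B\<close>,
  which the last clause of \<open>asc\<close> permits for exponent 0 only. So the padding of
  \<open>rep_shift\<close> is the sole ambiguity of the normal form.\<close>

lemma asc_unique:
  assumes a: "asc G A B t" and b: "b \<in> B" "b' \<in> B" and "i \<le> i'"
    and eq: "t [^] (i::nat) \<otimes> b \<otimes> inv (t [^] (j::nat)) = t [^] (i'::nat) \<otimes> b' \<otimes> inv (t [^] (j'::nat))"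
  shows "j' = j + (i' - i) \<and> b' = inv (t [^] (i' - i)) \<otimes> b \<otimes> t [^] (i' - i)"
proof -
  note c [simp] = asc_carrier(1,2) [OF a]
  define p where "p = i' - i"
  define b2 where "b2 = inv (t [^] p) \<otimes> b \<otimes> t [^] p"
  have b2: "b2 \<in> B" unfolding b2_def using conj_pow_mem [OF ascD(2) [OF a] c(1) ascD(5) [OF a] b(1)] by simp
  have i': "i' = i + p" using assms by (simp add: p_def)
  have "t [^] i' \<otimes> b2 \<otimes> inv (t [^] (j + p)) = t [^] i' \<otimes> b' \<otimes> inv (t [^] j')"
    using eq rep_shift [of t b i j p] b by (simp add: i' b2_def)
  then have eq2: "b2 \<otimes> inv (t [^] (j + p)) = b' \<otimes> inv (t [^] j')"
    using b b2 by (simp add: m_assoc)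
  then have "inv b' \<otimes> (b2 \<otimes> inv (t [^] (j + p))) \<otimes> t [^] (j + p) = inv b' \<otimes> (b' \<otimes> inv (t [^] j')) \<otimes> t [^] (j + p)"
    by simp
  then have q: "inv b' \<otimes> b2 = inv (t [^] j') \<otimes> t [^] (j + p)"
    using b b2 by (simp add: m_assoc)
  have qB: "inv b' \<otimes> b2 \<in> B"
    using b b2 ascD(2) [OF a] by (simp add: subgroup.m_closed subgroup.m_inv_closed)
  have "\<not> j' < j + p"
  proof
    assume l: "j' < j + p"
    then have "t [^] (j + p) = t [^] j' \<otimes> t [^] (j + p - j')" by (simp add: nat_pow_mult)
    then have "inv b' \<otimes> b2 = t [^] (j + p - j')" using q by simp
    then show False using qB ascD(6) [OF a, of "j + p - j'"] l by simp
  qed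
  moreover have "\<not> j + p < j'"
  proof
    assume l: "j + p < j'"
    then have "t [^] j' = t [^] (j + p) \<otimes> t [^] (j' - (j + p))" by (simp add: nat_pow_mult)
    then have "inv b' \<otimes> b2 = inv (t [^] (j' - (j + p)))" using q by (simp add: group_word)
    then have "inv (inv b' \<otimes> b2) = t [^] (j' - (j + p))" by simp
    then show False using subgroup.m_inv_closed [OF ascD(2) [OF a] qB] ascD(6) [OF a, of "j' - (j + p)"] l by simp
  qed
  ultimately have j': "j' = j + p" by simp
  then have "inv b' \<otimes> b2 = \<one>" using q by simp
  then have "b' \<otimes> (inv b' \<otimes> b2) = b'" using b by simp
  then have "b' = b2" using b b2 by simp
  then show ?thesis using j' by (simp add: p_def b2_def)
qed

end

context group
begin

text \<open>The universal property of an HNN extension. The value on a normal form is forced;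
  \<open>asc_unique\<close> makes it well defined, and \<open>rep_mult\<close> describes products in
  the same way on both sides.\<close>

theorem asc_hom:
  assumes a: "asc G A B t" and E: "group E" and f: "f \<in> homs G B E" and s: "s \<in> carrier E"
    and fs: "\<And>b. b \<in> B \<Longrightarrow> inv\<^bsub>E\<^esub> s \<otimes>\<^bsub>E\<^esub> f b \<otimes>\<^bsub>E\<^esub> s = f (inv t \<otimes> b \<otimes> t)"
  obtains F where "F \<in> homs G A E" "\<And>b. b \<in> B \<Longrightarrow> F b = f b" "F t = s"
proof -
  interpret E: group E by fact
  interpret f: homs_on G E B f using homs_onI [OF E ascD(2) [OF a] f] .
  note c [simp] = asc_carrier [OF a] and s [simp]
  have Bpow: "inv (t [^] p) \<otimes> b \<otimes> t [^] p \<in> B" if "b \<in> B" for b and p :: nat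
    using conj_pow_mem [OF ascD(2) [OF a] c(1) ascD(5) [OF a] that] by simp
  define rep where "rep i b j = t [^] i \<otimes> b \<otimes> inv (t [^] j)" for i j :: nat and b
  define val where "val i b j = s [^]\<^bsub>E\<^esub> i \<otimes>\<^bsub>E\<^esub> f b \<otimes>\<^bsub>E\<^esub> inv\<^bsub>E\<^esub> (s [^]\<^bsub>E\<^esub> j)" for i j :: nat and b
  have fpow: "f (inv (t [^] p) \<otimes> b \<otimes> t [^] p) = inv\<^bsub>E\<^esub> (s [^]\<^bsub>E\<^esub> p) \<otimes>\<^bsub>E\<^esub> f b \<otimes>\<^bsub>E\<^esub> s [^]\<^bsub>E\<^esub> p"
    if "b \<in> B" for p :: nat and b
  proof (induction p)
    case 0
    then show ?case using that by simp
  next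
    case (Suc p)
    show ?case
      using Suc that fs [OF Bpow [OF that, of p]] conj_pow_Suc [of t b p] E.conj_pow_Suc [of s "f b" p] by simp
  qed
  have val_shift: "val i b j = val i' b' j'" if "b \<in> B" "b' \<in> B" "i \<le> i'" "rep i b j = rep i' b' j'" for i b j i' b' j'
    using asc_unique [OF a that(1-3) that(4) [unfolded rep_def]] E.rep_shift [of s "f b" i j "i' - i"] that(1,3) fpow
    by (simp add: val_def)
  have val: "val i b j = val i' b' j'" if "b \<in> B" "b' \<in> B" "rep i b j = rep i' b' j'" for i b j i' b' j'
    using val_shift [of b b' i i' j j'] val_shift [of b' b i' i j' j] that by (cases "i \<le> i'") auto
  define F where "F g = (SOME e. \<exists>i j b. b \<in> B \<and> g = rep i b j \<and> e = val i b j)" for g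
  have Fev: "F (rep i b j) = val i b j" if "b \<in> B" for i b j
    unfolding F_def
  proof (rule some_equality)
    show "\<exists>i' j' b'. b' \<in> B \<and> rep i b j = rep i' b' j' \<and> val i b j = val i' b' j'"
      using that by blast
    fix e assume "\<exists>i' j' b'. b' \<in> B \<and> rep i b j = rep i' b' j' \<and> e = val i' b' j'"
    then show "e = val i b j" using val [OF that] by metis
  qed
  have valc: "val i b j \<in> carrier E" if "b \<in> B" for i b j
    using that by (simp add: val_def)
  have "F \<in> homs G A E"
  proof -
    have "F g \<in> carrier E" if "g \<in> A" for g
      using ascE [OF a that] Fev valc by (metis rep_def)
    moreover have "F (g \<otimes> h) = F g \<otimes>\<^bsub>E\<^esub> F h" if "g \<in> A" "h \<in> A" for g h
    proof -
      obtain i j b where b: "b \<in> B" "g = rep i b j" using ascE [OF a \<open>g \<in> A\<close>] by (metis rep_def)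
      obtain i' j' b' where b': "b' \<in> B" "h = rep i' b' j'" using ascE [OF a \<open>h \<in> A\<close>] by (metis rep_def)
      let ?x = "inv (t [^] i') \<otimes> b \<otimes> t [^] i'" and ?x' = "inv (t [^] j) \<otimes> b' \<otimes> t [^] j"
      have x: "?x \<in> B" "?x' \<in> B" using Bpow b b' by auto
      have "g \<otimes> h = rep (i + i') (?x \<otimes> ?x') (j' + j)"
        using rep_mult [of t b b' i j i' j'] b b' by (simp add: rep_def)
      then have "F (g \<otimes> h) = val (i + i') (?x \<otimes> ?x') (j' + j)"
        using Fev x subgroup.m_closed [OF ascD(2) [OF a]] by simp
      also have "\<dots> = val i b j \<otimes>\<^bsub>E\<^esub> val i' b' j'"
        using E.rep_mult [of s "f b" "f b'" i j i' j'] b(1) b'(1) f.mult [OF x] fpow [OF b(1)] fpow [OF b'(1)]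
        by (simp add: val_def)
      finally show ?thesis using Fev b b' by simp
    qed
    ultimately show ?thesis by (auto simp: homs_def)
  qed
  moreover have "F b = f b" if "b \<in> B" for b
    using Fev [OF that, of 0 0] that by (simp add: rep_def val_def)
  moreover have "F t = s"
    using Fev [of \<one> 1 0] subgroup.one_closed [OF ascD(2) [OF a]] by (simp add: rep_def val_def)
  ultimately show ?thesis using that by auto
qed

lemma asc_subset:
  assumes a: "asc G A B t" and "subgroup H G" "B \<subseteq> H" "t \<in> H"
  shows "A \<subseteq> H"
proof
  fix g assume "g \<in> A"
  then obtain i j b where "b \<in> B" "g = t [^] (i::nat) \<otimes> b \<otimes> inv (t [^] (j::nat))" using ascE [OF a] by metis
  then show "g \<in> H"
    using assms(2-4) pow_mem [OF assms(2,4)] by (auto intro!: subgroup.m_closed subgroup.m_inv_closed)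
qed

lemma generates_add:
  assumes y: "generates G B y X" and "subgroup B G" "subgroup A G" "B \<subseteq> A" "t \<in> A"
    and "\<And>H. subgroup H G \<Longrightarrow> B \<subseteq> H \<Longrightarrow> t \<in> H \<Longrightarrow> A \<subseteq> H"
  shows "generates G A (case_option t y) (insert None (Some ` X))"
proof (rule generatesI [OF assms(3)])
  show "case_option t y ` insert None (Some ` X) \<subseteq> A"
    using subset_trans [OF generatesD(1) [OF y] assms(4)] assms(5) by (auto simp: image_subset_iff)
  fix H assume H: "subgroup H G" "case_option t y ` insert None (Some ` X) \<subseteq> H"
  then have "y ` X \<subseteq> H" "t \<in> H" by (auto simp: image_subset_iff)
  then show "A \<subseteq> H" using assms(6) [OF H(1)] generates_subset [OF y H(1)] by blast
qed

lemma rank_le_add: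
  assumes "rank_le G B d" "subgroup B G" "subgroup A G" "B \<subseteq> A" "t \<in> A"
    and "\<And>H. subgroup H G \<Longrightarrow> B \<subseteq> H \<Longrightarrow> t \<in> H \<Longrightarrow> A \<subseteq> H"
  shows "rank_le G A (Suc d)"
proof -
  obtain X :: "nat set" and y where X: "finite X" "card X \<le> d" "generates G B y X"
    using assms(1) by (auto simp: rank_le_def)
  show ?thesis
  proof (rule rank_leI)
    show "generates G A (case_option t y) (insert None (Some ` X))"
      using generates_add [OF X(3) assms(2-6)] .
  qed (use X in \<open>auto simp: card_image\<close>)
qed

lemma asc_rank:
  assumes a: "asc G A B t" and "rank_le G B d"
  shows "rank_le G A (Suc d)"
  using rank_le_add [OF assms(2) ascD(2) [OF a] ascD(1) [OF a] ascD(3) [OF a] ascD(4) [OF a] asc_subset [OF a]] .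

end

lemma pgen_relator:
  assumes "r \<in> R" "r \<in> words_on X" shows "ev (pres_group X R) (pgen X R) r = \<one>\<^bsub>pres_group X R\<^esub>"
  using assms by (simp add: ev_pgen pres_group_one pres_class_eq_iff pres_eq_relator)

context group
begin

lemma relator_eq:
  assumes "range y \<subseteq> carrier G" "ev G y (u @ inv_word v) = \<one>"
  shows "ev G y u = ev G y v"
proof -
  have "ev G y u \<otimes> inv (ev G y v) \<otimes> ev G y v = ev G y v"
    using assms by (simp add: ev_append [OF assms(1)] ev_inv_word [OF assms(1)])
  then show ?thesis using assms(1) by (simp add: m_assoc)
qed

lemma conj_homs:
  assumes "f \<in> homs G' B G" "s \<in> carrier G"
  shows "(\<lambda>b. inv s \<otimes> f b \<otimes> s) \<in> homs G' B G"
  using assms by (auto simp: homs_def conj_hom [OF assms(2)] image_subset_iff simp del: m_assoc)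

lemma precomp_conj_homs:
  assumes "group E" "f \<in> homs G B E" "t \<in> carrier G" "subgroup B G" "\<And>b. b \<in> D \<Longrightarrow> inv t \<otimes> b \<otimes> t \<in> B"
    "D \<subseteq> carrier G"
  shows "(\<lambda>b. f (inv t \<otimes> b \<otimes> t)) \<in> homs G D E"
proof -
  have "f (inv t \<otimes> (a \<otimes> b) \<otimes> t) = f (inv t \<otimes> a \<otimes> t) \<otimes>\<^bsub>E\<^esub> f (inv t \<otimes> b \<otimes> t)" if "a \<in> D" "b \<in> D" for a b
    using conj_hom [OF assms(3), of a b] that assms(2,5,6) by (auto simp: homs_def subset_iff)
  then show ?thesis using assms(2,5) by (auto simp: homs_def)
qed

end

context group
begin

text \<open>One generator \<open>t\<close> is added and, for each generator of \<open>B\<close>, one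
  relator that spells its conjugate by \<open>t\<close>; together at most \<open>c + 1\<close>
  more.\<close>

lemma asc_cost:
  assumes a: "asc G A B t" and "cost_le G B c"
  shows "cost_le G A (2 * c + 1)"
proof -
  obtain X :: "nat set" and R y where X: "finite X" "finite R" "card X + card R \<le> c" and P: "presents G B y X R"
    using assms(2) by (auto simp: cost_le_def)
  note c [simp] = asc_carrier [OF a] and B = ascD(2) [OF a]
  have yB: "y x \<in> B" if "x \<in> X" for x using presentsD(2) [OF P] that by auto
  then have "\<forall>x\<in>X. \<exists>w\<in>words_on X. ev G y w = inv t \<otimes> y x \<otimes> t"
    using presentsD(6) [OF P] ascD(5) [OF a] by blast
  then obtain w where w: "\<And>x. x \<in> X \<Longrightarrow> w x \<in> words_on X \<and> ev G y (w x) = inv t \<otimes> y x \<otimes> t"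
    by metis
  define X' where "X' = insert None (Some ` X)"
  define y' where "y' = case_option t y"
  define rel where "rel x = [(True, None), (False, Some x), (False, None)] @ inv_word (rename Some (w x))" for x
  define R' where "R' = rename Some ` R \<union> rel ` X"
  let ?E = "pres_group X' R'"
  interpret E: group ?E by (rule group_pres_group)
  define e where "e = pgen X' R'"
  have e: "range e \<subseteq> carrier ?E" by (auto simp: e_def)
  then have ec [simp]: "e x \<in> carrier ?E" for x by auto
  have sub: "rename Some r \<in> words_on X'" if "r \<in> words_on X" for r
    using that by (auto simp: X'_def intro: rename_words_on)
  have R': "R' \<subseteq> words_on X'"
    using sub presentsD(3) [OF P] w by (auto simp: R'_def rel_def X'_def)
  have rel1: "ev ?E e r = \<one>\<^bsub>?E\<^esub>" if "r \<in> R'" for r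
    using pgen_relator [of r R' X'] that R' by (auto simp: e_def)
  obtain f where f: "f \<in> homs G B ?E" "\<And>x. x \<in> X \<Longrightarrow> f (y x) = e (Some x)"
      "\<And>w. w \<in> words_on X \<Longrightarrow> f (ev G y w) = ev ?E (e \<circ> Some) w"
  proof (rule presents_hom [OF B P group_pres_group, of "e \<circ> Some" X' R'])
    fix r assume "r \<in> R"
    then show "ev ?E (e \<circ> Some) r = \<one>\<^bsub>?E\<^esub>"
      using rel1 [of "rename Some r"] by (simp add: R'_def ev_rename)
  qed auto
  \<comment> \<open>Both sides are homomorphisms in \<open>b\<close>, so it suffices that the
    relators give the identity on generators.\<close>
  have fs: "inv\<^bsub>?E\<^esub> (e None) \<otimes>\<^bsub>?E\<^esub> f b \<otimes>\<^bsub>?E\<^esub> e None = f (inv t \<otimes> b \<otimes> t)" if "b \<in> B" for b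
  proof (rule homs_eq [OF B presentsD(1) [OF P] group_pres_group _ _ _ that])
    show "(\<lambda>b. inv\<^bsub>?E\<^esub> (e None) \<otimes>\<^bsub>?E\<^esub> f b \<otimes>\<^bsub>?E\<^esub> e None) \<in> homs G B ?E"
      by (rule E.conj_homs [OF f(1)]) simp
    show "(\<lambda>b. f (inv t \<otimes> b \<otimes> t)) \<in> homs G B ?E"
      by (rule precomp_conj_homs [OF group_pres_group f(1) c(1) B ascD(5) [OF a] subgroup.subset [OF B]])
    fix x assume x: "x \<in> X"
    have "ev ?E e [(True, None), (False, Some x), (False, None)] = ev ?E e (rename Some (w x))"
      using rel1 [of "rel x"] x by (intro E.relator_eq [OF e]) (auto simp: R'_def rel_def)
    then show "inv\<^bsub>?E\<^esub> (e None) \<otimes>\<^bsub>?E\<^esub> f (y x) \<otimes>\<^bsub>?E\<^esub> e None = f (inv t \<otimes> y x \<otimes> t)"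
      using f(2) [OF x] f(3) [of "w x"] w [OF x] by (simp add: ev_rename E.m_assoc)
  qed
  obtain F where F: "F \<in> homs G A ?E" "\<And>b. b \<in> B \<Longrightarrow> F b = f b" "F t = e None"
    using asc_hom [OF a group_pres_group f(1) _ fs] by (metis ec)
  have gen: "generates G A y' X'"
    unfolding y'_def X'_def
    using generates_add [OF presentsD(1) [OF P] B ascD(1,3,4) [OF a] asc_subset [OF a]] .
  have y'X: "y' ` X' \<subseteq> carrier G" using generatesD(1) [OF gen] by auto
  have y'S: "y' \<circ> Some = y" by (auto simp: y'_def)
  have ev1: "ev G y' r = \<one>" if "r \<in> R'" for r
    using that unfolding R'_def
  proof
    assume "r \<in> rename Some ` R"
    then show ?thesis using presentsD(4) [OF P] by (auto simp: ev_rename y'S)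
  next
    assume "r \<in> rel ` X"
    then obtain x where x: "x \<in> X" "r = rel x" by auto
    have 1: "[(True, None), (False, Some x), (False, None)] \<in> words_on X'" using x by (simp add: X'_def)
    have "ev G y' (rename Some (w x)) = inv t \<otimes> y x \<otimes> t"
      using w [OF x(1)] by (simp add: ev_rename y'S)
    moreover have "ev G y' [(True, None), (False, Some x), (False, None)] = inv t \<otimes> y x \<otimes> t"
      using yB [OF x(1)] by (simp add: y'_def m_assoc)
    ultimately show ?thesis
      unfolding x(2) rel_def using ev_append [OF y'X 1, of "inv_word (rename Some (w x))"]
        ev_inv_word [OF y'X sub] w [OF x(1)] sub yB [OF x(1)] by simp
  qed
  have "presents G A y' X' R'"
  proof (rule presentsI [OF ascD(1) [OF a] gen R' ev1 F(1)])
    fix x assume "x \<in> X'"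
    then show "F (y' x) = pgen X' R' x"
      using F f(2) yB by (auto simp: X'_def y'_def e_def)
  qed
  moreover have "card R' \<le> card R + card X"
    unfolding R'_def using X by (meson add_mono card_Un_le card_image_le le_trans)
  moreover have "card X' = Suc (card X)" using X by (simp add: X'_def card_image)
  ultimately show ?thesis using X by (intro cost_leI [of X' R']) (auto simp: X'_def R'_def)
qed

end

subsection \<open>Restriction to the kernel of a homomorphism\<close>

definition kern :: "'g set \<Rightarrow> ('q, 'n) monoid_scheme \<Rightarrow> ('g \<Rightarrow> 'q) \<Rightarrow> 'g set" where
  "kern A Q \<pi> = {a \<in> A. \<pi> a = \<one>\<^bsub>Q\<^esub>}"

lemma (in group) left_cancel [simp]:
  "x \<in> carrier G \<Longrightarrow> y \<in> carrier G \<Longrightarrow> z \<in> carrier G \<Longrightarrow> x \<otimes> y = x \<otimes> z \<longleftrightarrow> y = z"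
  using cancel_left(1) by metis

context group
begin

lemma subgroup_kern:
  assumes "subgroup A G" "group Q" "\<pi> \<in> homs G A Q"
  shows "subgroup (kern A Q \<pi>) G"
proof -
  interpret Q: group Q by fact
  interpret \<pi>: homs_on G Q A \<pi> by (rule homs_onI [OF assms(2,1,3)])
  show ?thesis
  proof (rule subgroupI)
    show "kern A Q \<pi> \<subseteq> carrier G" using \<pi>.A_carrier by (auto simp: kern_def)
    show "kern A Q \<pi> \<noteq> {}" using subgroup.one_closed [OF assms(1)] \<pi>.one by (auto simp: kern_def)
    fix a assume a: "a \<in> kern A Q \<pi>"
    then show "inv a \<in> kern A Q \<pi>"
      using \<pi>.inv [of a] subgroup.m_inv_closed [OF assms(1), of a] by (simp add: kern_def)
    fix b assume "b \<in> kern A Q \<pi>"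
    then show "a \<otimes> b \<in> kern A Q \<pi>"
      using a \<pi>.mult [of a b] subgroup.m_closed [OF assms(1), of a b] by (simp add: kern_def)
  qed
qed

lemma subgroup_homs_image:
  assumes "subgroup A G" "group Q" "\<pi> \<in> homs G A Q"
  shows "subgroup (\<pi> ` A) Q"
proof -
  interpret Q: group Q by fact
  interpret \<pi>: homs_on G Q A \<pi> by (rule homs_onI [OF assms(2,1,3)])
  show ?thesis
  proof (rule Q.subgroupI)
    show "\<pi> ` A \<subseteq> carrier Q" by auto
    show "\<pi> ` A \<noteq> {}" using subgroup.one_closed [OF assms(1)] by auto
    fix u assume "u \<in> \<pi> ` A"
    then obtain a where a: "a \<in> A" "u = \<pi> a" by auto
    then show "inv\<^bsub>Q\<^esub> u \<in> \<pi> ` A"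
      using \<pi>.inv [of a] subgroup.m_inv_closed [OF assms(1), of a] by force
    fix v assume "v \<in> \<pi> ` A"
    then obtain b where b: "b \<in> A" "v = \<pi> b" by auto
    then show "u \<otimes>\<^bsub>Q\<^esub> v \<in> \<pi> ` A"
      using a \<pi>.mult [of a b] subgroup.m_closed [OF assms(1), of a b] by force
  qed
qed

text \<open>Elements of \<open>B\<close> can be moved to the right past \<open>t\<close> and stay in
  \<open>B\<close>, so all powers of \<open>t\<close> collect on the left.\<close>

lemma twisted_pow:
  assumes "subgroup B G" "t \<in> carrier G" "\<And>b. b \<in> B \<Longrightarrow> inv t \<otimes> b \<otimes> t \<in> B" "g \<in> B"
  shows "\<exists>h\<in>B. (t [^] (m::nat) \<otimes> g) [^] (q::nat) = t [^] (m * q) \<otimes> h"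
proof (induction q)
  case 0
  then show ?case using subgroup.one_closed [OF assms(1)] by (intro bexI [of _ \<one>]) auto
next
  case (Suc q)
  note B = subgroup.mem_carrier [OF assms(1)]
  obtain h where h: "h \<in> B" "(t [^] m \<otimes> g) [^] q = t [^] (m * q) \<otimes> h" using Suc by auto
  have "(t [^] m \<otimes> g) [^] Suc q = t [^] (m * q) \<otimes> h \<otimes> (t [^] m \<otimes> g)" using h by simp
  also have "\<dots> = t [^] (m * q + m) \<otimes> ((inv (t [^] m) \<otimes> h \<otimes> t [^] m) \<otimes> g)"
    using assms(2) B [OF h(1)] B [OF assms(4)] by (simp add: group_word flip: nat_pow_mult)
  finally have "(t [^] m \<otimes> g) [^] Suc q = t [^] (m * Suc q) \<otimes> ((inv (t [^] m) \<otimes> h \<otimes> t [^] m) \<otimes> g)"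
    by (simp add: add.commute)
  moreover have "(inv (t [^] m) \<otimes> h \<otimes> t [^] m) \<otimes> g \<in> B"
    using conj_pow_mem [OF assms(1-3) h(1), of m] assms(1,4) by (simp add: subgroup.m_closed)
  ultimately show ?case by blast
qed

text \<open>If a normal form with exponents \<open>i\<close> and \<open>j\<close> lies in the
  kernel, then the images of the two powers of \<open>t\<close> differ by an element of the image of
  \<open>B\<close>, so \<open>i\<close> and \<open>j\<close> agree modulo \<open>m\<close>. Padding
  makes both exponents multiples of \<open>m\<close>, and then \<open>t [^] m\<close> can be traded
  for \<open>t [^] m \<otimes> g\<close> with corrections in \<open>B\<close>.\<close>

theorem asc_kern:
  assumes a: "asc G A B t" and Q: "group Q" and \<pi>: "\<pi> \<in> homs G A Q" and g: "g \<in> B" and m: "m > 0"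
    and tm: "\<pi> (t [^] (m::nat) \<otimes> g) = \<one>\<^bsub>Q\<^esub>"
    and dvd: "\<And>k. \<pi> (t [^] (k::nat)) \<in> \<pi> ` B \<Longrightarrow> m dvd k"
  shows "asc G (kern A Q \<pi>) (kern B Q \<pi>) (t [^] m \<otimes> g)"
proof -
  interpret Q: group Q by fact
  interpret \<pi>: homs_on G Q A \<pi> by (rule homs_onI [OF Q ascD(1) [OF a] \<pi>])
  note c [simp] = asc_carrier [OF a] and A = ascD(1) [OF a] and B = ascD(2) [OF a] and BA = subsetD [OF ascD(3) [OF a]]
  note tw = twisted_pow [OF B c(1) ascD(5) [OF a] g]
  define u where "u = t [^] m \<otimes> g"
  have uA: "u \<in> A" unfolding u_def using pow_mem [OF A ascD(4) [OF a]] BA [OF g] A by (simp add: subgroup.m_closed)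
  have uc [simp]: "u \<in> carrier G" using uA by simp
  have K: "subgroup (kern A Q \<pi>) G" by (rule subgroup_kern [OF A Q \<pi>])
  have KB: "subgroup (kern B Q \<pi>) G"
    by (rule subgroup_kern [OF B Q homs_mono [OF \<pi> ascD(3) [OF a]]])
  have KAB: "kern B Q \<pi> = kern A Q \<pi> \<inter> B" using ascD(3) [OF a] by (auto simp: kern_def)
  have uK: "u \<in> kern A Q \<pi>" using uA tm by (simp add: kern_def u_def)
  have conj: "inv u \<otimes> b \<otimes> u \<in> kern B Q \<pi>" if b: "b \<in> kern B Q \<pi>" for b
  proof -
    have bB: "b \<in> B" and bK: "b \<in> kern A Q \<pi>" using b KAB by auto
    have "inv u \<otimes> b \<otimes> u \<in> kern A Q \<pi>"
      using uK bK K by (simp add: subgroup.m_closed subgroup.m_inv_closed)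
    moreover have "inv u \<otimes> b \<otimes> u = inv g \<otimes> (inv (t [^] m) \<otimes> b \<otimes> t [^] m) \<otimes> g"
      using g bB by (simp add: u_def group_word)
    then have "inv u \<otimes> b \<otimes> u \<in> B"
      using conj_pow_mem [OF B c(1) ascD(5) [OF a] bB, of m] g B
      by (simp add: subgroup.m_closed subgroup.m_inv_closed)
    ultimately show ?thesis by (simp add: KAB)
  qed
  have rep: "\<exists>(i::nat) (j::nat). \<exists>b\<in>kern B Q \<pi>. h = u [^] i \<otimes> b \<otimes> inv (u [^] j)" if h: "h \<in> kern A Q \<pi>" for h
  proof -
    have hA: "h \<in> A" and \<pi>h: "\<pi> h = \<one>\<^bsub>Q\<^esub>" using h by (auto simp: kern_def)
    obtain i j b where b: "b \<in> B" "h = t [^] (i::nat) \<otimes> b \<otimes> inv (t [^] (j::nat))"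
      using ascE [OF a hA] by metis
    have tA: "t [^] (k::nat) \<in> A" for k by (rule pow_mem [OF A ascD(4) [OF a]])
    have pt: "\<pi> (t [^] (k + l)) = \<pi> (t [^] k) \<otimes>\<^bsub>Q\<^esub> \<pi> (t [^] l)" for k l :: nat
      using \<pi>.mult [OF tA tA] by (simp add: nat_pow_mult)
    have "\<pi> h = \<pi> (t [^] i) \<otimes>\<^bsub>Q\<^esub> \<pi> b \<otimes>\<^bsub>Q\<^esub> inv\<^bsub>Q\<^esub> (\<pi> (t [^] j))"
      unfolding b(2) using tA BA [OF b(1)] A
      by (simp add: \<pi>.mult \<pi>.inv subgroup.m_closed subgroup.m_inv_closed)
    then have "\<pi> (t [^] i) \<otimes>\<^bsub>Q\<^esub> \<pi> b \<otimes>\<^bsub>Q\<^esub> inv\<^bsub>Q\<^esub> (\<pi> (t [^] j)) = \<one>\<^bsub>Q\<^esub>" using \<pi>h by simp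
    then have "\<pi> (t [^] i) \<otimes>\<^bsub>Q\<^esub> \<pi> b \<otimes>\<^bsub>Q\<^esub> inv\<^bsub>Q\<^esub> (\<pi> (t [^] j)) \<otimes>\<^bsub>Q\<^esub> \<pi> (t [^] j) = \<pi> (t [^] j)"
      using tA by simp
    then have e: "\<pi> (t [^] i) \<otimes>\<^bsub>Q\<^esub> \<pi> b = \<pi> (t [^] j)"
      using tA BA [OF b(1)] by (simp add: Q.m_assoc)
    have bA: "b \<in> A" using BA b by simp
    have "i mod m = j mod m"
    proof (cases "i \<le> j")
      case True
      then have "\<pi> (t [^] j) = \<pi> (t [^] i) \<otimes>\<^bsub>Q\<^esub> \<pi> (t [^] (j - i))"
        using pt [of i "j - i"] by (simp only: le_add_diff_inverse)
      then have "\<pi> (t [^] i) \<otimes>\<^bsub>Q\<^esub> \<pi> b = \<pi> (t [^] i) \<otimes>\<^bsub>Q\<^esub> \<pi> (t [^] (j - i))"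
        using e by (simp only:)
      then have "\<pi> (t [^] (j - i)) = \<pi> b" using tA bA Q.left_cancel \<pi>.closed by metis
      then have "m dvd (j - i)" using dvd b(1) by auto
      then show ?thesis using True by (metis mod_eq_dvd_iff_nat)
    next
      case False
      then have "\<pi> (t [^] i) = \<pi> (t [^] j) \<otimes>\<^bsub>Q\<^esub> \<pi> (t [^] (i - j))"
        using pt [of j "i - j"] by (simp only: le_add_diff_inverse nat_le_linear not_le less_imp_le)
      then have "\<pi> (t [^] j) \<otimes>\<^bsub>Q\<^esub> (\<pi> (t [^] (i - j)) \<otimes>\<^bsub>Q\<^esub> \<pi> b) = \<pi> (t [^] j)"
        using e tA bA Q.m_assoc \<pi>.closed by metis
      then have "\<pi> (t [^] (i - j)) \<otimes>\<^bsub>Q\<^esub> \<pi> b = \<one>\<^bsub>Q\<^esub>"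
        using tA bA Q.l_cancel_one Q.m_closed \<pi>.closed by metis
      then have "\<pi> (t [^] (i - j)) = \<pi> (inv b)" using tA bA by (simp add: \<pi>.inv Q.inv_equality)
      then have "m dvd (i - j)" using dvd subgroup.m_inv_closed [OF B b(1)] by auto
      then show ?thesis using False by (simp add: mod_eq_dvd_iff_nat)
    qed
    then have ij: "i mod m = j mod m" .
    \<comment> \<open>The padding that lifts both exponents to multiples of \<open>m\<close>,
      possible simultaneously because they agree modulo \<open>m\<close>.\<close>
    define p where "p = m - i mod m"
    have "m dvd i + p" "m dvd j + p"
    proof -
      have l: "i mod m \<le> m" using m by simp
      have "i + p = i div m * m + m" using l div_mult_mod_eq [of i m] unfolding p_def by linarith
      moreover have "j + p = j div m * m + m" using l div_mult_mod_eq [of j m] ij unfolding p_def by linarith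
      ultimately show "m dvd i + p" "m dvd j + p" by simp_all
    qed
    then obtain q r where q: "i + p = m * q" and r: "j + p = m * r" by (auto elim!: dvdE)
    obtain gq where gq: "gq \<in> B" "u [^] q = t [^] (m * q) \<otimes> gq" using tw [of m q] by (auto simp: u_def)
    obtain gr where gr: "gr \<in> B" "u [^] r = t [^] (m * r) \<otimes> gr" using tw [of m r] by (auto simp: u_def)
    define b2 where "b2 = inv (t [^] p) \<otimes> b \<otimes> t [^] p"
    have b2: "b2 \<in> B" unfolding b2_def using conj_pow_mem [OF B c(1) ascD(5) [OF a] b(1)] by simp
    have h2: "h = t [^] (m * q) \<otimes> b2 \<otimes> inv (t [^] (m * r))"
      using rep_shift [of t b i j p] b by (simp add: b2_def q r)
    have "h = u [^] q \<otimes> (inv gq \<otimes> b2 \<otimes> gr) \<otimes> inv (u [^] r)"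
      unfolding gq(2) gr(2) h2 using gq(1) gr(1) b2 by (simp add: group_word)
    moreover have "inv gq \<otimes> b2 \<otimes> gr \<in> B"
      using gq(1) gr(1) b2 B by (simp add: subgroup.m_closed subgroup.m_inv_closed)
    moreover have "inv gq \<otimes> b2 \<otimes> gr \<in> kern A Q \<pi>"
    proof -
      have uk: "u [^] k \<in> kern A Q \<pi>" for k :: nat using pow_mem [OF K uK] .
      have "inv gq \<otimes> b2 \<otimes> gr = inv (u [^] q) \<otimes> h \<otimes> u [^] r"
        unfolding gq(2) gr(2) h2 using gq(1) gr(1) b2 by (simp add: group_word)
      then show ?thesis using uk h K by (simp add: subgroup.m_closed subgroup.m_inv_closed)
    qed
    ultimately show ?thesis unfolding KAB by blast
  qed
  have np: "u [^] k \<notin> kern B Q \<pi>" if k: "k > 0" for k :: nat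
  proof
    assume "u [^] k \<in> kern B Q \<pi>"
    then have uB: "u [^] k \<in> B" by (simp add: KAB)
    obtain h where h: "h \<in> B" "u [^] k = t [^] (m * k) \<otimes> h" using tw [of m k] by (auto simp: u_def)
    then have "t [^] (m * k) = u [^] k \<otimes> inv h" by (simp add: m_assoc)
    moreover have "u [^] k \<otimes> inv h \<in> B" using uB h(1) B by (blast intro: subgroup.m_closed subgroup.m_inv_closed)
    ultimately have "t [^] (m * k) \<in> B" by simp
    then show False using ascD(6) [OF a, of "m * k"] m k by simp
  qed
  show ?thesis
    unfolding asc_def using K KB KAB uK conj rep np by (auto simp: u_def)
qed

text \<open>\<open>m\<close> is the order of \<open>\<pi> t\<close> modulo \<open>S\<close>,
  positive because the image is finite. If \<open>S\<close> lies in the image, its left cosets by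
  the powers with exponent below \<open>m\<close> are disjoint there, which gives the bound on
  cardinalities.\<close>

lemma least_pow:
  assumes "group Q" "finite (\<pi> ` A)" "subgroup A G" "\<pi> \<in> homs G A Q" "subgroup S Q" "t \<in> A"
  obtains m :: nat where "m > 0" "\<And>k::nat. \<pi> t [^]\<^bsub>Q\<^esub> k \<in> S \<longleftrightarrow> m dvd k"
    "S \<subseteq> \<pi> ` A \<Longrightarrow> m * card S \<le> card (\<pi> ` A)"
proof -
  interpret Q: group Q by fact
  interpret S: subgroup S Q by fact
  interpret \<pi>: homs_on G Q A \<pi> by (rule homs_onI [OF assms(1,3,4)])
  have \<pi>A: "subgroup (\<pi> ` A) Q" by (rule subgroup_homs_image [OF assms(3,1,4)])
  define s where "s = \<pi> t"
  have s [simp]: "s \<in> carrier Q" using assms(6) by (simp add: s_def)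
  have sA: "s [^]\<^bsub>Q\<^esub> k \<in> \<pi> ` A" for k :: nat using Q.pow_mem [OF \<pi>A] assms(6) by (simp add: s_def)
  have "\<exists>k::nat. k > 0 \<and> s [^]\<^bsub>Q\<^esub> k = \<one>\<^bsub>Q\<^esub>"
  proof -
    have "finite (range (\<lambda>k::nat. s [^]\<^bsub>Q\<^esub> k))" using sA by (intro finite_subset [OF _ assms(2)]) auto
    then have "\<not> inj (\<lambda>k::nat. s [^]\<^bsub>Q\<^esub> k)" using finite_imageD infinite_UNIV_nat by blast
    then obtain i' j' :: nat where ij': "i' \<noteq> j'" "s [^]\<^bsub>Q\<^esub> i' = s [^]\<^bsub>Q\<^esub> j'"
      unfolding inj_def by blast
    obtain i j :: nat where ij: "i < j" "s [^]\<^bsub>Q\<^esub> i = s [^]\<^bsub>Q\<^esub> j"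
      using ij' by (cases "i' < j'") (auto intro: that [of i' j'] that [of j' i'])
    have "s [^]\<^bsub>Q\<^esub> i \<otimes>\<^bsub>Q\<^esub> s [^]\<^bsub>Q\<^esub> (j - i) = s [^]\<^bsub>Q\<^esub> j" using ij(1) by (simp add: Q.nat_pow_mult)
    then have "s [^]\<^bsub>Q\<^esub> (j - i) = \<one>\<^bsub>Q\<^esub>" using ij(2) Q.l_cancel_one [of "s [^]\<^bsub>Q\<^esub> i" "s [^]\<^bsub>Q\<^esub> (j - i)"] by simp
    then show ?thesis using ij by (intro exI [of _ "j - i"]) simp
  qed
  then obtain k0 :: nat where "k0 > 0" "s [^]\<^bsub>Q\<^esub> k0 = \<one>\<^bsub>Q\<^esub>" by blast
  then have ex: "\<exists>k::nat. k > 0 \<and> s [^]\<^bsub>Q\<^esub> k \<in> S" using S.one_closed by (intro exI [of _ k0]) simp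
  define m where "m = (LEAST k::nat. k > 0 \<and> s [^]\<^bsub>Q\<^esub> k \<in> S)"
  have m: "m > 0" "s [^]\<^bsub>Q\<^esub> m \<in> S" using LeastI_ex [OF ex] unfolding m_def by blast+
  have least: "m \<le> k" if "k > 0" "s [^]\<^bsub>Q\<^esub> k \<in> S" for k
    unfolding m_def by (rule Least_le) (use that in blast)
  have mS: "s [^]\<^bsub>Q\<^esub> (m * q) \<in> S" for q
    using Q.pow_mem [OF assms(5) m(2)] by (simp add: Q.nat_pow_pow)
  have dvd: "s [^]\<^bsub>Q\<^esub> k \<in> S \<longleftrightarrow> m dvd k" for k
  proof
    assume k: "s [^]\<^bsub>Q\<^esub> k \<in> S"
    have "s [^]\<^bsub>Q\<^esub> (m * (k div m)) \<otimes>\<^bsub>Q\<^esub> s [^]\<^bsub>Q\<^esub> (k mod m) = s [^]\<^bsub>Q\<^esub> k"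
      by (simp only: Q.nat_pow_mult [OF s] mult_div_mod_eq)
    then have "s [^]\<^bsub>Q\<^esub> (k mod m) = inv\<^bsub>Q\<^esub> (s [^]\<^bsub>Q\<^esub> (m * (k div m))) \<otimes>\<^bsub>Q\<^esub> s [^]\<^bsub>Q\<^esub> k"
      by (metis Q.cancel_left(1) Q.nat_pow_closed s)
    then have "s [^]\<^bsub>Q\<^esub> (k mod m) \<in> S" using k mS by simp
    then have "k mod m = 0" using least [of "k mod m"] m(1) mod_less_divisor [of m k] by (meson leD neq0_conv)
    then show "m dvd k" by auto
  next
    assume "m dvd k" then show "s [^]\<^bsub>Q\<^esub> k \<in> S" using mS by (auto elim!: dvdE)
  qed
  have card: "m * card S \<le> card (\<pi> ` A)" if SA: "S \<subseteq> \<pi> ` A"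
  proof -
    let ?f = "\<lambda>(k::nat, q). s [^]\<^bsub>Q\<^esub> k \<otimes>\<^bsub>Q\<^esub> q"
    have le: "k = l \<and> q = r" if "k \<le> l" "l < m" "q \<in> S" "r \<in> S" "s [^]\<^bsub>Q\<^esub> k \<otimes>\<^bsub>Q\<^esub> q = s [^]\<^bsub>Q\<^esub> l \<otimes>\<^bsub>Q\<^esub> r"
      for k l q r
    proof -
      have qr: "q \<in> carrier Q" "r \<in> carrier Q" using that by auto
      have "s [^]\<^bsub>Q\<^esub> l = s [^]\<^bsub>Q\<^esub> k \<otimes>\<^bsub>Q\<^esub> s [^]\<^bsub>Q\<^esub> (l - k)"
        using that(1) by (simp only: Q.nat_pow_mult [OF s] le_add_diff_inverse)
      then have "s [^]\<^bsub>Q\<^esub> k \<otimes>\<^bsub>Q\<^esub> q = s [^]\<^bsub>Q\<^esub> k \<otimes>\<^bsub>Q\<^esub> (s [^]\<^bsub>Q\<^esub> (l - k) \<otimes>\<^bsub>Q\<^esub> r)"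
        using that(5) qr by (simp only: Q.m_assoc Q.nat_pow_closed s)
      then have e: "q = s [^]\<^bsub>Q\<^esub> (l - k) \<otimes>\<^bsub>Q\<^esub> r" using qr Q.left_cancel Q.m_closed Q.nat_pow_closed s by metis
      then have "s [^]\<^bsub>Q\<^esub> (l - k) = q \<otimes>\<^bsub>Q\<^esub> inv\<^bsub>Q\<^esub> r" using qr by (simp only: Q.m_assoc Q.nat_pow_closed s Q.r_inv Q.r_one Q.inv_closed)
      then have "s [^]\<^bsub>Q\<^esub> (l - k) \<in> S" using that(3,4) by simp
      then have "m dvd l - k" using dvd by simp
      then have lk: "l - k = 0" using that(2) by (meson dvd_imp_le leD less_imp_diff_less neq0_conv)
      then show ?thesis using e that(1) qr by simp
    qed
    have "inj_on ?f ({..<m} \<times> S)"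
    proof (rule inj_onI)
      fix x z assume xz: "x \<in> {..<m} \<times> S" "z \<in> {..<m} \<times> S" "?f x = ?f z"
      obtain k q where x: "x = (k, q)" by force
      obtain l r where z: "z = (l, r)" by force
      show "x = z"
        using xz le [of k l q r] le [of l k r q] unfolding x z by (cases "k \<le> l") auto
    qed
    moreover have "?f ` ({..<m} \<times> S) \<subseteq> \<pi> ` A"
      using sA SA subgroup.m_closed [OF \<pi>A] by auto
    ultimately have "card ({..<m} \<times> S) \<le> card (\<pi> ` A)" using card_inj_on_le assms(2) by blast
    then show ?thesis by (simp add: card_cartesian_product)
  qed
  show ?thesis using that [of m] m(1) dvd card by (simp add: s_def)
qed

text \<open>The source of the improved bounds: rewriting in the base sees only the image of
  \<open>B\<close>, which is smaller by the factor \<open>m\<close>. The element \<open>g\<close>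
  corrects \<open>t [^] m\<close> into the kernel.\<close>

theorem asc_kern_ex:
  assumes a: "asc G A B t" and Q: "group Q" and \<pi>: "\<pi> \<in> homs G A Q" and fin: "finite (\<pi> ` A)"
  obtains m g where "m > 0" "m * card (\<pi> ` B) \<le> card (\<pi> ` A)" "g \<in> B"
    "\<And>k::nat. \<pi> t [^]\<^bsub>Q\<^esub> k \<in> \<pi> ` B \<longleftrightarrow> m dvd k"
    "asc G (kern A Q \<pi>) (kern B Q \<pi>) (t [^] (m::nat) \<otimes> g)"
proof -
  interpret Q: group Q by fact
  interpret \<pi>: homs_on G Q A \<pi> by (rule homs_onI [OF Q ascD(1) [OF a] \<pi>])
  note A = ascD(1) [OF a] and B = ascD(2) [OF a] and BA = ascD(3) [OF a]
  have \<pi>B: "subgroup (\<pi> ` B) Q" by (rule subgroup_homs_image [OF B Q homs_mono [OF \<pi> BA]])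
  obtain m :: nat where m: "m > 0" "\<And>k::nat. \<pi> t [^]\<^bsub>Q\<^esub> k \<in> \<pi> ` B \<longleftrightarrow> m dvd k"
    "m * card (\<pi> ` B) \<le> card (\<pi> ` A)"
    using least_pow [OF Q fin A \<pi> \<pi>B ascD(4) [OF a]] BA by (metis image_mono)
  have "inv\<^bsub>Q\<^esub> (\<pi> t [^]\<^bsub>Q\<^esub> m) \<in> \<pi> ` B"
    using m(2) [of m] subgroup.m_inv_closed [OF \<pi>B] by simp
  then obtain g where g: "g \<in> B" "\<pi> g = inv\<^bsub>Q\<^esub> (\<pi> t [^]\<^bsub>Q\<^esub> m)" by auto
  have "t [^] m \<in> A" by (rule pow_mem [OF A ascD(4) [OF a]])
  then have "\<pi> (t [^] m \<otimes> g) = \<one>\<^bsub>Q\<^esub>"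
    using g BA \<pi>.mult [of "t [^] m" g] \<pi>.pow [OF ascD(4) [OF a], of m] ascD(4) [OF a] by auto
  moreover have "m dvd k" if "\<pi> (t [^] (k::nat)) \<in> \<pi> ` B" for k
    using that \<pi>.pow [OF ascD(4) [OF a], of k] m(2) by simp
  ultimately have "asc G (kern A Q \<pi>) (kern B Q \<pi>) (t [^] m \<otimes> g)"
    by (intro asc_kern [OF a Q \<pi> g(1) m(1)])
  then show ?thesis using that m g by blast
qed

end

subsection \<open>An amalgam of two ascending HNN extensions\<close>

context group
begin

lemma homs_rep:
  assumes "homs_on G E A F" "t \<in> A" "b \<in> A"
  shows "F (t [^] (i::nat) \<otimes> b \<otimes> inv (t [^] (j::nat))) =
    F t [^]\<^bsub>E\<^esub> i \<otimes>\<^bsub>E\<^esub> F b \<otimes>\<^bsub>E\<^esub> inv\<^bsub>E\<^esub> (F t [^]\<^bsub>E\<^esub> j)"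
proof -
  interpret F: homs_on G E A F by fact
  have t: "t [^] i \<in> A" "t [^] j \<in> A" using pow_mem [OF F.sub assms(2)] by auto
  have "inv (t [^] j) \<in> A" using t F.sub by (simp add: subgroup.m_inv_closed)
  moreover have "t [^] i \<otimes> b \<in> A" using t assms(3) F.sub by (simp add: subgroup.m_closed)
  ultimately have "F (t [^] i \<otimes> b \<otimes> inv (t [^] j)) = F (t [^] i \<otimes> b) \<otimes>\<^bsub>E\<^esub> F (inv (t [^] j))"
    by (rule F.mult [rotated])
  also have "F (t [^] i \<otimes> b) = F (t [^] i) \<otimes>\<^bsub>E\<^esub> F b" using t(1) assms(3) by (rule F.mult)
  also have "F (inv (t [^] j)) = inv\<^bsub>E\<^esub> F (t [^] j)" using t(2) by (rule F.inv)
  finally show ?thesis using F.pow [OF assms(2)] by simp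
qed

text \<open>
  Since \<open>p\<close> and \<open>D\<close> live in \<open>P\<close>, the HNN relators for the action of \<open>pt\<close> on \<open>D\<close> are redundant. Hence a
  presentation of \<open>P\<close> only has to be enlarged by the relators for the action of \<open>t\<close> on \<open>D\<close> and by one
  relator for the action of \<open>pt\<close> on \<open>t\<close>.
\<close>

theorem double_asc_cost:
  assumes BD: "asc G B D t" and AB: "asc G A B (p \<otimes> t)"
    and P: "subgroup P G" "D \<subseteq> P" "p \<in> P" "\<And>d. d \<in> D \<Longrightarrow> inv p \<otimes> d \<otimes> p \<in> D"
    and Prep: "\<And>g. g \<in> P \<Longrightarrow> \<exists>(i::nat) (j::nat). \<exists>d\<in>D. g = p [^] i \<otimes> d \<otimes> inv (p [^] j)"
    and PA: "P \<subseteq> A"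
    and cost: "cost_le G P c" and rank: "rank_le G D d"
  shows "cost_le G A (c + d + 2)"
proof -
  obtain X :: "nat set" and R y where X: "finite X" "finite R" "card X + card R \<le> c" and pr: "presents G P y X R"
    using cost by (auto simp: cost_le_def)
  obtain Z :: "nat set" and z where Z: "finite Z" "card Z \<le> d" and gz: "generates G D z Z"
    using rank by (auto simp: rank_le_def)
  note DA = ascD(2) [OF BD] and BA = ascD(1) [OF BD] and AA = ascD(1) [OF AB]
  have c [simp]: "t \<in> carrier G" "p \<in> carrier G" using asc_carrier(1) [OF BD] subgroup.mem_carrier [OF P(1,3)] .
  have Dc: "b \<in> carrier G" if "b \<in> D" for b using subgroup.mem_carrier [OF DA that] .
  have ptc: "p \<otimes> t \<in> carrier G" by simp
  have zD: "z q \<in> D" if "q \<in> Z" for q using generatesD(1) [OF gz] that by auto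
  have DtD: "inv t \<otimes> b \<otimes> t \<in> D" if "b \<in> D" for b using ascD(5) [OF BD that] .
  have "\<forall>q\<in>Z. \<exists>u\<in>words_on X. ev G y u = z q" using presentsD(6) [OF pr] zD P(2) by blast
  then obtain u where u: "\<And>q. q \<in> Z \<Longrightarrow> u q \<in> words_on X \<and> ev G y (u q) = z q" by metis
  have "\<forall>q\<in>Z. \<exists>w\<in>words_on X. ev G y w = inv t \<otimes> z q \<otimes> t"
    using presentsD(6) [OF pr] zD P(2) DtD by blast
  then obtain w where w: "\<And>q. q \<in> Z \<Longrightarrow> w q \<in> words_on X \<and> ev G y (w q) = inv t \<otimes> z q \<otimes> t" by metis
  obtain wp where wp: "wp \<in> words_on X" "ev G y wp = p" using presentsD(6) [OF pr P(3)] by auto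
  have tB: "t \<in> B" using ascD(4) [OF BD] .
  \<comment> \<open>The conjugate of \<open>t\<close> by \<open>p \<otimes> t\<close> lies in
    \<open>B\<close>, hence has a normal form over \<open>D\<close>; this becomes the right-hand
    side \<open>rhs0\<close> of the single relator for \<open>t\<close>.\<close>
  obtain i j bt where bt: "bt \<in> D"
    "inv (p \<otimes> t) \<otimes> t \<otimes> (p \<otimes> t) = t [^] (i::nat) \<otimes> bt \<otimes> inv (t [^] (j::nat))"
    using ascE [OF BD ascD(5) [OF AB tB]] by metis
  obtain wb where wb: "wb \<in> words_on X" "ev G y wb = bt" using presentsD(6) [OF pr] bt(1) P(2) by blast
  define X' where "X' = insert None (Some ` X)"
  define y' where "y' = case_option t y"
  define T where "T = (False, None :: nat option)"
  define T' where "T' = (True, None :: nat option)"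
  define lhs rhs where "lhs q = [T'] @ rename Some (u q) @ [T]" and "rhs q = rename Some (w q)" for q
  define lhs0 where "lhs0 = inv_word (rename Some wp @ [T]) @ [T] @ (rename Some wp @ [T])"
  define rhs0 where "rhs0 = replicate i T @ rename Some wb @ replicate j T'"
  define R' where "R' = rename Some ` R \<union> (\<lambda>q. lhs q @ inv_word (rhs q)) ` Z \<union> {lhs0 @ inv_word rhs0}"
  have T: "[T] \<in> words_on X'" "[T'] \<in> words_on X'" "replicate k T \<in> words_on X'" "replicate k T' \<in> words_on X'" for k
    by (auto simp: T_def T'_def X'_def)
  have sT: "snd T \<in> X'" "snd T' \<in> X'" by (auto simp: T_def T'_def X'_def)
  have sub: "rename Some r \<in> words_on X'" if "r \<in> words_on X" for r
    using that by (auto simp: X'_def intro: rename_words_on)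
  have W: "lhs q \<in> words_on X'" "rhs q \<in> words_on X'" if "q \<in> Z" for q
    using u [OF that] w [OF that] sT sub by (auto simp: lhs_def rhs_def)
  have W0: "lhs0 \<in> words_on X'" "rhs0 \<in> words_on X'"
    using sT sub [OF wp(1)] sub [OF wb(1)] by (simp_all add: lhs0_def rhs0_def)
  have R': "R' \<subseteq> words_on X'"
    using sub presentsD(3) [OF pr] W W0 by (auto simp: R'_def)
  let ?E = "pres_group X' R'"
  interpret E: group ?E by (rule group_pres_group)
  define e where "e = pgen X' R'"
  have e: "range e \<subseteq> carrier ?E" by (auto simp: e_def)
  then have ec [simp]: "e x \<in> carrier ?E" for x by auto
  have rel1: "ev ?E e r = \<one>\<^bsub>?E\<^esub>" if "r \<in> R'" for r
    using pgen_relator [of r R' X'] that R' by (auto simp: e_def)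
  obtain f where f: "f \<in> homs G P ?E" "\<And>x. x \<in> X \<Longrightarrow> f (y x) = e (Some x)"
      "\<And>w. w \<in> words_on X \<Longrightarrow> f (ev G y w) = ev ?E (e \<circ> Some) w"
  proof (rule presents_hom [OF P(1) pr group_pres_group, of "e \<circ> Some" X' R'])
    fix r assume "r \<in> R"
    then show "ev ?E (e \<circ> Some) r = \<one>\<^bsub>?E\<^esub>"
      using rel1 [of "rename Some r"] by (simp add: R'_def ev_rename)
  qed auto
  interpret f: homs_on G ?E P f by (rule homs_onI [OF group_pres_group P(1) f(1)])
  have fev: "f g = ev ?E e (rename Some w)" if "w \<in> words_on X" "ev G y w = g" for g w
    using f(3) [OF that(1)] that(2) by (simp add: ev_rename)
  define s where "s = e None"
  have s [simp]: "s \<in> carrier ?E" by (simp add: s_def)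
  have evT: "ev ?E e [T] = s" "ev ?E e [T'] = inv\<^bsub>?E\<^esub> s" "ev ?E e (replicate k T) = s [^]\<^bsub>?E\<^esub> k"
    "ev ?E e (replicate k T') = inv\<^bsub>?E\<^esub> (s [^]\<^bsub>?E\<^esub> k)" for k
    using E.ev_replicate [of e None k] by (simp_all add: T_def T'_def s_def)
  have fD: "f \<in> homs G D ?E" by (rule homs_mono [OF f(1) P(2)])
  have fs: "inv\<^bsub>?E\<^esub> s \<otimes>\<^bsub>?E\<^esub> f b \<otimes>\<^bsub>?E\<^esub> s = f (inv t \<otimes> b \<otimes> t)" if "b \<in> D" for b
  proof (rule homs_eq [OF DA gz group_pres_group _ _ _ that])
    show "(\<lambda>b. inv\<^bsub>?E\<^esub> s \<otimes>\<^bsub>?E\<^esub> f b \<otimes>\<^bsub>?E\<^esub> s) \<in> homs G D ?E"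
      by (rule E.conj_homs [OF fD]) simp
    show "(\<lambda>b. f (inv t \<otimes> b \<otimes> t)) \<in> homs G D ?E"
      by (rule precomp_conj_homs [OF group_pres_group fD c(1) DA DtD subgroup.subset [OF DA]])
    fix q assume q: "q \<in> Z"
    have "ev ?E e (lhs q) = ev ?E e (rhs q)"
      using rel1 [of "lhs q @ inv_word (rhs q)"] q by (intro E.relator_eq [OF e]) (auto simp: R'_def)
    moreover have "ev ?E e (lhs q) = inv\<^bsub>?E\<^esub> s \<otimes>\<^bsub>?E\<^esub> f (z q) \<otimes>\<^bsub>?E\<^esub> s"
      using fev [of "u q" "z q"] u [OF q] E.ev_append [OF e] evT zD [OF q] P(2)
      by (simp add: lhs_def E.m_assoc E.ev_carrier [OF e] subset_iff del: ev.simps append_Cons append_Nil)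
    moreover have "ev ?E e (rhs q) = f (inv t \<otimes> z q \<otimes> t)"
      using fev [of "w q" "inv t \<otimes> z q \<otimes> t"] w [OF q] by (simp add: rhs_def)
    ultimately show "inv\<^bsub>?E\<^esub> s \<otimes>\<^bsub>?E\<^esub> f (z q) \<otimes>\<^bsub>?E\<^esub> s = f (inv t \<otimes> z q \<otimes> t)" by simp
  qed
  \<comment> \<open>The inverse homomorphism is built along the tower: from \<open>D\<close> to
    \<open>B\<close> here, and from \<open>B\<close> to \<open>A\<close> below.\<close>
  obtain f1 where f1: "f1 \<in> homs G B ?E" "\<And>b. b \<in> D \<Longrightarrow> f1 b = f b" "f1 t = s"
    using asc_hom [OF BD group_pres_group fD s fs] by blast
  interpret f1: homs_on G ?E B f1 by (rule homs_onI [OF group_pres_group BA f1(1)])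
  have DB: "D \<subseteq> B" using ascD(3) [OF BD] .
  define s0 where "s0 = f p \<otimes>\<^bsub>?E\<^esub> s"
  have fp: "f p \<in> carrier ?E" using P(3) by simp
  have s0 [simp]: "s0 \<in> carrier ?E" using fp by (simp add: s0_def)
  have gB: "generates G B (case_option t z) (insert None (Some ` Z))"
    using generates_add [OF gz DA BA DB tB asc_subset [OF BD]] .
  have fs0: "inv\<^bsub>?E\<^esub> s0 \<otimes>\<^bsub>?E\<^esub> f1 b \<otimes>\<^bsub>?E\<^esub> s0 = f1 (inv (p \<otimes> t) \<otimes> b \<otimes> (p \<otimes> t))" if "b \<in> B" for b
  proof (rule homs_eq [OF BA gB group_pres_group _ _ _ that])
    show "(\<lambda>b. inv\<^bsub>?E\<^esub> s0 \<otimes>\<^bsub>?E\<^esub> f1 b \<otimes>\<^bsub>?E\<^esub> s0) \<in> homs G B ?E"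
      by (rule E.conj_homs [OF f1(1)]) simp
    show "(\<lambda>b. f1 (inv (p \<otimes> t) \<otimes> b \<otimes> (p \<otimes> t))) \<in> homs G B ?E"
      by (rule precomp_conj_homs [OF group_pres_group f1(1) ptc BA ascD(5) [OF AB] subgroup.subset [OF BA]])
    fix x assume "x \<in> insert None (Some ` Z)"
    then consider q where "q \<in> Z" "x = Some q" | "x = None" by auto
    then show "inv\<^bsub>?E\<^esub> s0 \<otimes>\<^bsub>?E\<^esub> f1 (case_option t z x) \<otimes>\<^bsub>?E\<^esub> s0 =
        f1 (inv (p \<otimes> t) \<otimes> case_option t z x \<otimes> (p \<otimes> t))"
    proof cases
      case 1
      define b where "b = z q"
      have b: "b \<in> D" using zD 1 by (simp add: b_def)
      have bp: "inv p \<otimes> b \<otimes> p \<in> D" using P(4) [OF b] .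
      have bP: "b \<in> P" "p \<in> P" "inv p \<in> P" "inv p \<otimes> b \<in> P"
        using b P(1-3) by (auto simp: subgroup.m_inv_closed subgroup.m_closed)
      have "f (inv p \<otimes> b \<otimes> p) = inv\<^bsub>?E\<^esub> (f p) \<otimes>\<^bsub>?E\<^esub> f b \<otimes>\<^bsub>?E\<^esub> f p"
        using f.mult [OF bP(4,2)] f.mult [OF bP(3,1)] f.inv [OF bP(2)] by simp
      then have "inv\<^bsub>?E\<^esub> s0 \<otimes>\<^bsub>?E\<^esub> f b \<otimes>\<^bsub>?E\<^esub> s0 = inv\<^bsub>?E\<^esub> s \<otimes>\<^bsub>?E\<^esub> f (inv p \<otimes> b \<otimes> p) \<otimes>\<^bsub>?E\<^esub> s"
        using fp f.closed [OF bP(1)] by (simp add: s0_def E.group_word)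
      also have "\<dots> = f (inv t \<otimes> (inv p \<otimes> b \<otimes> p) \<otimes> t)" by (rule fs [OF bp])
      also have "\<dots> = f1 (inv t \<otimes> (inv p \<otimes> b \<otimes> p) \<otimes> t)" using f1(2) [OF DtD [OF bp]] by simp
      also have "inv t \<otimes> (inv p \<otimes> b \<otimes> p) \<otimes> t = inv (p \<otimes> t) \<otimes> b \<otimes> (p \<otimes> t)"
        using Dc [OF b] by (simp add: group_word)
      finally show ?thesis using 1 f1(2) [OF b] by (simp add: b_def)
    next
      case 2
      have "ev ?E e lhs0 = ev ?E e rhs0"
        using rel1 [of "lhs0 @ inv_word rhs0"] by (intro E.relator_eq [OF e]) (auto simp: R'_def)
      moreover have "ev ?E e (rename Some wp @ [T]) = s0"
        using fev [OF wp] E.ev_append [OF e] evT by (simp add: s0_def del: ev.simps append_Cons append_Nil)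
      then have "ev ?E e lhs0 = inv\<^bsub>?E\<^esub> s0 \<otimes>\<^bsub>?E\<^esub> s \<otimes>\<^bsub>?E\<^esub> s0"
        unfolding lhs0_def E.ev_append [OF e words_on_simps(4) words_on_simps(4)] E.ev_inv_word [OF e words_on_simps(4)] evT
        using fp by (simp add: E.m_assoc s0_def)
      moreover have "ev ?E e rhs0 = f1 (inv (p \<otimes> t) \<otimes> t \<otimes> (p \<otimes> t))"
      proof -
        have fb: "f bt = ev ?E e (rename Some wb)" using fev [OF wb] .
        have "f1 (inv (p \<otimes> t) \<otimes> t \<otimes> (p \<otimes> t)) = s [^]\<^bsub>?E\<^esub> i \<otimes>\<^bsub>?E\<^esub> f1 bt \<otimes>\<^bsub>?E\<^esub> inv\<^bsub>?E\<^esub> (s [^]\<^bsub>?E\<^esub> j)"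
          unfolding bt(2) using homs_rep [OF f1.homs_on_axioms tB, of bt i j] bt(1) DB f1(3) by auto
        then show ?thesis
          unfolding rhs0_def E.ev_append [OF e words_on_simps(4) words_on_simps(4)] evT
          using f1(2) [OF bt(1)] fb e by (simp add: E.m_assoc)
      qed
      ultimately show ?thesis using 2 f1(3) by simp
    qed
  qed
  obtain F where F: "F \<in> homs G A ?E" "\<And>b. b \<in> B \<Longrightarrow> F b = f1 b" "F (p \<otimes> t) = s0"
    using asc_hom [OF AB group_pres_group f1(1) s0 fs0] by blast
  interpret F: homs_on G ?E A F by (rule homs_onI [OF group_pres_group AA F(1)])
  have tA: "t \<in> A" and pA: "p \<in> A" using tB ascD(3) [OF AB] P(3) PA by auto
  have Ft: "F t = s" using F(2) [OF tB] f1(3) by simp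
  have Fp: "F p = f p"
  proof -
    have "F p \<otimes>\<^bsub>?E\<^esub> s = f p \<otimes>\<^bsub>?E\<^esub> s" using F.mult [OF pA tA] F(3) Ft by (simp add: s0_def)
    then show ?thesis using fp F.closed [OF pA] by simp
  qed
  \<comment> \<open>On \<open>P\<close> two maps compete, \<open>f\<close> from the presentation of
    \<open>P\<close> and \<open>F\<close> from the tower. They agree on \<open>p\<close> and on
    \<open>D\<close>, which express every element of \<open>P\<close> by
    \<open>Prep\<close>.\<close>
  have FP: "F g = f g" if g: "g \<in> P" for g
  proof -
    obtain k l b where b: "b \<in> D" "g = p [^] (k::nat) \<otimes> b \<otimes> inv (p [^] (l::nat))" using Prep [OF g] by blast
    have "F b = f b" using F(2) [of b] f1(2) [OF b(1)] b(1) DB by auto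
    moreover have "F g = F p [^]\<^bsub>?E\<^esub> k \<otimes>\<^bsub>?E\<^esub> F b \<otimes>\<^bsub>?E\<^esub> inv\<^bsub>?E\<^esub> (F p [^]\<^bsub>?E\<^esub> l)"
      unfolding b(2) using b(1) P(2) PA by (intro homs_rep [OF F.homs_on_axioms pA]) auto
    moreover have "f g = f p [^]\<^bsub>?E\<^esub> k \<otimes>\<^bsub>?E\<^esub> f b \<otimes>\<^bsub>?E\<^esub> inv\<^bsub>?E\<^esub> (f p [^]\<^bsub>?E\<^esub> l)"
      unfolding b(2) using b(1) P(2) by (intro homs_rep [OF f.homs_on_axioms P(3)]) auto
    ultimately show ?thesis using Fp by simp
  qed
  have gen: "generates G A y' X'"
    unfolding y'_def X'_def
  proof (rule generates_add [OF presentsD(1) [OF pr] P(1) AA PA tA])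
    fix H assume H: "subgroup H G" "P \<subseteq> H" "t \<in> H"
    then have "B \<subseteq> H" using asc_subset [OF BD H(1)] P(2) by auto
    moreover have "p \<otimes> t \<in> H" using H P(3) subgroup.m_closed [OF H(1)] by auto
    ultimately show "A \<subseteq> H" by (rule asc_subset [OF AB H(1)])
  qed
  have y'X: "y' ` X' \<subseteq> carrier G" using generatesD(1) [OF gen] subgroup.subset [OF AA] by auto
  have y'S: "y' \<circ> Some = y" by (auto simp: y'_def)
  have yc: "y' None = t" by (simp add: y'_def)
  have evs: "ev G y' (rename Some r) = ev G y r" for r by (simp add: ev_rename y'S)
  have evT': "ev G y' [T] = t" "ev G y' [T'] = inv t" "ev G y' (replicate k T) = t [^] k"
    "ev G y' (replicate k T') = inv (t [^] k)" for k
    using ev_replicate [of y' None k] by (simp_all add: T_def T'_def yc)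
  have rr: "ev G y' (v @ inv_word v') = \<one>" if "v \<in> words_on X'" "v' \<in> words_on X'" "ev G y' v = ev G y' v'" for v v'
    using that ev_append [OF y'X] ev_inv_word [OF y'X] ev_in_carrier [OF y'X] by simp
  have ev1: "ev G y' r = \<one>" if r: "r \<in> R'" for r
  proof -
    consider r0 where "r0 \<in> R" "r = rename Some r0" | q where "q \<in> Z" "r = lhs q @ inv_word (rhs q)"
      | "r = lhs0 @ inv_word rhs0" using r unfolding R'_def by blast
    then show ?thesis
    proof cases
      case 1
      then show ?thesis using presentsD(4) [OF pr 1(1)] by (simp add: evs)
    next
      case 2
      have "ev G y' (lhs q) = inv t \<otimes> z q \<otimes> t"
        unfolding lhs_def using u [OF 2(1)] T sub Dc [OF zD [OF 2(1)]]
        by (simp add: ev_append [OF y'X] evT' evs m_assoc del: ev.simps append_Cons append_Nil words_on_simps(2))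
      moreover have "ev G y' (rhs q) = inv t \<otimes> z q \<otimes> t"
        using w [OF 2(1)] by (simp add: rhs_def evs)
      ultimately show ?thesis unfolding 2(2) using W [OF 2(1)] by (intro rr) auto
    next
      case 3
      have p: "rename Some wp @ [T] \<in> words_on X'" using T(1) sub [OF wp(1)] by simp
      have pt: "ev G y' (rename Some wp @ [T]) = p \<otimes> t"
        using ev_append [OF y'X sub [OF wp(1)] T(1)] by (simp add: evT'(1) evs wp(2) del: ev.simps)
      have "ev G y' lhs0 = inv (p \<otimes> t) \<otimes> t \<otimes> (p \<otimes> t)"
        unfolding lhs0_def using p T(1) pt
        by (simp add: ev_append [OF y'X] ev_inv_word [OF y'X] evT' m_assoc del: ev.simps append_Cons append_Nil words_on_simps(2) append_assoc inv_word_simps)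
      moreover have "ev G y' rhs0 = t [^] i \<otimes> bt \<otimes> inv (t [^] j)"
        unfolding rhs0_def using T sub [OF wb(1)] Dc [OF bt(1)] wb(2)
        by (simp add: ev_append [OF y'X] evT' evs m_assoc del: ev.simps append_Cons append_Nil words_on_simps(2))
      ultimately show ?thesis unfolding 3 using W0 bt(2) by (intro rr) auto
    qed
  qed
  have "presents G A y' X' R'"
  proof (rule presentsI [OF AA gen R' ev1 F(1)])
    fix x assume "x \<in> X'"
    then consider x0 where "x0 \<in> X" "x = Some x0" | "x = None" by (auto simp: X'_def)
    then show "F (y' x) = pgen X' R' x"
    proof cases
      case 1
      have "y x0 \<in> P" using presentsD(2) [OF pr] 1 by auto
      then show ?thesis using FP f(2) [OF 1(1)] 1 by (simp add: y'_def e_def)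
    next
      case 2
      then show ?thesis using Ft by (simp add: y'_def s_def e_def)
    qed
  qed
  moreover have "card R' \<le> card R + card Z + 1"
  proof -
    have "card R' \<le> card (rename (Some :: nat \<Rightarrow> _) ` R) + card ((\<lambda>q. lhs q @ inv_word (rhs q)) ` Z) + card {lhs0 @ inv_word rhs0}"
      unfolding R'_def by (meson add_le_mono card_Un_le le_refl order_trans)
    then show ?thesis using card_image_le [OF X(2), of "rename Some"] card_image_le [OF Z(1), of "\<lambda>q. lhs q @ inv_word (rhs q)"]
      by simp
  qed
  moreover have "card X' = Suc (card X)" using X by (simp add: X'_def card_image)
  ultimately show ?thesis using X Z by (intro cost_leI [of X' R']) (auto simp: X'_def R'_def)
qed

end

subsection \<open>Central extensions by an infinite cyclic group\<close>

text \<open>\<open>None\<close> will be a central letter. \<open>strip\<close> forgets it and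
  \<open>expo\<close> is its exponent sum, so that \<open>ev_strip\<close> can collect it at the end
  of a word.\<close>

primrec strip :: "'x option word \<Rightarrow> 'x word" where
  "strip [] = []"
| "strip (a # w) = (case snd a of None \<Rightarrow> strip w | Some x \<Rightarrow> (fst a, x) # strip w)"

primrec expo :: "'x option word \<Rightarrow> int" where
  "expo [] = 0"
| "expo (a # w) = (case snd a of None \<Rightarrow> (if fst a then - 1 else 1) + expo w | Some x \<Rightarrow> expo w)"

definition zpow_word :: "int \<Rightarrow> 'x option word" where
  "zpow_word k = replicate (nat \<bar>k\<bar>) (k < 0, None)"

lemma pres_eq_inv_word: "pres_eq R u v \<Longrightarrow> pres_eq R (inv_word u) (inv_word v)"
proof -
  assume uv: "pres_eq R u v"
  have "pres_eq R (inv_word u @ []) (inv_word u @ (v @ inv_word v))"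
    by (intro pres_eq_append_left pres_sym [OF pres_eq_inv_right])
  also have "pres_eq R (inv_word u @ (v @ inv_word v)) (inv_word u @ (u @ inv_word v))"
    by (intro pres_eq_append_left pres_eq_append_right pres_sym [OF uv])
  also (pres_trans) have "pres_eq R (inv_word u @ (u @ inv_word v)) ([] @ inv_word v)"
    using pres_eq_append_right [OF pres_eq_inv_left [of R u], of "inv_word v"] by simp
  finally (pres_trans) show ?thesis by simp
qed

context group
begin

lemma subgroup_centralizer:
  assumes "S \<subseteq> carrier G"
  shows "subgroup {g \<in> carrier G. \<forall>a\<in>S. a \<otimes> g = g \<otimes> a} G"
proof (rule subgroupI)
  fix g assume g: "g \<in> {g \<in> carrier G. \<forall>a\<in>S. a \<otimes> g = g \<otimes> a}"
  have "a \<otimes> inv g = inv g \<otimes> a" if a: "a \<in> S" for a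
  proof -
    have ac: "a \<in> carrier G" and gc: "g \<in> carrier G" and e: "a \<otimes> g = g \<otimes> a" using a assms g by auto
    have "inv g \<otimes> (a \<otimes> g) \<otimes> inv g = inv g \<otimes> (g \<otimes> a) \<otimes> inv g" using e by simp
    then show ?thesis using ac gc by (simp add: m_assoc)
  qed
  then show "inv g \<in> {g \<in> carrier G. \<forall>a\<in>S. a \<otimes> g = g \<otimes> a}" using g by blast
  fix h assume h: "h \<in> {g \<in> carrier G. \<forall>a\<in>S. a \<otimes> g = g \<otimes> a}"
  have "a \<otimes> (g \<otimes> h) = g \<otimes> h \<otimes> a" if a: "a \<in> S" for a
  proof -
    have c: "a \<in> carrier G" "g \<in> carrier G" "h \<in> carrier G" and e: "a \<otimes> g = g \<otimes> a" "a \<otimes> h = h \<otimes> a"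
      using a assms g h by auto
    have "a \<otimes> (g \<otimes> h) = a \<otimes> g \<otimes> h" using c by (simp add: m_assoc)
    also have "\<dots> = g \<otimes> (a \<otimes> h)" using c e(1) by (simp add: m_assoc)
    also have "\<dots> = g \<otimes> h \<otimes> a" using c e(2) by (simp add: m_assoc)
    finally show ?thesis .
  qed
  then show "g \<otimes> h \<in> {g \<in> carrier G. \<forall>a\<in>S. a \<otimes> g = g \<otimes> a}" using g h by blast
next
  have "\<one> \<in> {g \<in> carrier G. \<forall>a\<in>S. a \<otimes> g = g \<otimes> a}" using assms by (simp add: subset_iff)
  then show "{g \<in> carrier G. \<forall>a\<in>S. a \<otimes> g = g \<otimes> a} \<noteq> {}" by blast
qed blast

lemma int_pow_mem:
  assumes "subgroup A G" "a \<in> A" shows "a [^] (k::int) \<in> A"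
  unfolding int_pow_def2 using pow_mem [OF assms] subgroup.m_inv_closed [OF assms(1)] by metis

lemma int_pow_comm:
  assumes "a \<in> carrier G" "z \<in> carrier G" "a \<otimes> z = z \<otimes> a"
  shows "a \<otimes> z [^] (k::int) = z [^] k \<otimes> a"
proof -
  have "z [^] k \<in> {g \<in> carrier G. \<forall>b\<in>{a}. b \<otimes> g = g \<otimes> b}"
    using int_pow_mem [OF subgroup_centralizer] assms by blast
  then show ?thesis by simp
qed

lemma ev_comm:
  assumes "y ` X \<subseteq> carrier G" "z \<in> carrier G" "\<And>x. x \<in> X \<Longrightarrow> y x \<otimes> z = z \<otimes> y x" "w \<in> words_on X"
  shows "ev G y w \<otimes> z = z \<otimes> ev G y w"
proof -
  have "y ` X \<subseteq> {g \<in> carrier G. \<forall>a\<in>{z}. a \<otimes> g = g \<otimes> a}"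
    using assms(1,3) by (simp add: image_subset_iff)
  then have "ev G y w \<in> {g \<in> carrier G. \<forall>a\<in>{z}. a \<otimes> g = g \<otimes> a}"
    using ev_closed [OF subgroup_centralizer _ assms(4)] assms(2) by blast
  then show ?thesis by simp
qed

lemma ev_zpow_word:
  assumes "y None \<in> carrier G" shows "ev G y (zpow_word k) = y None [^] k"
proof (cases "k < 0")
  case True
  then have 1: "zpow_word k = replicate (nat (- k)) (True, None :: 'd option)" by (simp add: zpow_word_def)
  show ?thesis unfolding 1 ev_replicate(2) [of y None, OF assms] using True by (simp only: int_pow_def2 if_True)
next
  case False
  then have 1: "zpow_word k = replicate (nat k) (False, None :: 'd option)" by (simp add: zpow_word_def)
  show ?thesis unfolding 1 ev_replicate(1) [of y None, OF assms] using False by (simp only: int_pow_def2 if_False)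
qed

lemma ev_strip:
  assumes y: "y ` insert None (Some ` X) \<subseteq> carrier G"
    and comm: "\<And>x. x \<in> X \<Longrightarrow> y (Some x) \<otimes> y None = y None \<otimes> y (Some x)"
    and w: "w \<in> words_on (insert None (Some ` X))"
  shows "strip w \<in> words_on X \<and> ev G y w = ev G (y \<circ> Some) (strip w) \<otimes> y None [^] expo w"
  using w
proof (induction w)
  case Nil
  then show ?case using y by simp
next
  case (Cons a w)
  then have w: "strip w \<in> words_on X" "ev G y w = ev G (y \<circ> Some) (strip w) \<otimes> y None [^] expo w"
    by (simp_all del: comp_apply)
  have z: "y None \<in> carrier G" using y by auto
  have yS: "(y \<circ> Some) ` X \<subseteq> carrier G" using y by auto
  let ?u = "ev G (y \<circ> Some) (strip w)"
  have u: "?u \<in> carrier G" by (rule ev_in_carrier [OF yS w(1)])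
  show ?case
  proof (cases "snd a")
    case None
    have uz: "?u \<otimes> y None = y None \<otimes> ?u" by (rule ev_comm [OF yS z _ w(1)]) (simp add: comm)
    define l :: int where "l = (if fst a then - 1 else 1)"
    have "ev G y (a # w) = y None [^] l \<otimes> ev G y w"
      using None z by (simp add: l_def int_pow_neg)
    also have "\<dots> = (y None [^] l \<otimes> ?u) \<otimes> y None [^] expo w"
      using u z by (simp add: w(2) m_assoc)
    also have "\<dots> = (?u \<otimes> y None [^] l) \<otimes> y None [^] expo w"
      using int_pow_comm [OF u z uz, of l] by simp
    also have "\<dots> = ?u \<otimes> (y None [^] l \<otimes> y None [^] expo w)"
      using u z by (simp add: m_assoc)
    finally show ?thesis using None w(1) z by (simp add: l_def comp_def flip: int_pow_mult)
  next
    case (Some x)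
    then have x: "x \<in> X" "y (Some x) \<in> carrier G" using Cons.prems y by auto
    show ?thesis using Some x w u z by (simp add: m_assoc comp_def)
  qed
qed

text \<open>A relator \<open>r\<close> of the quotient lifts to some power \<open>z [^] k r\<close>.
  The relators are these equations and the commutation of \<open>z\<close> with the generators. They
  reduce a word that is trivial in \<open>A\<close> to a power of the central letter, and the
  infinite order of \<open>z\<close> makes this power trivial.\<close>

theorem central_cost:
  assumes A: "subgroup A G" and zA: "z \<in> A" and comm: "\<And>a. a \<in> A \<Longrightarrow> a \<otimes> z = z \<otimes> a"
    and G': "group G'" and f: "f \<in> homs G A G'" and fz: "f z = \<one>\<^bsub>G'\<^esub>"
    and ker: "\<And>a. a \<in> A \<Longrightarrow> f a = \<one>\<^bsub>G'\<^esub> \<Longrightarrow> \<exists>k::int. a = z [^] k"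
    and inf: "\<And>k::int. z [^] k = \<one> \<Longrightarrow> k = 0"
    and cost: "cost_le G' (f ` A) c"
  shows "cost_le G A (2 * c + 1)"
proof -
  interpret G': group G' by fact
  interpret f: homs_on G G' A f by (rule homs_onI [OF G' A f])
  obtain X :: "nat set" and R y where X: "finite X" "finite R" "card X + card R \<le> c" and pr: "presents G' (f ` A) y X R"
    using cost by (auto simp: cost_le_def)
  have zc [simp]: "z \<in> carrier G" using f.A_carrier [OF zA] .
  have "\<forall>x\<in>X. \<exists>a\<in>A. f a = y x" using presentsD(2) [OF pr] by force
  then obtain v where v: "\<And>x. x \<in> X \<Longrightarrow> v x \<in> A \<and> f (v x) = y x" by metis
  have vX: "v ` X \<subseteq> A" using v by auto
  have vc: "v ` X \<subseteq> carrier G" using vX f.A_carrier by auto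
  have fv: "f (ev G v w) = ev G' y w" if "w \<in> words_on X" for w
    using f.ev [OF vX that] ev_cong [of X "f \<circ> v" y w G'] that v by simp
  have "\<forall>r\<in>R. \<exists>k::int. ev G v r = z [^] k"
    using ker ev_closed [OF A vX] fv presentsD(3,4) [OF pr] by (metis subsetD)
  then obtain k where k: "\<And>r. r \<in> R \<Longrightarrow> ev G v r = z [^] (k r :: int)" by metis
  define X' where "X' = insert None (Some ` X)"
  define y' where "y' = case_option z v"
  define com where "com x = [(False, Some x), (False, None)] @ inv_word [(False, None), (False, Some x)]" for x :: nat
  define rel where "rel r = rename Some r @ inv_word (zpow_word (k r))" for r :: "nat word"
  define R' where "R' = rel ` R \<union> com ` X"
  have zw: "zpow_word l \<in> words_on X'" for l by (auto simp: zpow_word_def X'_def)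
  have sub: "rename Some r \<in> words_on X'" if "r \<in> words_on X" for r
    using that by (auto simp: X'_def intro: rename_words_on)
  have R': "R' \<subseteq> words_on X'"
    using sub zw presentsD(3) [OF pr] by (auto simp: R'_def com_def rel_def) (auto simp: X'_def)
  have y'X: "y' ` X' \<subseteq> A" using vX zA by (auto simp: y'_def X'_def)
  then have y'c: "y' ` X' \<subseteq> carrier G" using f.A_carrier by auto
  have y'S: "y' \<circ> Some = v" by (auto simp: y'_def)
  have y'N: "y' None = z" by (simp add: y'_def)
  have evs: "ev G y' (rename Some r) = ev G v r" for r by (simp add: ev_rename y'S)
  have evz: "ev G y' (zpow_word l) = z [^] l" for l using ev_zpow_word [of y' l] y'N by simp
  have rr: "ev G y' (u @ inv_word u') = \<one>" if "u \<in> words_on X'" "u' \<in> words_on X'" "ev G y' u = ev G y' u'" for u u'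
    using that ev_append [OF y'c] ev_inv_word [OF y'c] ev_in_carrier [OF y'c] by simp
  have ev1: "ev G y' r = \<one>" if r: "r \<in> R'" for r
  proof -
    consider r0 where "r0 \<in> R" "r = rel r0" | x where "x \<in> X" "r = com x" using r unfolding R'_def by blast
    then show ?thesis
    proof cases
      case 1
      have "r0 \<in> words_on X" using presentsD(3) [OF pr] 1(1) by blast
      moreover have "ev G y' (rename Some r0) = ev G y' (zpow_word (k r0))"
        using k [OF 1(1)] by (simp add: evs evz)
      ultimately show ?thesis unfolding 1(2) rel_def using rr [OF sub zw] by blast
    next
      case 2
      have "v x \<in> A" using v [OF 2(1)] by simp
      then have "ev G y' [(False, Some x), (False, None)] = ev G y' [(False, None), (False, Some x)]"
        using comm [of "v x"] f.A_carrier [of "v x"] by (simp add: y'_def)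
      moreover have "[(False, Some x), (False, None)] \<in> words_on X'" "[(False, None), (False, Some x)] \<in> words_on X'"
        using 2(1) by (auto simp: X'_def)
      ultimately show ?thesis unfolding 2(2) com_def using rr by blast
    qed
  qed
  have gen: "generates G A y' X'"
  proof -
    have "\<exists>w\<in>words_on X'. ev G y' w = a" if a: "a \<in> A" for a
    proof -
      obtain w where w: "w \<in> words_on X" "ev G' y w = f a" using presentsD(6) [OF pr] a by blast
      have wA: "ev G v w \<in> A" by (rule ev_closed [OF A vX w(1)])
      have iA: "inv (ev G v w) \<otimes> a \<in> A" using wA a A by (simp add: subgroup.m_closed subgroup.m_inv_closed)
      have "f (inv (ev G v w) \<otimes> a) = \<one>\<^bsub>G'\<^esub>"
        using f.mult [of "inv (ev G v w)" a] f.inv [OF wA] wA a A fv [OF w(1)] w(2) f.closed [OF a]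
        by (simp add: subgroup.m_inv_closed)
      then obtain l where "inv (ev G v w) \<otimes> a = z [^] (l::int)" using ker [OF iA] by auto
      then have "ev G v w \<otimes> (inv (ev G v w) \<otimes> a) = ev G v w \<otimes> z [^] l" by simp
      then have al: "ev G v w \<otimes> z [^] l = a" using f.A_carrier [OF wA] f.A_carrier [OF a] by simp
      have "ev G y' (rename Some w @ zpow_word l) = ev G y' (rename Some w) \<otimes> ev G y' (zpow_word l)"
        by (rule ev_append [OF y'c sub [OF w(1)] zw])
      also have "\<dots> = a" unfolding evs evz by (rule al)
      finally have "ev G y' (rename Some w @ zpow_word l) = a" .
      moreover have "rename Some w @ zpow_word l \<in> words_on X'" using sub [OF w(1)] zw by simp
      ultimately show ?thesis by blast
    qed
    then show ?thesis using y'X by (auto simp: generates_def)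
  qed
  let ?E = "pres_group X' R'"
  interpret E: group ?E by (rule group_pres_group)
  define e where "e = pgen X' R'"
  have e: "range e \<subseteq> carrier ?E" by (auto simp: e_def)
  then have ec [simp]: "e x \<in> carrier ?E" for x by auto
  have rel1: "ev ?E e r = \<one>\<^bsub>?E\<^esub>" if "r \<in> R'" for r
    using pgen_relator [of r R' X'] that R' by (auto simp: e_def)
  define s where "s = e None"
  have s [simp]: "s \<in> carrier ?E" by (simp add: s_def)
  \<comment> \<open>Required for every letter, also off \<open>X\<close>, because the derivations
    treated in \<open>claim\<close> may use all of them.\<close>
  have scomm: "e (Some x) \<otimes>\<^bsub>?E\<^esub> s = s \<otimes>\<^bsub>?E\<^esub> e (Some x)" for x
  proof (cases "x \<in> X")
    case True
    have "ev ?E e [(False, Some x), (False, None)] = ev ?E e [(False, None), (False, Some x)]"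
      using rel1 [of "com x"] True by (intro E.relator_eq [OF e]) (auto simp: R'_def com_def)
    then show ?thesis by (simp add: s_def)
  next
    case False
    then have "e (Some x) = \<one>\<^bsub>?E\<^esub>" by (auto simp: e_def pgen_def X'_def)
    then show ?thesis by simp
  qed
  define U where "U = ev ?E (e \<circ> Some)"
  have eS: "range (e \<circ> Some) \<subseteq> carrier ?E" using e by auto
  have Uc [simp]: "U u \<in> carrier ?E" for u unfolding U_def by (rule E.ev_carrier [OF eS])
  have U0 [simp]: "U [] = \<one>\<^bsub>?E\<^esub>" by (simp add: U_def)
  have Uapp: "U (u @ u') = U u \<otimes>\<^bsub>?E\<^esub> U u'" for u u'
    unfolding U_def by (rule E.ev_append [OF eS words_on_simps(4) words_on_simps(4)])
  have Us: "U u \<otimes>\<^bsub>?E\<^esub> s [^]\<^bsub>?E\<^esub> (l::int) = s [^]\<^bsub>?E\<^esub> l \<otimes>\<^bsub>?E\<^esub> U u" for u l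
  proof (rule E.int_pow_comm [OF Uc s])
    show "U u \<otimes>\<^bsub>?E\<^esub> s = s \<otimes>\<^bsub>?E\<^esub> U u"
      unfolding U_def by (rule E.ev_comm [OF eS s _ words_on_simps(4)]) (simp add: scomm)
  qed
  have Ez: "ev ?E e (zpow_word l) = s [^]\<^bsub>?E\<^esub> l" for l using E.ev_zpow_word [of e l] by (simp add: s_def)
  \<comment> \<open>Deleting a relator \<open>r\<close> of the quotient changes the value by the
    power of \<open>s\<close> with exponent \<open>k r\<close>, and cancellations do not change it.
    As \<open>s\<close> is central, such powers can be collected.\<close>
  have claim: "\<exists>l::int. U u = U u' \<otimes>\<^bsub>?E\<^esub> s [^]\<^bsub>?E\<^esub> l" if "pres_eq R u u'" for u u'
    using that
  proof induction
    case (pres_refl w)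
    show ?case by (intro exI [of _ 0]) simp
  next
    case (pres_sym u u')
    then obtain l where l: "U u = U u' \<otimes>\<^bsub>?E\<^esub> s [^]\<^bsub>?E\<^esub> (l::int)" by auto
    have "U u' = U u \<otimes>\<^bsub>?E\<^esub> s [^]\<^bsub>?E\<^esub> (- l)"
      unfolding l by (simp add: E.m_assoc E.int_pow_neg)
    then show ?case by blast
  next
    case (pres_trans u u' u'')
    then obtain l l' where l: "U u = U u' \<otimes>\<^bsub>?E\<^esub> s [^]\<^bsub>?E\<^esub> (l::int)" "U u' = U u'' \<otimes>\<^bsub>?E\<^esub> s [^]\<^bsub>?E\<^esub> (l'::int)"
      by blast
    have "U u = U u'' \<otimes>\<^bsub>?E\<^esub> s [^]\<^bsub>?E\<^esub> (l' + l)"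
      unfolding l by (simp add: E.m_assoc E.int_pow_mult)
    then show ?case by blast
  next
    case (pres_cancel u a u')
    have "U (u @ [a, inv_letter a] @ u') = U (u @ u')"
      unfolding U_def by (rule E.pres_eq_ev [OF eS _ pres_eq.pres_cancel, of "{}"]) simp
    then show ?case by (intro exI [of _ 0]) simp
  next
    case (pres_rel r u u')
    have "ev ?E e (rename Some r) = ev ?E e (zpow_word (k r))"
      using rel1 [of "rel r"] pres_rel by (intro E.relator_eq [OF e]) (auto simp: R'_def rel_def)
    then have r: "U r = s [^]\<^bsub>?E\<^esub> k r" unfolding U_def ev_rename Ez .
    have "U (u @ r @ u') = U u \<otimes>\<^bsub>?E\<^esub> (s [^]\<^bsub>?E\<^esub> k r \<otimes>\<^bsub>?E\<^esub> U u')"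
      by (simp add: Uapp r)
    also have "\<dots> = U (u @ u') \<otimes>\<^bsub>?E\<^esub> s [^]\<^bsub>?E\<^esub> k r"
      using Us [of u' "k r"] by (simp add: Uapp E.m_assoc)
    finally show ?case by blast
  qed
  \<comment> \<open>The map back to \<open>G\<close> detects the exponent of \<open>s\<close>,
    because it sends \<open>s\<close> to \<open>z\<close>, of infinite order.\<close>
  obtain \<Psi> where \<Psi>: "\<And>w. w \<in> words_on X' \<Longrightarrow> \<Psi> (ev ?E e w) = ev G y' w"
    using E.presents_hom [OF E.subgroup_self presents_pres_group [OF R'] group_axioms y'c ev1] by (metis e_def)
  have "pres_eq R' w []" if w: "w \<in> words_on X'" "ev G y' w = \<one>" for w
  proof -
    have ws: "strip w \<in> words_on X" "ev G y' w = ev G v (strip w) \<otimes> z [^] expo w"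
    proof -
      have "y' (Some x) \<otimes> y' None = y' None \<otimes> y' (Some x)" if "x \<in> X" for x
        using comm [of "v x"] v [OF that] by (simp add: y'_def)
      then show "strip w \<in> words_on X" "ev G y' w = ev G v (strip w) \<otimes> z [^] expo w"
        using ev_strip [of y' X w] w(1) y'c by (simp_all only: X'_def y'S y'N)
    qed
    have es: "ev ?E e w = U (strip w) \<otimes>\<^bsub>?E\<^esub> s [^]\<^bsub>?E\<^esub> expo w"
      using E.ev_strip [of e X w, OF _ scomm [unfolded s_def]] w(1) e unfolding X'_def s_def U_def by blast
    have wA: "ev G v (strip w) \<in> A" "z [^] expo w \<in> A"
      using ev_closed [OF A vX ws(1)] int_pow_mem [OF A zA] by auto
    have fn: "f (z [^] (n::nat)) = \<one>\<^bsub>G'\<^esub>" for n using f.pow [OF zA, of n] fz by simp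
    have "f (z [^] expo w) = \<one>\<^bsub>G'\<^esub>"
    proof (cases "expo w < 0")
      case True
      then show ?thesis using fn f.inv [OF pow_mem [OF A zA, of "nat (- expo w)"]] by (simp only: int_pow_def2 if_True G'.inv_one)
    next
      case False
      then show ?thesis using fn by (simp only: int_pow_def2 if_False)
    qed
    then have "f (ev G v (strip w)) = f (ev G v (strip w) \<otimes> z [^] expo w)"
      using f.mult [OF wA] f.closed [OF wA(1)] by simp
    also have "\<dots> = \<one>\<^bsub>G'\<^esub>" using ws(2) w(2) by (metis f.one)
    finally have "f (ev G v (strip w)) = \<one>\<^bsub>G'\<^esub>" .
    then have "pres_eq R (strip w) []" using presentsD(5) [OF pr ws(1)] fv [OF ws(1)] by simp
    then obtain l where "U (strip w) = U [] \<otimes>\<^bsub>?E\<^esub> s [^]\<^bsub>?E\<^esub> (l::int)" using claim by blast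
    then have ew: "ev ?E e w = s [^]\<^bsub>?E\<^esub> (l + expo w)"
      using es E.int_pow_mult [OF s, of l "expo w"] by simp
    then have "ev G y' (zpow_word (l + expo w)) = ev G y' w"
      using \<Psi> [OF w(1)] \<Psi> [OF zw, of "l + expo w"] Ez [of "l + expo w"] by metis
    then have "l + expo w = 0" using inf [of "l + expo w"] w(2) evz [of "l + expo w"] by metis
    then have "ev ?E e w = \<one>\<^bsub>?E\<^esub>" using ew by simp
    then show ?thesis using w(1) by (simp add: e_def ev_pgen pres_group_one pres_class_eq_iff)
  qed
  then have "presents G A y' X' R'" using gen R' ev1 by (auto simp: presents_def)
  moreover have "card R' \<le> card R + card X"
    unfolding R'_def using X by (meson add_mono card_Un_le card_image_le le_trans)
  moreover have "card X' = Suc (card X)" using X by (simp add: X'_def card_image)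
  ultimately show ?thesis using X by (intro cost_leI [of X' R']) (auto simp: X'_def R'_def)
qed

end

subsection \<open>Reidemeister--Schreier rewriting for kernels\<close>

text \<open>\<open>lift Q p w a\<close> spells the path labelled \<open>w\<close> from \<open>a\<close> in the Cayley graph of \<open>Q\<close>; the
  pair \<open>(x, a)\<close> names the edge labelled \<open>x\<close> that leaves \<open>a\<close>.\<close>

primrec lift :: "('q, 'n) monoid_scheme \<Rightarrow> ('x \<Rightarrow> 'q) \<Rightarrow> 'x word \<Rightarrow> 'q \<Rightarrow> ('x \<times> 'q) word" where
  "lift Q p [] a = []"
| "lift Q p (l # w) a =
    (if fst l then (True, (snd l, a \<otimes>\<^bsub>Q\<^esub> inv\<^bsub>Q\<^esub> (p (snd l)))) # lift Q p w (a \<otimes>\<^bsub>Q\<^esub> inv\<^bsub>Q\<^esub> (p (snd l)))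
     else (False, (snd l, a)) # lift Q p w (a \<otimes>\<^bsub>Q\<^esub> p (snd l)))"

primrec subst :: "('z \<Rightarrow> 'x word) \<Rightarrow> 'z word \<Rightarrow> 'x word" where
  "subst g [] = []"
| "subst g (l # w) = (if fst l then inv_word (g (snd l)) else g (snd l)) @ subst g w"

context group
begin

lemma ev_subst:
  assumes y: "range y \<subseteq> carrier G"
  shows "ev G y (subst g w) = ev G (\<lambda>x. ev G y (g x)) w"
  by (induction w)
    (simp_all add: ev_append [OF y words_on_simps(4) words_on_simps(4)] ev_inv_word [OF y words_on_simps(4)])

lemma lift_append:
  assumes p: "range p \<subseteq> carrier G" and a: "a \<in> carrier G"
  shows "lift G p (u @ v) a = lift G p u a @ lift G p v (a \<otimes> ev G p u)"
  using a
proof (induction u arbitrary: a)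
  case (Cons l u)
  have "p (snd l) \<in> carrier G" "ev G p u \<in> carrier G" using p ev_carrier [OF p] by auto
  then show ?case using Cons by (simp add: m_assoc)
qed simp

text \<open>The inverse word traverses the same path backwards, starting from its end point.\<close>

lemma lift_inv_word:
  assumes p: "range p \<subseteq> carrier G" and a: "a \<in> carrier G"
  shows "lift G p (inv_word u) (a \<otimes> ev G p u) = inv_word (lift G p u a)"
  using a
proof (induction u arbitrary: a)
  case (Cons l u)
  have c [simp]: "p (snd l) \<in> carrier G" "ev G p u \<in> carrier G" using p ev_carrier [OF p] by auto
  define q where "q = (if fst l then inv (p (snd l)) else p (snd l))"
  have q [simp]: "q \<in> carrier G" by (simp add: q_def)
  have "lift G p (inv_word (l # u)) (a \<otimes> ev G p (l # u)) =
      lift G p (inv_word u) (a \<otimes> q \<otimes> ev G p u) @ lift G p [inv_letter l] (a \<otimes> q \<otimes> ev G p u \<otimes> ev G p (inv_word u))"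
    using lift_append [OF p, of "a \<otimes> q \<otimes> ev G p u" "inv_word u" "[inv_letter l]"] Cons.prems
    by (simp add: q_def m_assoc)
  also have "a \<otimes> q \<otimes> ev G p u \<otimes> ev G p (inv_word u) = a \<otimes> q"
    using Cons.prems ev_inv_word [OF p words_on_simps(4)] by (simp add: m_assoc)
  also have "lift G p (inv_word u) (a \<otimes> q \<otimes> ev G p u) = inv_word (lift G p u (a \<otimes> q))"
    using Cons.IH [of "a \<otimes> q"] Cons.prems by simp
  finally show ?case using Cons.prems by (simp add: q_def m_assoc inv_letter_def)
qed simp

lemma lift_words_on:
  assumes "subgroup S G" "range p \<subseteq> S" "a \<in> S" "w \<in> words_on X"
  shows "lift G p w a \<in> words_on (X \<times> S)"
  using assms(3,4)
proof (induction w arbitrary: a)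
  case (Cons l w)
  have "p (snd l) \<in> S" using assms(2) by auto
  then show ?case using Cons assms(1) by (simp add: subgroup.m_closed subgroup.m_inv_closed)
qed simp

text \<open>A relator is a closed path at every vertex of the Cayley graph. Removing it leaves the
  lift of the rest unchanged, and what is removed is one of its lifts.\<close>

lemma lift_pres_eq:
  assumes S: "subgroup S G" and p: "range p \<subseteq> S" and R: "\<And>r. r \<in> R \<Longrightarrow> ev G p r = \<one>"
    and R': "\<And>r a. r \<in> R \<Longrightarrow> a \<in> S \<Longrightarrow> lift G p r a \<in> R'" and "pres_eq R u v" "a \<in> S"
  shows "pres_eq R' (lift G p u a) (lift G p v a)"
proof -
  have pc: "range p \<subseteq> carrier G" using p subgroup.subset [OF S] by blast
  have evS: "a \<otimes> ev G p w \<in> S" if "a \<in> S" for a w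
    using that ev_closed [OF S p, of w] S by (simp add: subgroup.m_closed)
  note Sc = subgroup.mem_carrier [OF S]
  show ?thesis using assms(5,6)
  proof (induction arbitrary: a)
    case (pres_cancel u l v)
    have c: "p (snd l) \<in> carrier G" using pc by auto
    define b where "b = a \<otimes> ev G p u"
    have b: "b \<in> carrier G" using Sc evS pres_cancel by (simp add: b_def)
    have a: "a \<in> carrier G" using pres_cancel Sc by simp
    obtain k where k: "lift G p [l, inv_letter l] b = [k, inv_letter k]"
      using b c by (cases "fst l") (auto simp: inv_letter_def m_assoc)
    have 1: "ev G p [l, inv_letter l] = \<one>" using c by (auto simp: inv_letter_def)
    have "lift G p (u @ [l, inv_letter l] @ v) a = lift G p u a @ [k, inv_letter k] @ lift G p v b"
      using lift_append [OF pc a, of u "[l, inv_letter l] @ v"] lift_append [OF pc b, of "[l, inv_letter l]" v] 1 k b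
      by (simp add: b_def del: lift.simps ev.simps append_Cons)
    moreover have "lift G p (u @ v) a = lift G p u a @ lift G p v b"
      using lift_append [OF pc a, of u v] by (simp add: b_def)
    ultimately show ?case by (simp only: pres_eq.pres_cancel)
  next
    case (pres_rel r u v)
    define b where "b = a \<otimes> ev G p u"
    have bS: "b \<in> S" using evS pres_rel by (simp add: b_def)
    have a: "a \<in> carrier G" and b: "b \<in> carrier G" using pres_rel bS Sc by auto
    have "lift G p (u @ r @ v) a = lift G p u a @ lift G p r b @ lift G p v b"
      using lift_append [OF pc a, of u "r @ v"] lift_append [OF pc b, of r v] R [OF pres_rel(1)] b
      by (simp add: b_def)
    moreover have "lift G p (u @ v) a = lift G p u a @ lift G p v b"
      using lift_append [OF pc a, of u v] by (simp add: b_def)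
    ultimately show ?case using R' [OF pres_rel(1) bS] by (simp only: pres_eq.pres_rel)
  next
    case (pres_sym u v)
    show ?case using pres_sym.IH [OF pres_sym.prems] by (rule pres_eq.pres_sym)
  next
    case (pres_trans u v w)
    show ?case using pres_trans.IH(1) [OF pres_trans.prems] pres_trans.IH(2) [OF pres_trans.prems]
      by (rule pres_eq.pres_trans)
  qed (rule pres_eq.pres_refl)
qed

text \<open>Each edge is sent to its label, framed by the representatives \<open>s\<close> of its
  end points; along a path the inner representatives cancel.\<close>

lemma ev_lift:
  assumes Q: "group Q" and S: "subgroup S Q" and p: "range p \<subseteq> S" and y: "range y \<subseteq> carrier G"
    and s: "\<And>a. a \<in> S \<Longrightarrow> s a \<in> carrier G" and "a \<in> S"
  shows "ev G (\<lambda>(x, a). s a \<otimes> y x \<otimes> inv (s (a \<otimes>\<^bsub>Q\<^esub> p x))) (lift Q p w a) =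
    s a \<otimes> ev G y w \<otimes> inv (s (a \<otimes>\<^bsub>Q\<^esub> ev Q p w))"
  using assms(6)
proof (induction w arbitrary: a)
  interpret Q: group Q by fact
  note Sc = subgroup.mem_carrier [OF S]
  have pc: "range p \<subseteq> carrier Q" using p Sc by blast
  {
    case Nil
    then show ?case using s Sc by simp
  next
    case (Cons l w)
    define q where "q = (if fst l then inv\<^bsub>Q\<^esub> (p (snd l)) else p (snd l))"
    define g where "g = (if fst l then inv (y (snd l)) else y (snd l))"
    let ?Y = "\<lambda>(x, a). s a \<otimes> y x \<otimes> inv (s (a \<otimes>\<^bsub>Q\<^esub> p x))"
    have pS: "p (snd l) \<in> S" and yc: "y (snd l) \<in> carrier G" using p y by auto
    have qS: "q \<in> S" using pS S by (simp add: q_def subgroup.m_inv_closed)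
    have aq: "a \<otimes>\<^bsub>Q\<^esub> q \<in> S" using qS Cons.prems S by (simp add: subgroup.m_closed)
    have g: "g \<in> carrier G" using yc by (simp add: g_def)
    have ew: "ev G y w \<in> carrier G" "ev Q p w \<in> S" using ev_carrier [OF y] Q.ev_closed [OF S p, of w] by auto
    have c: "a \<in> carrier Q" "q \<in> carrier Q" "ev Q p w \<in> carrier Q" "p (snd l) \<in> carrier Q"
      using Cons.prems qS ew pS Sc by auto
    have sa: "s a \<in> carrier G" "s (a \<otimes>\<^bsub>Q\<^esub> q) \<in> carrier G" using s Cons.prems aq by auto
    have "a \<otimes>\<^bsub>Q\<^esub> q \<otimes>\<^bsub>Q\<^esub> ev Q p w \<in> S" using aq ew S by (simp add: subgroup.m_closed)
    then have sw: "s (a \<otimes>\<^bsub>Q\<^esub> q \<otimes>\<^bsub>Q\<^esub> ev Q p w) \<in> carrier G" using s by simp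
    have "ev G ?Y (lift Q p (l # w) a) = (s a \<otimes> g \<otimes> inv (s (a \<otimes>\<^bsub>Q\<^esub> q))) \<otimes> ev G ?Y (lift Q p w (a \<otimes>\<^bsub>Q\<^esub> q))"
    proof (cases "fst l")
      case True
      have "a \<otimes>\<^bsub>Q\<^esub> inv\<^bsub>Q\<^esub> p (snd l) \<otimes>\<^bsub>Q\<^esub> p (snd l) = a" using c by (simp add: Q.m_assoc)
      moreover have "s (a \<otimes>\<^bsub>Q\<^esub> inv\<^bsub>Q\<^esub> p (snd l)) \<in> carrier G" using sa(2) True by (simp add: q_def)
      ultimately show ?thesis using True sa(1) yc by (simp add: q_def g_def group_word)
    next
      case False
      then show ?thesis by (simp add: q_def g_def)
    qed
    also have "ev G ?Y (lift Q p w (a \<otimes>\<^bsub>Q\<^esub> q)) = s (a \<otimes>\<^bsub>Q\<^esub> q) \<otimes> ev G y w \<otimes> inv (s (a \<otimes>\<^bsub>Q\<^esub> q \<otimes>\<^bsub>Q\<^esub> ev Q p w))"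
      by (rule Cons.IH [OF aq])
    also have "(s a \<otimes> g \<otimes> inv (s (a \<otimes>\<^bsub>Q\<^esub> q))) \<otimes> (s (a \<otimes>\<^bsub>Q\<^esub> q) \<otimes> ev G y w \<otimes> inv (s (a \<otimes>\<^bsub>Q\<^esub> q \<otimes>\<^bsub>Q\<^esub> ev Q p w))) =
        s a \<otimes> (g \<otimes> ev G y w) \<otimes> inv (s (a \<otimes>\<^bsub>Q\<^esub> q \<otimes>\<^bsub>Q\<^esub> ev Q p w))"
      using sa sw g ew(1) by (simp add: m_assoc)
    also have "a \<otimes>\<^bsub>Q\<^esub> q \<otimes>\<^bsub>Q\<^esub> ev Q p w = a \<otimes>\<^bsub>Q\<^esub> ev Q p (l # w)" using c by (simp add: q_def Q.m_assoc)
    also have "g \<otimes> ev G y w = ev G y (l # w)" by (simp add: g_def)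
    finally show ?case .
  }
qed

text \<open>The generators are the edges of the Cayley graph. The relators are the lifts of
  \<open>R\<close> at all vertices and, for each vertex, the chosen path to it; the latter play the
  part of a spanning tree and account for the summand 1 in the bound.\<close>

theorem presents_kern:
  assumes A: "subgroup A G" and Q: "group Q" and \<pi>: "\<pi> \<in> homs G A Q" and fin: "finite (\<pi> ` A)"
    and X: "finite X" "finite R" and pr: "presents G A y X R"
  shows "cost_le G (kern A Q \<pi>) (card (\<pi> ` A) * (card X + card R + 1))"
proof -
  interpret Q: group Q by fact
  interpret \<pi>: homs_on G Q A \<pi> by (rule homs_onI [OF Q A \<pi>])
  define S where "S = \<pi> ` A"
  have S: "subgroup S Q" unfolding S_def by (rule subgroup_homs_image [OF A Q \<pi>])
  note Sc = subgroup.mem_carrier [OF S] and Ac = subgroup.mem_carrier [OF A]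
  define y0 where "y0 x = (if x \<in> X then y x else \<one>)" for x
  have y0A: "range y0 \<subseteq> A" using presentsD(2) [OF pr] subgroup.one_closed [OF A] by (auto simp: y0_def)
  then have y0c: "range y0 \<subseteq> carrier G" using Ac by blast
  have y0: "ev G y0 w = ev G y w" if "w \<in> words_on X" for w
    using that by (intro ev_cong [of X]) (auto simp: y0_def)
  define p where "p x = \<pi> (y0 x)" for x
  have pS: "range p \<subseteq> S" using y0A by (auto simp: p_def S_def)
  then have pc: "range p \<subseteq> carrier Q" using Sc by blast
  have evp: "ev Q p w = \<pi> (ev G y0 w)" for w
  proof -
    have "p = \<pi> \<circ> y0" by (auto simp: p_def)
    then show ?thesis using \<pi>.ev [OF y0A words_on_simps(4), of w] by simp
  qed
  have "\<forall>a\<in>S. \<exists>w\<in>words_on X. \<pi> (ev G y0 w) = a" using presentsD(6) [OF pr] y0 unfolding S_def by force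
  then obtain wa' where wa': "\<And>a. a \<in> S \<Longrightarrow> wa' a \<in> words_on X \<and> \<pi> (ev G y0 (wa' a)) = a" by metis
  \<comment> \<open>The empty word at the base vertex gives \<open>s\<close> the value
    \<open>\<one>\<close> there, so that loops at the base are evaluated without a
    correction.\<close>
  define wa where "wa a = (if a = \<one>\<^bsub>Q\<^esub> then [] else wa' a)" for a
  define s where "s a = ev G y0 (wa a)" for a
  have wa: "wa a \<in> words_on X" "\<pi> (s a) = a" if "a \<in> S" for a
    using wa' [OF that] by (auto simp: wa_def s_def)
  have s1: "s \<one>\<^bsub>Q\<^esub> = \<one>" by (simp add: s_def wa_def)
  have sA: "s a \<in> A" for a unfolding s_def by (rule ev_closed [OF A y0A]) simp
  then have sc: "s a \<in> carrier G" for a using Ac by blast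
  have evwa: "ev Q p (wa a) = a" if "a \<in> S" for a using wa(2) [OF that] by (simp add: evp s_def)
  have oneS: "\<one>\<^bsub>Q\<^esub> \<in> S" by (rule subgroup.one_closed [OF S])
  define Y where "Y = (\<lambda>(x, a). s a \<otimes> y0 x \<otimes> inv (s (a \<otimes>\<^bsub>Q\<^esub> p x)))"
  define X' where "X' = X \<times> S"
  define R' where "R' = (\<lambda>(r, a). lift Q p r a) ` (R \<times> S) \<union> (\<lambda>a. lift Q p (wa a) \<one>\<^bsub>Q\<^esub>) ` S"
  have evY: "ev G Y (lift Q p w a) = s a \<otimes> ev G y0 w \<otimes> inv (s (a \<otimes>\<^bsub>Q\<^esub> ev Q p w))" if "a \<in> S" for w a
    unfolding Y_def by (rule ev_lift [OF Q S pS y0c sc that])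
  have Rp: "ev G y0 r = \<one>" "ev Q p r = \<one>\<^bsub>Q\<^esub>" if "r \<in> R" for r
    using presentsD(3,4) [OF pr] that y0 evp by auto
  have Yk: "Y (x, a) \<in> kern A Q \<pi>" if "a \<in> S" for x a
  proof -
    have yA: "y0 x \<in> A" and px: "p x \<in> S" using y0A pS by auto
    have ap: "a \<otimes>\<^bsub>Q\<^esub> p x \<in> S" using that px S by (simp add: subgroup.m_closed)
    have syA: "s a \<otimes> y0 x \<in> A" "inv (s (a \<otimes>\<^bsub>Q\<^esub> p x)) \<in> A" using sA yA A
      by (auto simp: subgroup.m_closed subgroup.m_inv_closed)
    have "\<pi> (Y (x, a)) = \<pi> (s a) \<otimes>\<^bsub>Q\<^esub> \<pi> (y0 x) \<otimes>\<^bsub>Q\<^esub> inv\<^bsub>Q\<^esub> (\<pi> (s (a \<otimes>\<^bsub>Q\<^esub> p x)))"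
      unfolding Y_def using \<pi>.mult [OF syA] \<pi>.mult [OF sA yA, of a] \<pi>.inv [OF sA] by simp
    also have "\<dots> = (a \<otimes>\<^bsub>Q\<^esub> p x) \<otimes>\<^bsub>Q\<^esub> inv\<^bsub>Q\<^esub> (a \<otimes>\<^bsub>Q\<^esub> p x)"
      using wa(2) [OF that] wa(2) [OF ap] by (simp add: p_def)
    also have "\<dots> = \<one>\<^bsub>Q\<^esub>" using Sc [OF ap] by simp
    finally show ?thesis unfolding kern_def Y_def using syA A by (simp add: subgroup.m_closed)
  qed
  have gen: "generates G (kern A Q \<pi>) Y X'"
  proof -
    have "\<exists>W\<in>words_on X'. ev G Y W = h" if h: "h \<in> kern A Q \<pi>" for h
    proof -
      have hA: "h \<in> A" "\<pi> h = \<one>\<^bsub>Q\<^esub>" using h by (auto simp: kern_def)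
      obtain w where w: "w \<in> words_on X" "ev G y w = h" using presentsD(6) [OF pr hA(1)] by auto
      have "ev Q p w = \<one>\<^bsub>Q\<^esub>" using evp y0 [OF w(1)] w(2) hA(2) by simp
      then have "ev G Y (lift Q p w \<one>\<^bsub>Q\<^esub>) = h"
        using evY [OF oneS, of w] s1 y0 [OF w(1)] w(2) Ac [OF hA(1)] by simp
      moreover have "lift Q p w \<one>\<^bsub>Q\<^esub> \<in> words_on X'"
        unfolding X'_def by (rule Q.lift_words_on [OF S pS oneS w(1)])
      ultimately show ?thesis by blast
    qed
    moreover have "Y ` X' \<subseteq> kern A Q \<pi>" using Yk by (auto simp: X'_def)
    ultimately show ?thesis by (simp add: generates_def)
  qed
  have R'w: "R' \<subseteq> words_on X'"
  proof
    fix r assume "r \<in> R'"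
    then consider r0 a where "r0 \<in> R" "a \<in> S" "r = lift Q p r0 a" | a where "a \<in> S" "r = lift Q p (wa a) \<one>\<^bsub>Q\<^esub>"
      unfolding R'_def by auto
    then show "r \<in> words_on X'"
    proof cases
      case 1
      have "r0 \<in> words_on X" using presentsD(3) [OF pr] 1 by auto
      then show ?thesis unfolding 1(3) X'_def by (rule Q.lift_words_on [OF S pS 1(2)])
    next
      case 2
      show ?thesis unfolding 2(2) X'_def by (rule Q.lift_words_on [OF S pS oneS wa(1) [OF 2(1)]])
    qed
  qed
  have ev1: "ev G Y r = \<one>" if r: "r \<in> R'" for r
  proof -
    consider r0 a where "r0 \<in> R" "a \<in> S" "r = lift Q p r0 a" | a where "a \<in> S" "r = lift Q p (wa a) \<one>\<^bsub>Q\<^esub>"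
      using r unfolding R'_def by auto
    then show ?thesis
    proof cases
      case 1
      show ?thesis unfolding 1(3) evY [OF 1(2)] using Rp [OF 1(1)] sc Sc [OF 1(2)] by simp
    next
      case 2
      show ?thesis unfolding 2(2) evY [OF oneS] evwa [OF 2(1)]
        using s1 sc Sc [OF 2(1)] by (simp flip: s_def)
    qed
  qed
  \<comment> \<open>The loop at the base vertex that runs to \<open>a\<close>, along the edge, and
    back. Its lift is the edge itself up to the relators for the chosen paths, and its value is that
    of the generator \<open>Y\<close>.\<close>
  define g where "g = (\<lambda>(x, a). wa a @ [(False, x)] @ inv_word (wa (a \<otimes>\<^bsub>Q\<^esub> p x)))"
  have evg: "ev G y0 (g z) = Y z" if "z \<in> X'" for z
  proof -
    obtain x a where z: "z = (x, a)" by force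
    have "y0 x \<in> carrier G" using y0c by auto
    then show ?thesis unfolding z g_def Y_def s_def
      using sc by (simp add: ev_append [OF y0c words_on_simps(4) words_on_simps(4)] ev_inv_word [OF y0c words_on_simps(4)] m_assoc s_def
        del: append_Cons append_Nil)
  qed
  have tree: "pres_eq R' (lift Q p (wa a) \<one>\<^bsub>Q\<^esub>) []" if "a \<in> S" for a
    using that by (intro pres_eq_relator) (auto simp: R'_def)
  have lift_g: "pres_eq R' (lift Q p (g z) \<one>\<^bsub>Q\<^esub>) [(False, z)]" "ev Q p (g z) = \<one>\<^bsub>Q\<^esub>" if z': "z \<in> X'" for z
  proof -
    obtain x a where z: "z = (x, a)" "a \<in> S" using z' by (auto simp: X'_def)
    have px: "p x \<in> carrier Q" "p x \<in> S" using pS pc by auto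
    define b where "b = a \<otimes>\<^bsub>Q\<^esub> p x"
    have b: "b \<in> S" using z(2) px(2) S by (simp add: b_def subgroup.m_closed)
    have ac: "a \<in> carrier Q" "b \<in> carrier Q" using z b Sc by auto
    have 1: "lift Q p (inv_word (wa b)) b = inv_word (lift Q p (wa b) \<one>\<^bsub>Q\<^esub>)"
      using Q.lift_inv_word [OF pc Q.one_closed, of "wa b"] evwa [OF b] ac by simp
    have "lift Q p (g z) \<one>\<^bsub>Q\<^esub> = lift Q p (wa a) \<one>\<^bsub>Q\<^esub> @ lift Q p ([(False, x)] @ inv_word (wa b)) a"
      using Q.lift_append [OF pc Q.one_closed, of "wa a" "[(False, x)] @ inv_word (wa b)"] evwa [OF z(2)] ac
      by (simp add: z(1) g_def b_def)
    also have "lift Q p ([(False, x)] @ inv_word (wa b)) a = [(False, z)] @ inv_word (lift Q p (wa b) \<one>\<^bsub>Q\<^esub>)"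
      using 1 by (simp add: z(1) b_def)
    finally have e: "lift Q p (g z) \<one>\<^bsub>Q\<^esub> = lift Q p (wa a) \<one>\<^bsub>Q\<^esub> @ [(False, z)] @ inv_word (lift Q p (wa b) \<one>\<^bsub>Q\<^esub>)" .
    have "pres_eq R' (inv_word (lift Q p (wa b) \<one>\<^bsub>Q\<^esub>)) []" using pres_eq_inv_word [OF tree [OF b]] by simp
    then have "pres_eq R' (lift Q p (g z) \<one>\<^bsub>Q\<^esub>) ([] @ [(False, z)] @ [])"
      unfolding e by (intro pres_eq_append tree [OF z(2)] pres_refl)
    then show "pres_eq R' (lift Q p (g z) \<one>\<^bsub>Q\<^esub>) [(False, z)]" by simp
    have "ev Q p (g z) = a \<otimes>\<^bsub>Q\<^esub> (p x \<otimes>\<^bsub>Q\<^esub> inv\<^bsub>Q\<^esub> b)"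
      unfolding z(1) g_def using evwa [OF z(2)] evwa [OF b] px
      by (simp add: Q.ev_append [OF pc words_on_simps(4) words_on_simps(4)] Q.ev_inv_word [OF pc words_on_simps(4)] b_def del: append_Cons append_Nil)
    also have "\<dots> = a \<otimes>\<^bsub>Q\<^esub> p x \<otimes>\<^bsub>Q\<^esub> inv\<^bsub>Q\<^esub> b"
      by (rule Q.m_assoc [symmetric]) (use ac px in auto)
    also have "\<dots> = b \<otimes>\<^bsub>Q\<^esub> inv\<^bsub>Q\<^esub> b" by (simp only: b_def)
    also have "\<dots> = \<one>\<^bsub>Q\<^esub>" using ac by simp
    finally show "ev Q p (g z) = \<one>\<^bsub>Q\<^esub>" .
  qed
  have lift_subst: "pres_eq R' (lift Q p (subst g W) \<one>\<^bsub>Q\<^esub>) W" if "W \<in> words_on X'" for W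
    using that
  proof (induction W)
    case (Cons l W)
    then have l: "snd l \<in> X'" and W: "W \<in> words_on X'" by auto
    define h where "h = (if fst l then inv_word (g (snd l)) else g (snd l))"
    have h1: "ev Q p h = \<one>\<^bsub>Q\<^esub>"
      using lift_g(2) [OF l] Q.ev_inv_word [OF pc words_on_simps(4), of "g (snd l)"] by (simp add: h_def)
    have h2: "pres_eq R' (lift Q p h \<one>\<^bsub>Q\<^esub>) [l]"
    proof (cases "fst l")
      case True
      have "lift Q p (inv_word (g (snd l))) \<one>\<^bsub>Q\<^esub> = inv_word (lift Q p (g (snd l)) \<one>\<^bsub>Q\<^esub>)"
        using Q.lift_inv_word [OF pc Q.one_closed, of "g (snd l)"] lift_g(2) [OF l] by simp
      moreover have "inv_word [(False, snd l)] = [l]" using True by (cases l) (simp add: inv_letter_def)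
      ultimately show ?thesis using pres_eq_inv_word [OF lift_g(1) [OF l]] True by (simp add: h_def)
    next
      case False
      then have "[(False, snd l)] = [l]" by (cases l) simp
      then show ?thesis using lift_g(1) [OF l] False by (simp add: h_def)
    qed
    have "lift Q p (subst g (l # W)) \<one>\<^bsub>Q\<^esub> = lift Q p h \<one>\<^bsub>Q\<^esub> @ lift Q p (subst g W) \<one>\<^bsub>Q\<^esub>"
      using Q.lift_append [OF pc Q.one_closed, of h "subst g W"] h1 by (simp add: h_def)
    then show ?case using pres_eq_append [OF h2 Cons.IH [OF W]] by simp
  qed (simp add: pres_refl)
  \<comment> \<open>Translate \<open>W\<close> into a word over \<open>X\<close>, derive that word
    from \<open>R\<close> in \<open>A\<close>, and lift the derivation; \<open>lift_subst\<close>
    identifies the lift with \<open>W\<close>.\<close>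
  have "pres_eq R' W []" if W: "W \<in> words_on X'" "ev G Y W = \<one>" for W
  proof -
    have sw: "subst g W \<in> words_on X"
      using W(1)
    proof (induction W)
      case (Cons l W)
      obtain x a where xa: "snd l = (x, a)" "x \<in> X" "a \<in> S" using Cons.prems by (auto simp: X'_def)
      have "p x \<in> S" using pS by auto
      then have "a \<otimes>\<^bsub>Q\<^esub> p x \<in> S" by (rule subgroup.m_closed [OF S xa(3)])
      then have "g (snd l) \<in> words_on X" using wa(1) xa by (simp add: g_def)
      then show ?case using Cons by simp
    qed simp
    have "ev G y0 (subst g W) = ev G (\<lambda>z. ev G y0 (g z)) W" by (rule ev_subst [OF y0c])
    also have "\<dots> = ev G Y W" using evg W(1) by (rule ev_cong)
    finally have "ev G y (subst g W) = \<one>" using W(2) y0 [OF sw] by simp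
    then have "pres_eq R (subst g W) []" by (rule presentsD(5) [OF pr sw])
    then have "pres_eq R' (lift Q p (subst g W) \<one>\<^bsub>Q\<^esub>) (lift Q p [] \<one>\<^bsub>Q\<^esub>)"
      using Rp(2) by (intro Q.lift_pres_eq [OF S pS _ _ _ oneS]) (auto simp: R'_def)
    then show ?thesis using lift_subst [OF W(1)] pres_sym pres_trans by (metis lift.simps(1))
  qed
  then have "presents G (kern A Q \<pi>) Y X' R'" using gen R'w ev1 by (auto simp: presents_def)
  moreover have fS: "finite S" using fin by (simp add: S_def)
  moreover have "card R' \<le> card R * card S + card S"
  proof -
    have "card R' \<le> card ((\<lambda>(r, a). lift Q p r a) ` (R \<times> S)) + card ((\<lambda>a. lift Q p (wa a) \<one>\<^bsub>Q\<^esub>) ` S)"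
      unfolding R'_def by (rule card_Un_le)
    also have "\<dots> \<le> card (R \<times> S) + card S"
      using X fS by (intro add_mono card_image_le) auto
    finally show ?thesis by (simp add: card_cartesian_product)
  qed
  moreover have "card X' = card X * card S" by (simp add: X'_def card_cartesian_product)
  moreover have "finite R'" "finite X'" using X fS by (auto simp: R'_def X'_def)
  ultimately show ?thesis
    by (intro cost_leI [of X' R']) (simp_all add: algebra_simps flip: S_def)
qed

theorem cost_le_kern:
  assumes "subgroup A G" "group Q" "\<pi> \<in> homs G A Q" "finite (\<pi> ` A)" "cost_le G A c"
  shows "cost_le G (kern A Q \<pi>) (card (\<pi> ` A) * (c + 1))"
proof -
  obtain X :: "nat set" and R y where X: "finite X" "finite R" "card X + card R \<le> c" and pr: "presents G A y X R"
    using assms(5) by (auto simp: cost_le_def)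
  show ?thesis
    by (rule cost_le_mono [OF presents_kern [OF assms(1-4) X(1,2) pr]]) (use X(3) in simp)
qed

end

subsection \<open>Injectivity and images\<close>

context group
begin

lemma asc_image:
  assumes a: "asc G A B t" and E: "group E" and h: "h \<in> homs G A E" "inj_on h A"
  shows "asc E (h ` A) (h ` B) (h t)"
proof -
  interpret E: group E by fact
  interpret h: homs_on G E A h by (rule homs_onI [OF E ascD(1) [OF a] h(1)])
  note A = ascD(1) [OF a] and B = ascD(2) [OF a] and BA = subsetD [OF ascD(3) [OF a]] and tA = ascD(4) [OF a]
  have tp: "t [^] (k::nat) \<in> A" "inv (t [^] k) \<in> A" for k
    using pow_mem [OF A tA] subgroup.m_inv_closed [OF A] by auto
  have "inv\<^bsub>E\<^esub> (h t) \<otimes>\<^bsub>E\<^esub> h b \<otimes>\<^bsub>E\<^esub> h t \<in> h ` B" if b: "b \<in> B" for b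
  proof -
    have it: "inv t \<in> A" using tA A by (simp add: subgroup.m_inv_closed)
    then have "inv t \<otimes> b \<in> A" using BA [OF b] A by (simp add: subgroup.m_closed)
    then have "h (inv t \<otimes> b \<otimes> t) = inv\<^bsub>E\<^esub> (h t) \<otimes>\<^bsub>E\<^esub> h b \<otimes>\<^bsub>E\<^esub> h t"
      using h.mult [of "inv t \<otimes> b" t] h.mult [OF it BA [OF b]] h.inv [OF tA] tA by simp
    then show ?thesis using ascD(5) [OF a b] by (metis imageI)
  qed
  moreover have "\<exists>(i::nat) (j::nat). \<exists>b\<in>h ` B. u = h t [^]\<^bsub>E\<^esub> i \<otimes>\<^bsub>E\<^esub> b \<otimes>\<^bsub>E\<^esub> inv\<^bsub>E\<^esub> (h t [^]\<^bsub>E\<^esub> j)"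
    if u: "u \<in> h ` A" for u
  proof -
    obtain g where g: "g \<in> A" "u = h g" using u by auto
    obtain i j b where b: "b \<in> B" "g = t [^] (i::nat) \<otimes> b \<otimes> inv (t [^] (j::nat))" using ascE [OF a g(1)] by metis
    have "u = h t [^]\<^bsub>E\<^esub> i \<otimes>\<^bsub>E\<^esub> h b \<otimes>\<^bsub>E\<^esub> inv\<^bsub>E\<^esub> (h t [^]\<^bsub>E\<^esub> j)"
      unfolding g(2) b(2) by (rule homs_rep [OF h.homs_on_axioms tA BA [OF b(1)]])
    then show ?thesis using b(1) by blast
  qed
  moreover have "h t [^]\<^bsub>E\<^esub> k \<notin> h ` B" if k: "k > 0" for k :: nat
  proof
    assume "h t [^]\<^bsub>E\<^esub> k \<in> h ` B"
    then obtain b where b: "b \<in> B" "h (t [^] k) = h b" using h.pow [OF tA, of k] by auto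
    then have "t [^] k = b" using h(2) tp BA by (meson inj_onD)
    then show False using ascD(6) [OF a k] b(1) by simp
  qed
  ultimately show ?thesis
    unfolding asc_def using subgroup_homs_image [OF A E h(1)] subgroup_homs_image [OF B E homs_mono [OF h(1) ascD(3) [OF a]]]
      ascD(3,4) [OF a] by (intro conjI allI ballI impI) auto
qed

text \<open>An element of the kernel of \<open>h\<close>, in normal form, has equal exponents, as
  otherwise a positive power of \<open>h t\<close> would lie in the image of \<open>B\<close>. What
  remains is an element of \<open>B\<close>, where \<open>h\<close> is injective.\<close>

lemma asc_inj:
  assumes a: "asc G A B t" and E: "group E" and h: "h \<in> homs G A E" "inj_on h B"
    and k: "\<And>k::nat. k > 0 \<Longrightarrow> h t [^]\<^bsub>E\<^esub> k \<notin> h ` B"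
  shows "inj_on h A"
proof -
  interpret E: group E by fact
  interpret h: homs_on G E A h by (rule homs_onI [OF E ascD(1) [OF a] h(1)])
  note A = ascD(1) [OF a] and B = ascD(2) [OF a] and BA = subsetD [OF ascD(3) [OF a]] and tA = ascD(4) [OF a]
  note c [simp] = asc_carrier [OF a]
  define s where "s = h t"
  have s [simp]: "s \<in> carrier E" using tA by (simp add: s_def)
  have ker: "g = \<one>" if g: "g \<in> A" "h g = \<one>\<^bsub>E\<^esub>" for g
  proof -
    obtain i j b where b: "b \<in> B" "g = t [^] (i::nat) \<otimes> b \<otimes> inv (t [^] (j::nat))" using ascE [OF a g(1)] by metis
    have hb: "h b \<in> carrier E" using BA [OF b(1)] by simp
    have e: "s [^]\<^bsub>E\<^esub> i \<otimes>\<^bsub>E\<^esub> h b \<otimes>\<^bsub>E\<^esub> inv\<^bsub>E\<^esub> (s [^]\<^bsub>E\<^esub> j) = \<one>\<^bsub>E\<^esub>"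
      using homs_rep [OF h.homs_on_axioms tA BA [OF b(1)], of i j] g(2) b(2) by (simp add: s_def)
    have e2: "s [^]\<^bsub>E\<^esub> i \<otimes>\<^bsub>E\<^esub> h b = s [^]\<^bsub>E\<^esub> j"
    proof -
      have "s [^]\<^bsub>E\<^esub> i \<otimes>\<^bsub>E\<^esub> h b = s [^]\<^bsub>E\<^esub> i \<otimes>\<^bsub>E\<^esub> h b \<otimes>\<^bsub>E\<^esub> inv\<^bsub>E\<^esub> (s [^]\<^bsub>E\<^esub> j) \<otimes>\<^bsub>E\<^esub> s [^]\<^bsub>E\<^esub> j"
        using hb by (simp add: E.m_assoc)
      then show ?thesis unfolding e using hb by simp
    qed
    have "\<not> i < j"
    proof
      assume l: "i < j"
      then have "s [^]\<^bsub>E\<^esub> i \<otimes>\<^bsub>E\<^esub> s [^]\<^bsub>E\<^esub> (j - i) = s [^]\<^bsub>E\<^esub> j" by (simp add: E.nat_pow_mult)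
      then have "s [^]\<^bsub>E\<^esub> i \<otimes>\<^bsub>E\<^esub> s [^]\<^bsub>E\<^esub> (j - i) = s [^]\<^bsub>E\<^esub> i \<otimes>\<^bsub>E\<^esub> h b" using e2 by simp
      then have "s [^]\<^bsub>E\<^esub> (j - i) = h b" using hb by simp
      then show False using k [of "j - i"] l b(1) by (simp add: s_def)
    qed
    moreover have "\<not> j < i"
    proof
      assume l: "j < i"
      then have "s [^]\<^bsub>E\<^esub> j \<otimes>\<^bsub>E\<^esub> s [^]\<^bsub>E\<^esub> (i - j) = s [^]\<^bsub>E\<^esub> i" by (simp add: E.nat_pow_mult)
      then have "s [^]\<^bsub>E\<^esub> j \<otimes>\<^bsub>E\<^esub> (s [^]\<^bsub>E\<^esub> (i - j) \<otimes>\<^bsub>E\<^esub> h b) = s [^]\<^bsub>E\<^esub> j"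
        using e2 hb by (simp flip: E.m_assoc)
      then have "s [^]\<^bsub>E\<^esub> (i - j) \<otimes>\<^bsub>E\<^esub> h b = \<one>\<^bsub>E\<^esub>" using hb by simp
      then have "s [^]\<^bsub>E\<^esub> (i - j) = h (inv b)" using hb h.inv [OF BA [OF b(1)]] by (simp add: E.inv_equality)
      then show False using k [of "i - j"] l subgroup.m_inv_closed [OF B b(1)] by (simp add: s_def)
    qed
    ultimately have ij: "i = j" by simp
    then have "s [^]\<^bsub>E\<^esub> i \<otimes>\<^bsub>E\<^esub> h b = s [^]\<^bsub>E\<^esub> i" using e2 by simp
    then have "h b = h \<one>" using hb by simp
    then have "b = \<one>" using h(2) b(1) subgroup.one_closed [OF B] by (meson inj_onD)
    then show ?thesis using b(2) ij by simp
  qed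
  show ?thesis
  proof (rule inj_onI)
    fix u v assume uv: "u \<in> A" "v \<in> A" "h u = h v"
    have iv: "inv v \<in> A" using uv A by (simp add: subgroup.m_inv_closed)
    then have "u \<otimes> inv v \<in> A" using uv(1) A by (simp add: subgroup.m_closed)
    moreover have "h (u \<otimes> inv v) = \<one>\<^bsub>E\<^esub>" using h.mult [OF uv(1) iv] h.inv [OF uv(2)] uv by simp
    ultimately have "u \<otimes> inv v = \<one>" by (rule ker)
    then have "u \<otimes> inv v \<otimes> v = v" using c(3) [OF uv(2)] by simp
    then show "u = v" using c(3) [OF uv(1)] c(3) [OF uv(2)] by (simp add: m_assoc)
  qed
qed

text \<open>By \<open>rep_mult\<close> the elements with a normal form are a subgroup. It contains
  \<open>B\<close> and \<open>t\<close>, hence is everything by \<open>gen\<close>.\<close>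

lemma ascI:
  assumes B: "subgroup B G" and t: "t \<in> carrier G" and conj: "\<And>b. b \<in> B \<Longrightarrow> inv t \<otimes> b \<otimes> t \<in> B"
    and gen: "\<And>H. subgroup H G \<Longrightarrow> B \<subseteq> H \<Longrightarrow> t \<in> H \<Longrightarrow> carrier G \<subseteq> H"
    and k: "\<And>k::nat. k > 0 \<Longrightarrow> t [^] k \<notin> B"
  shows "asc G (carrier G) B t"
proof -
  define H where "H = {t [^] i \<otimes> b \<otimes> inv (t [^] j) | (i::nat) (j::nat) b. b \<in> B}"
  note Bc = subgroup.mem_carrier [OF B]
  have HI: "t [^] i \<otimes> b \<otimes> inv (t [^] j) \<in> H" if "b \<in> B" for i j :: nat and b using that by (auto simp: H_def)
  have HE: "\<exists>(i::nat) (j::nat). \<exists>b\<in>B. g = t [^] i \<otimes> b \<otimes> inv (t [^] j)" if "g \<in> H" for g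
    using that unfolding H_def by blast
  have "subgroup H G"
  proof (rule subgroupI)
    show "H \<subseteq> carrier G" using t Bc by (auto simp: H_def)
    show "H \<noteq> {}" using subgroup.one_closed [OF B] by (auto simp: H_def)
    fix g assume "g \<in> H"
    then obtain i j b where b: "b \<in> B" "g = t [^] (i::nat) \<otimes> b \<otimes> inv (t [^] (j::nat))" using HE by blast
    have "inv g = t [^] j \<otimes> inv b \<otimes> inv (t [^] i)" unfolding b(2) using t Bc [OF b(1)] by (simp add: group_word)
    then show "inv g \<in> H" using HI subgroup.m_inv_closed [OF B b(1)] by simp
    fix g' assume "g' \<in> H"
    then obtain i' j' b' where b': "b' \<in> B" "g' = t [^] (i'::nat) \<otimes> b' \<otimes> inv (t [^] (j'::nat))" using HE by blast
    have "(inv (t [^] i') \<otimes> b \<otimes> t [^] i') \<otimes> (inv (t [^] j) \<otimes> b' \<otimes> t [^] j) \<in> B"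
      by (intro subgroup.m_closed [OF B] conj_pow_mem [OF B t conj] b(1) b'(1))
    then show "g \<otimes> g' \<in> H"
      unfolding b(2) b'(2) rep_mult [OF t Bc [OF b(1)] Bc [OF b'(1)]] by (rule HI)
  qed
  moreover have "B \<subseteq> H"
  proof
    fix b assume b: "b \<in> B"
    then show "b \<in> H" using HI [OF b, of 0 0] Bc [OF b] by simp
  qed
  moreover have "t \<in> H" using HI [OF subgroup.one_closed [OF B], of 1 0] t by simp
  ultimately have "carrier G \<subseteq> H" by (rule gen)
  then show ?thesis
    unfolding asc_def using subgroup_self B t conj k HE subgroup.subset [OF B]
    by (intro conjI allI ballI impI) auto
qed

section \<open>Kernels of composite homomorphisms\<close>

lemma homs_comp:
  assumes "f \<in> homs G A E" "f ` A \<subseteq> B" "h \<in> homs E B E'"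
  shows "h \<circ> f \<in> homs G A E'"
proof -
  have "h (f a) \<in> carrier E'" if "a \<in> A" for a using assms(2,3) that by (auto simp: homs_def)
  moreover have "h (f (a \<otimes> b)) = h (f a) \<otimes>\<^bsub>E'\<^esub> h (f b)" if "a \<in> A" "b \<in> A" for a b
  proof -
    have "f (a \<otimes> b) = f a \<otimes>\<^bsub>E\<^esub> f b" using assms(1) that by (simp add: homs_def)
    moreover have "f a \<in> B" "f b \<in> B" using assms(2) that by auto
    ultimately show ?thesis using assms(3) by (simp add: homs_def)
  qed
  ultimately show ?thesis by (auto simp: homs_def)
qed

lemma kern_image:
  "kern (h ` A) Q \<pi> = h ` kern A Q (\<pi> \<circ> h)"
  by (auto simp: kern_def)

lemma cost_le_kern_image:
  assumes "subgroup A G" "group E" "h \<in> homs G A E" "inj_on h A" "group Q" "\<pi> \<in> homs E (h ` A) Q"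
    and "cost_le G (kern A Q (\<pi> \<circ> h)) c"
  shows "cost_le E (kern (h ` A) Q \<pi>) c"
proof -
  have k: "kern A Q (\<pi> \<circ> h) \<subseteq> A" by (auto simp: kern_def)
  have "subgroup (kern A Q (\<pi> \<circ> h)) G"
    by (rule subgroup_kern [OF assms(1,5) homs_comp [OF assms(3) subset_refl assms(6)]])
  then show ?thesis unfolding kern_image
    by (rule cost_le_image [OF _ assms(2) homs_mono [OF assms(3) k] inj_on_subset [OF assms(4) k] assms(7)])
qed

lemma rank_le_kern_image:
  assumes "subgroup A G" "group E" "h \<in> homs G A E" "group Q" "\<pi> \<in> homs E (h ` A) Q"
    and "rank_le G (kern A Q (\<pi> \<circ> h)) c"
  shows "rank_le E (kern (h ` A) Q \<pi>) c"
proof -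
  have k: "kern A Q (\<pi> \<circ> h) \<subseteq> A" by (auto simp: kern_def)
  have "subgroup (kern A Q (\<pi> \<circ> h)) G"
    by (rule subgroup_kern [OF assms(1,4) homs_comp [OF assms(3) subset_refl assms(5)]])
  then show ?thesis unfolding kern_image
    by (rule rank_le_image [OF _ assms(2) homs_mono [OF assms(3) k] assms(6)])
qed

subsection \<open>Finitely many of the Thompson relations suffice\<close>

text \<open>\<open>a1\<close>, \<open>b1\<close> and \<open>a1'\<close> are the conjugates of
  \<open>a\<close>, \<open>b\<close> and \<open>a'\<close> by \<open>z\<close>, so they inherit the
  relation.\<close>

lemma conj_rel:
  assumes c: "a \<in> carrier G" "b \<in> carrier G" "a' \<in> carrier G" "a1 \<in> carrier G" "b1 \<in> carrier G" "a1' \<in> carrier G" "z \<in> carrier G"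
    and "a \<otimes> b = b \<otimes> a'" "a \<otimes> z = z \<otimes> a1" "b \<otimes> z = z \<otimes> b1" "a' \<otimes> z = z \<otimes> a1'"
  shows "a1 \<otimes> b1 = b1 \<otimes> a1'"
proof -
  have "z \<otimes> (a1 \<otimes> b1) = a \<otimes> (z \<otimes> b1)" using assms(9) c by (simp flip: m_assoc)
  also have "\<dots> = (a \<otimes> b) \<otimes> z" using assms(10) c by (simp add: m_assoc)
  also have "\<dots> = b \<otimes> (z \<otimes> a1')" using assms(8,11) c by (simp add: m_assoc)
  also have "\<dots> = z \<otimes> (b1 \<otimes> a1')" using assms(10) c by (simp flip: m_assoc)
  finally show ?thesis using c by simp
qed

end

text \<open>Continues finitely many generators to all indices by the relations for
  \<open>x 0\<close>. The bound \<open>3 * n\<close> is the largest index in a relation with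
  \<open>i \<le> 2 * n + 1\<close>; the test \<open>n < 2\<close> ensures termination.\<close>

function fext :: "('e, 'm) monoid_scheme \<Rightarrow> nat \<Rightarrow> (nat \<Rightarrow> 'e) \<Rightarrow> nat \<Rightarrow> 'e" where
  "fext E n e i = (if i \<le> 3 * n \<or> n < 2 then e i else inv\<^bsub>E\<^esub> (e 0) \<otimes>\<^bsub>E\<^esub> fext E n e (i - (n - 1)) \<otimes>\<^bsub>E\<^esub> e 0)"
  by pat_completeness auto
termination by (relation "Wellfounded.measure (\<lambda>(E, n, e, i). i)") auto

declare fext.simps [simp del]

context group
begin

lemma fext_closed:
  assumes "range e \<subseteq> carrier G"
  shows "fext G n e i \<in> carrier G"
proof (induction i rule: less_induct)
  case (less i)
  have e: "e j \<in> carrier G" for j using assms by auto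
  show ?case
  proof (cases "i \<le> 3 * n \<or> n < 2")
    case True
    then show ?thesis using e by (simp add: fext.simps)
  next
    case False
    then have "i - (n - 1) < i" by auto
    then show ?thesis using less [of "i - (n - 1)"] e False by (subst fext.simps) auto
  qed
qed

text \<open>Strong induction on \<open>i\<close>. The relations with \<open>j = 0\<close> hold by
  construction. For \<open>j > n - 1\<close> both indices can be lowered by \<open>n - 1\<close>,
  and conjugation by the element of index 0 raises them again. The few remaining \<open>j\<close>
  follow from relations with smaller \<open>i\<close>.\<close>

theorem fext_rel:
  assumes n: "2 \<le> n" and e: "range e \<subseteq> carrier G"
    and rel: "\<And>i j. j < i \<Longrightarrow> i \<le> 2 * n + 1 \<Longrightarrow> e i \<otimes> e j = e j \<otimes> e (i + (n - 1))"
  shows "j < i \<Longrightarrow> fext G n e i \<otimes> fext G n e j = fext G n e j \<otimes> fext G n e (i + (n - 1))"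
proof -
  define f where "f = fext G n e"
  have fc [simp]: "f i \<in> carrier G" for i unfolding f_def by (rule fext_closed [OF e])
  have fe: "f i = e i" if "i \<le> 3 * n" for i using that by (simp add: f_def fext.simps)
  have ec [simp]: "e i \<in> carrier G" for i using e by auto
  have base: "f i \<otimes> f j = f j \<otimes> f (i + (n - 1))" if "j < i" "i \<le> 2 * n + 1" for i j
    using rel [OF that] fe [of i] fe [of j] fe [of "i + (n - 1)"] that n by simp
  have zero: "f i \<otimes> f 0 = f 0 \<otimes> f (i + (n - 1))" if "0 < i" for i
  proof (cases "i \<le> 2 * n + 1")
    case True
    then show ?thesis using base that by simp
  next
    case False
    then have "f (i + (n - 1)) = inv (e 0) \<otimes> f i \<otimes> e 0"
      unfolding f_def by (subst fext.simps) (use n in auto)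
    then show ?thesis using fe [of 0] by (simp add: m_assoc)
  qed
  have shift: "f (a + (n - 1)) \<otimes> f (b + (n - 1)) = f (b + (n - 1)) \<otimes> f (a + (n - 1) + (n - 1))"
    if "0 < b" "b < a" "f a \<otimes> f b = f b \<otimes> f (a + (n - 1))" for a b
    by (rule conj_rel [of "f a" "f b" "f (a + (n - 1))" _ _ _ "f 0"]) (use zero that n in auto)
  have "\<forall>j<i. f i \<otimes> f j = f j \<otimes> f (i + (n - 1))" for i
  proof (induction i rule: less_induct)
    case (less i)
    show ?case
    proof (intro allI impI)
      fix j assume j: "j < i"
      show "f i \<otimes> f j = f j \<otimes> f (i + (n - 1))"
      proof (cases "i \<le> 2 * n + 1")
        case True
        then show ?thesis using base j by simp
      next
        case False
        have i': "i - (n - 1) + (n - 1) = i" "i - (n - 1) < i" using False n by auto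
        consider "j = 0" | "1 \<le> j" "j \<le> n - 1" | "n - 1 < j" by linarith
        then show ?thesis
        proof cases
          case 1
          then show ?thesis using zero j by simp
        next
          case 2
          \<comment> \<open>The relation between \<open>u\<close> and \<open>k\<close> is conjugated
            by \<open>f j\<close> and by \<open>f 0\<close>. Both turn \<open>f u\<close> into
            \<open>f i\<close> and \<open>f k\<close> into \<open>f (k + (n - 1))\<close>, so the
            conjugates of \<open>f i\<close> agree: the one by \<open>f j\<close> is
            \<open>f (i + (n - 1))\<close>.\<close>
          define k u where "k = Suc j" and "u = i - (n - 1)"
          have k: "0 < k" "j < k" "k < u" "k < i" "u < i" "j < u" using 2 False n by (auto simp: k_def u_def)
          have ui: "u + (n - 1) = i" using i' by (simp add: u_def)
          have uk: "f u \<otimes> f k = f k \<otimes> f i" using less [OF k(5)] k(3) ui by metis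
          have uj: "f u \<otimes> f j = f j \<otimes> f i" using less [OF k(5)] k(6) ui by metis
          have kj: "f k \<otimes> f j = f j \<otimes> f (k + (n - 1))" using less [OF k(4)] k(2) by metis
          have ik: "f i \<otimes> f (k + (n - 1)) = f (k + (n - 1)) \<otimes> f (i + (n - 1))"
            using shift [OF k(1) k(3)] uk ui by simp
          have "f i \<otimes> f (k + (n - 1)) = f (k + (n - 1)) \<otimes> (inv (f j) \<otimes> f i \<otimes> f j)"
            by (rule conj_rel [of "f u" "f k" "f i" _ _ _ "f j"]) (use uk uj kj in \<open>simp_all add: m_assoc\<close>)
          then have "inv (f j) \<otimes> f i \<otimes> f j = f (i + (n - 1))" using ik by simp
          then have "f j \<otimes> (inv (f j) \<otimes> f i \<otimes> f j) = f j \<otimes> f (i + (n - 1))" by simp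
          then show ?thesis by (simp add: m_assoc)
        next
          case 3
          have "f (i - (n - 1)) \<otimes> f (j - (n - 1)) = f (j - (n - 1)) \<otimes> f (i - (n - 1) + (n - 1))"
            using less [OF i'(2)] 3 j by (metis diff_less_mono less_imp_le)
          then show ?thesis using shift [of "j - (n - 1)" "i - (n - 1)"] 3 j i' by simp
        qed
      qed
    qed
  qed
  then show "j < i \<Longrightarrow> fext G n e i \<otimes> fext G n e j = fext G n e j \<otimes> fext G n e (i + (n - 1))"
    by (simp add: f_def)
qed

end

section \<open>The group \<open>F_inf n\<close>\<close>

subsection \<open>A piecewise linear action on the real line\<close>

text \<open>Composition is reversed: the action is a right action, as in \<open>x\<^sup>y = y\<^sup>-\<^sup>1 x y\<close>.\<close>

definition bijs :: "(real \<Rightarrow> real) monoid" where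
  "bijs = \<lparr>carrier = {f. bij f}, mult = (\<lambda>f g. g \<circ> f), one = id\<rparr>"

text \<open>In the forest picture \<open>x i\<close> attaches an \<open>n\<close>-ary caret to leaf
  \<open>i\<close>: the unit interval at \<open>i\<close> is stretched to length \<open>n\<close>,
  and everything to its right moves by \<open>n - 1\<close>.\<close>

definition pl :: "nat \<Rightarrow> nat \<Rightarrow> real \<Rightarrow> real" where
  "pl n i t = (if t \<le> real i then t else if t \<le> real i + 1 then real i + real n * (t - real i) else t + real n - 1)"

definition pl_inv :: "nat \<Rightarrow> nat \<Rightarrow> real \<Rightarrow> real" where
  "pl_inv n i t = (if t \<le> real i then t else if t \<le> real i + real n then real i + (t - real i) / real n else t - real n + 1)"

lemma group_bijs: "group bijs"
proof (rule groupI)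
  fix f assume "f \<in> carrier bijs"
  then have f: "bij f" by (simp add: bijs_def)
  then show "\<exists>g\<in>carrier bijs. g \<otimes>\<^bsub>bijs\<^esub> f = \<one>\<^bsub>bijs\<^esub>"
    using bij_imp_bij_inv [OF f] surj_iff [of f] by (intro bexI [of _ "inv_into UNIV f"]) (auto simp: bijs_def bij_def)
qed (auto simp: bijs_def bij_comp comp_assoc)

lemma pl_mid:
  fixes t :: real
  assumes "1 \<le> n" "real i < t" "t \<le> real i + 1"
  shows "0 < real n * (t - real i)" "real n * (t - real i) \<le> real n" "t - real i \<le> real n * (t - real i)"
proof -
  show "0 < real n * (t - real i)" using assms by simp
  show "real n * (t - real i) \<le> real n" using mult_left_mono [of "t - real i" 1 "real n"] assms by simp
  show "t - real i \<le> real n * (t - real i)" using mult_right_mono [of 1 "real n" "t - real i"] assms by simp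
qed

lemma pl_cases:
  fixes t :: real
  obtains "t \<le> real i" "pl n i t = t"
  | "real i < t" "t \<le> real i + 1" "pl n i t = real i + real n * (t - real i)"
  | "real i + 1 < t" "pl n i t = t + real n - 1"
  by (cases "t \<le> real i"; cases "t \<le> real i + 1") (simp_all add: pl_def)

lemma pl_inv_pl:
  assumes n: "1 \<le> n" shows "pl_inv n i (pl n i t) = t"
proof (cases rule: pl_cases [of t i n])
  case 2
  define p where "p = real n * (t - real i)"
  have p: "0 < p" "p \<le> real n" "p / real n = t - real i"
    using pl_mid(1,2) [OF n 2(1,2)] n by (simp_all add: p_def)
  have "pl n i t = real i + p" using 2 by (simp add: p_def)
  then show ?thesis using p by (simp add: pl_inv_def)
qed (use n in \<open>simp_all add: pl_inv_def\<close>)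

lemma pl_pl_inv:
  assumes n: "1 \<le> n" shows "pl n i (pl_inv n i t) = t"
proof -
  consider "t \<le> real i" | "real i < t" "t \<le> real i + real n" | "real i + real n < t" by linarith
  then show ?thesis
  proof cases
    case 2
    define q where "q = (t - real i) / real n"
    have q: "0 < q" "q \<le> 1" "real n * q = t - real i" using 2 n by (simp_all add: q_def)
    have "pl_inv n i t = real i + q" using 2 by (simp add: pl_inv_def q_def)
    then show ?thesis using q by (simp add: pl_def)
  qed (use n in \<open>simp_all add: pl_def pl_inv_def\<close>)
qed

lemma bij_pl: "1 \<le> n \<Longrightarrow> bij (pl n i)"
  by (rule o_bij [of "pl_inv n i"]) (auto simp: fun_eq_iff pl_inv_pl pl_pl_inv)

lemma pl_ge:
  assumes n: "1 \<le> n" shows "t \<le> pl n i t"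
proof (cases rule: pl_cases [of t i n])
  case 2
  then show ?thesis using pl_mid(3) [OF n 2(1,2)] by linarith
qed (use n in simp_all)

text \<open>Up to \<open>j + 1\<close> neither map of larger index moves its argument. Beyond
  \<open>j + 1\<close>, \<open>pl n j\<close> is the translation by \<open>n - 1\<close>, which
  carries \<open>pl n i\<close> to \<open>pl n (i + n - 1)\<close>.\<close>

lemma pl_relation:
  assumes n: "1 \<le> n" and ji: "j < i"
  shows "pl n j (pl n i t) = pl n (i + n - 1) (pl n j t)"
proof -
  have r: "real (i + n - 1) = real i + real n - 1" using n by (simp add: of_nat_diff)
  have fix_low: "pl n k u = u" if "u \<le> real k" for k u using that by (simp add: pl_def)
  have ji': "real j + 1 \<le> real i" using ji by simp
  show ?thesis
  proof (cases rule: pl_cases [of t j n])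
    case 1
    then have "t \<le> real i" "t \<le> real (i + n - 1)" using ji' n unfolding r by linarith+
    then show ?thesis using 1 fix_low by simp
  next
    case 2
    have "t \<le> real i" "pl n j t \<le> real (i + n - 1)"
      using 2 ji' pl_mid(2) [OF n 2(1,2)] unfolding r by linarith+
    then show ?thesis using fix_low by simp
  next
    case 3
    have "t + real n - 1 - (real i + real n - 1) = t - real i" by simp
    then have "pl n (i + n - 1) (t + real n - 1) = pl n i t + real n - 1"
      unfolding pl_def r by (simp add: algebra_simps)
    moreover have "pl n j (pl n i t) = pl n i t + real n - 1"
      using pl_ge [OF n, of t i] 3 by (simp add: pl_def [of n j])
    ultimately show ?thesis using 3 by simp
  qed
qed

locale thompson =
  fixes n :: nat
  assumes n2: "2 \<le> n"
begin

lemma n1: "1 \<le> n" and nz: "n - 1 > 0" using n2 by auto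

abbreviation mul (infixl "\<cdot>" 70) where "a \<cdot> b \<equiv> a \<otimes>\<^bsub>F_inf n\<^esub> b"
abbreviation iv where "iv a \<equiv> inv\<^bsub>F_inf n\<^esub> a"
abbreviation e1 where "e1 \<equiv> \<one>\<^bsub>F_inf n\<^esub>"
abbreviation pw (infixr "\<up>" 75) where "a \<up> k \<equiv> a [^]\<^bsub>F_inf n\<^esub> k"
abbreviation C where "C \<equiv> carrier (F_inf n)"

definition x :: "nat \<Rightarrow> nat word set" where "x = pgen UNIV (F_rels n)"

sublocale G: group "F_inf n"
  unfolding F_inf_def by (rule group_pres_group)

lemma F_rels_words: "F_rels n \<subseteq> words_on UNIV" by auto

lemma presents_F: "presents (F_inf n) C x UNIV (F_rels n)"
  using presents_pres_group [OF F_rels_words] by (simp add: F_inf_def x_def)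

lemma generates_F: "generates (F_inf n) C x UNIV"
  by (rule presentsD(1) [OF presents_F])

lemma x_closed [simp]: "x i \<in> C"
  using generatesD(1) [OF generates_F] by auto

lemma x_rel: "j < i \<Longrightarrow> x i \<cdot> x j = x j \<cdot> x (i + n - 1)"
proof -
  assume "j < i"
  then have "[(True, j), (False, i), (False, j), (True, i + n - 1)] \<in> F_rels n" by (auto simp: F_rels_def)
  from presentsD(4) [OF presents_F this]
  have "iv (x j) \<cdot> (x i \<cdot> (x j \<cdot> iv (x (i + n - 1)))) = e1" by simp
  then have "x j \<cdot> (iv (x j) \<cdot> (x i \<cdot> (x j \<cdot> iv (x (i + n - 1))))) \<cdot> x (i + n - 1) = x j \<cdot> e1 \<cdot> x (i + n - 1)"
    by simp
  then show ?thesis by (simp add: G.m_assoc)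
qed

lemma homs_gen:
  assumes E: "group E" and f: "\<And>i. f i \<in> carrier E"
    "\<And>i j. j < i \<Longrightarrow> f i \<otimes>\<^bsub>E\<^esub> f j = f j \<otimes>\<^bsub>E\<^esub> f (i + n - 1)"
  shows "\<exists>F. F \<in> homs (F_inf n) C E \<and> (\<forall>i. F (x i) = f i)"
proof -
  interpret E: group E by fact
  have r: "ev E f r = \<one>\<^bsub>E\<^esub>" if r: "r \<in> F_rels n" for r
  proof -
    obtain i j where ij: "j < i" "r = [(True, j), (False, i), (False, j), (True, i + n - 1)]"
      using r by (auto simp: F_rels_def)
    have "ev E f r = inv\<^bsub>E\<^esub> (f j) \<otimes>\<^bsub>E\<^esub> ((f i \<otimes>\<^bsub>E\<^esub> f j) \<otimes>\<^bsub>E\<^esub> inv\<^bsub>E\<^esub> (f (i + n - 1)))"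
      using f(1) by (simp add: ij(2) E.m_assoc)
    also have "\<dots> = \<one>\<^bsub>E\<^esub>" unfolding f(2) [OF ij(1)] using f(1) by (simp add: E.m_assoc)
    finally show ?thesis .
  qed
  show ?thesis using G.presents_hom [OF G.subgroup_self presents_F E _ r] f(1) by (metis UNIV_I image_subsetI)
qed

lemma homs_eqI:
  assumes "group E" "F \<in> homs (F_inf n) C E" "F' \<in> homs (F_inf n) C E" "\<And>i. F (x i) = F' (x i)" "g \<in> C"
  shows "F g = F' g"
  by (rule G.homs_eq [OF G.subgroup_self generates_F assms(1-3) _ assms(5)]) (rule assms(4))

lemma generated: "subgroup H (F_inf n) \<Longrightarrow> (\<And>i. x i \<in> H) \<Longrightarrow> C \<subseteq> H"
  using G.generates_subset [OF generates_F] by blast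

lemma generated_low:
  assumes H: "subgroup H (F_inf n)" and low: "\<And>i. i < n \<Longrightarrow> x i \<in> H"
  shows "C \<subseteq> H"
proof (rule generated [OF H])
  fix i show "x i \<in> H"
  proof (induction i rule: less_induct)
    case (less i)
    show ?case
    proof (cases "i < n")
      case False
      then have "x (i - (n - 1)) \<cdot> x 0 = x 0 \<cdot> x i" using x_rel [of 0 "i - (n - 1)"] n2 by simp
      then have "x i = iv (x 0) \<cdot> (x (i - (n - 1)) \<cdot> x 0)" by simp
      then show ?thesis using less [of "i - (n - 1)"] less [of 0] False n2 H
        by (simp add: subgroup.m_closed subgroup.m_inv_closed)
    qed (use low in auto)
  qed
qed

text \<open>The map back into the finitely presented group exists because \<open>fext\<close>
  continues its generators to a family that satisfies all the relations of
  \<open>F_inf n\<close>.\<close>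

theorem cost_F: "\<exists>c. cost_le (F_inf n) C c"
proof -
  define X :: "nat set" where "X = {..3 * n}"
  define rl where "rl i j = [(True, j), (False, i), (False, j), (True, i + n - 1)]" for i j :: nat
  define I where "I = {(i, j). j < i \<and> i \<le> 2 * n + 1}"
  define R where "R = (\<lambda>(i, j). rl i j) ` I"
  have "I \<subseteq> {..2 * n + 1} \<times> {..2 * n + 1}" by (auto simp: I_def)
  then have finI: "finite I" by (rule finite_subset) auto
  have R: "R \<subseteq> words_on X" using n2 by (auto simp: R_def I_def rl_def X_def)
  have RF: "R \<subseteq> F_rels n" by (auto simp: R_def I_def rl_def F_rels_def)
  let ?E = "pres_group X R"
  interpret E: group ?E by (rule group_pres_group)
  define e where "e = pgen X R"
  have e: "range e \<subseteq> carrier ?E" by (auto simp: e_def)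
  then have ec [simp]: "e i \<in> carrier ?E" for i by auto
  have rel: "e i \<otimes>\<^bsub>?E\<^esub> e j = e j \<otimes>\<^bsub>?E\<^esub> e (i + (n - 1))" if ij: "j < i" "i \<le> 2 * n + 1" for i j
  proof -
    have rR: "rl i j \<in> R" using ij by (auto simp: R_def I_def)
    have eq: "i + n - 1 = i + (n - 1)" using n1 by simp
    have "ev ?E e (rl i j) = \<one>\<^bsub>?E\<^esub>"
      unfolding e_def using pgen_relator [OF rR] R rR by auto
    then have "inv\<^bsub>?E\<^esub> (e j) \<otimes>\<^bsub>?E\<^esub> (e i \<otimes>\<^bsub>?E\<^esub> (e j \<otimes>\<^bsub>?E\<^esub> inv\<^bsub>?E\<^esub> (e (i + (n - 1))))) = \<one>\<^bsub>?E\<^esub>"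
      unfolding rl_def eq by simp
    then have "e j \<otimes>\<^bsub>?E\<^esub> (inv\<^bsub>?E\<^esub> (e j) \<otimes>\<^bsub>?E\<^esub> (e i \<otimes>\<^bsub>?E\<^esub> (e j \<otimes>\<^bsub>?E\<^esub> inv\<^bsub>?E\<^esub> (e (i + (n - 1)))))) \<otimes>\<^bsub>?E\<^esub> e (i + (n - 1)) =
        e j \<otimes>\<^bsub>?E\<^esub> \<one>\<^bsub>?E\<^esub> \<otimes>\<^bsub>?E\<^esub> e (i + (n - 1))" by simp
    then show ?thesis by (simp add: E.m_assoc)
  qed
  obtain F where F: "F \<in> homs (F_inf n) C ?E" "\<And>i. F (x i) = fext ?E n e i"
    using homs_gen [OF group_pres_group, of "fext ?E n e"] E.fext_closed [OF e]
      E.fext_rel [OF n2 e rel] Nat.add_diff_assoc [OF n1] by metis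
  have gen: "generates (F_inf n) C x X"
  proof (rule G.generatesI [OF G.subgroup_self])
    show "x ` X \<subseteq> C" by auto
    fix H assume "subgroup H (F_inf n)" "x ` X \<subseteq> H"
    then show "C \<subseteq> H" by (intro generated_low) (auto simp: X_def)
  qed
  have "presents (F_inf n) C x X R"
  proof (rule G.presentsI [OF G.subgroup_self gen R _ F(1)])
    show "ev (F_inf n) x r = e1" if "r \<in> R" for r using presentsD(4) [OF presents_F] RF that by auto
    show "F (x i) = pgen X R i" if "i \<in> X" for i
      using that F(2) [of i] by (simp add: X_def e_def fext.simps)
  qed
  then have "cost_le (F_inf n) C (card X + card R)"
    using finI by (intro cost_leI [of X R]) (auto simp: X_def R_def)
  then show ?thesis ..
qed

text \<open>Generators and relations give such a homomorphism as a mere existence statement, whence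
  the choice operator; its values on \<open>C\<close> are determined by those on the
  generators.\<close>

definition act :: "nat word set \<Rightarrow> real \<Rightarrow> real" where
  "act = (SOME F. F \<in> homs (F_inf n) C bijs \<and> (\<forall>i. F (x i) = pl n i))"

lemma act: "act \<in> homs (F_inf n) C bijs" "act (x i) = pl n i"
proof -
  have "\<exists>F. F \<in> homs (F_inf n) C bijs \<and> (\<forall>i. F (x i) = pl n i)"
    using pl_relation [OF n1] bij_pl [OF n1]
    by (intro homs_gen [OF group_bijs]) (auto simp: bijs_def fun_eq_iff)
  from someI_ex [OF this] show "act \<in> homs (F_inf n) C bijs" "act (x i) = pl n i"
    by (auto simp: act_def)
qed

lemma act_mult: "g \<in> C \<Longrightarrow> h \<in> C \<Longrightarrow> act (g \<cdot> h) t = act h (act g t)"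
  using act(1) by (simp add: homs_def bijs_def)

lemma act_one [simp]: "act e1 t = t"
  using homs_on.one [OF G.homs_onI [OF group_bijs G.subgroup_self act(1)]] by (simp add: bijs_def)

lemma act_inv2: "g \<in> C \<Longrightarrow> act (iv g) (act g t) = t"
  using act_mult [of g "iv g" t] by simp

lemma act_iv_x: "act (iv (x i)) t = pl_inv n i t"
  using act_inv2 [of "x i" "pl_inv n i t"] by (simp add: act(2) pl_pl_inv [OF n1])

text \<open>Fixed half-lines separate the stable letters from the bases: the \<open>k\<close>-fold
  shift of \<open>F\<close> fixes everything up to \<open>k\<close>, and the image of
  \<open>\<theta>\<close> fixes everything from 1 on, in the sense of
  \<open>fixes_from\<close>.\<close>

definition fixes_upto :: "nat \<Rightarrow> nat word set set" where
  "fixes_upto k = {g \<in> C. \<forall>t\<in>{..real k}. act g t = t}"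

definition fixes_from :: "nat \<Rightarrow> nat word set set" where
  "fixes_from k = {g \<in> C. \<forall>t\<in>{real k..}. act g t = t}"

lemma subgroup_fixer: "subgroup {g \<in> C. \<forall>t\<in>T. act g t = t} (F_inf n)"
proof (rule G.subgroupI)
  show "{g \<in> C. \<forall>t\<in>T. act g t = t} \<noteq> {}" using G.one_closed act_one by blast
  fix g assume g: "g \<in> {g \<in> C. \<forall>t\<in>T. act g t = t}"
  then have "act (iv g) t = t" if "t \<in> T" for t using act_inv2 [of g t] that by simp
  then show "iv g \<in> {g \<in> C. \<forall>t\<in>T. act g t = t}" using g by simp
  fix h assume "h \<in> {g \<in> C. \<forall>t\<in>T. act g t = t}"
  then show "g \<cdot> h \<in> {g \<in> C. \<forall>t\<in>T. act g t = t}" using g by (simp add: act_mult)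
qed auto

lemma subgroup_fixes_upto: "subgroup (fixes_upto k) (F_inf n)"
  using subgroup_fixer [of "{..real k}"] by (simp add: fixes_upto_def)

lemma subgroup_fixes_from: "subgroup (fixes_from k) (F_inf n)"
  using subgroup_fixer [of "{real k..}"] by (simp add: fixes_from_def)

text \<open>The orbit of a point of \<open>S\<close> is trapped in \<open>T\<close>. With a starting
  point outside \<open>T\<close>, no positive power can fix that point.\<close>

lemma act_pow_mem:
  assumes "g \<in> C" "t \<in> S" "\<And>u. u \<in> S \<Longrightarrow> act g u \<in> T" "T \<subseteq> S" "k > 0"
  shows "act (g \<up> (k::nat)) t \<in> T"
  using assms(5)
proof (induction k)
  case (Suc k)
  have "act (g \<up> k) t \<in> S"
    using Suc.IH assms(2,4) by (cases "k = 0") auto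
  then show ?case using assms(1,3) by (simp add: act_mult)
qed simp

subsection \<open>The shift endomorphism\<close>

lemma homs_on_C: "group E \<Longrightarrow> F \<in> homs (F_inf n) C E \<Longrightarrow> homs_on (F_inf n) E C F"
  by (rule G.homs_onI [OF _ G.subgroup_self])

lemma image_subset_gen:
  assumes "h \<in> homs (F_inf n) C (F_inf n)" "subgroup H (F_inf n)" "\<And>i. h (x i) \<in> H"
  shows "h ` C \<subseteq> H"
  using G.generates_subset [OF G.generates_image [OF G.subgroup_self G.is_group assms(1) generates_F] assms(2)] assms(3)
  by auto

lemma x_moves: "k > 0 \<Longrightarrow> x i \<up> (k::nat) \<notin> fixes_upto (Suc i)"
proof
  assume k: "k > 0" and "x i \<up> k \<in> fixes_upto (Suc i)"
  then have "act (x i \<up> k) (real i + 1) = real i + 1" by (simp add: fixes_upto_def)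
  moreover have "act (x i \<up> k) (real i + 1) \<in> {real i + 1<..}"
  proof (rule act_pow_mem [of _ _ "{real i + 1..}"])
    fix u :: real assume u: "u \<in> {real i + 1..}"
    have "pl n i u = u + real n - 1" using u by (cases rule: pl_cases [of u i n]) (auto simp: algebra_simps)
    then show "act (x i) u \<in> {real i + 1<..}" using u n2 by (simp add: act(2))
  qed (use k in auto)
  ultimately show False by simp
qed

lemma x_mem_fixes_upto: "k \<le> i \<Longrightarrow> x i \<in> fixes_upto k"
  by (simp add: fixes_upto_def act(2) pl_def)

definition \<phi> :: "nat word set \<Rightarrow> nat word set" where
  "\<phi> = (SOME F. F \<in> homs (F_inf n) C (F_inf n) \<and> (\<forall>i. F (x i) = x (Suc i)))"

lemma phi: "\<phi> \<in> homs (F_inf n) C (F_inf n)" "\<phi> (x i) = x (Suc i)"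
proof -
  have "\<exists>F. F \<in> homs (F_inf n) C (F_inf n) \<and> (\<forall>i. F (x i) = x (Suc i))"
  proof (rule homs_gen [OF G.is_group])
    fix i j :: nat assume "j < i"
    then show "x (Suc i) \<cdot> x (Suc j) = x (Suc j) \<cdot> x (Suc (i + n - 1))"
      using x_rel [of "Suc j" "Suc i"] n1 by (simp add: Suc_diff_le)
  qed simp
  from someI_ex [OF this] show "\<phi> \<in> homs (F_inf n) C (F_inf n)" "\<phi> (x i) = x (Suc i)"
    by (auto simp: \<phi>_def)
qed

lemma phi_closed: "g \<in> C \<Longrightarrow> \<phi> g \<in> C"
  using phi(1) by (auto simp: homs_def)

lemma phi_pow: "(\<phi> ^^ k) \<in> homs (F_inf n) C (F_inf n)" "(\<phi> ^^ k) (x i) = x (i + k)"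
proof -
  show "(\<phi> ^^ k) \<in> homs (F_inf n) C (F_inf n)"
  proof (induction k)
    case (Suc k)
    have "(\<phi> ^^ k) ` C \<subseteq> C" using Suc by (simp add: homs_def)
    then show ?case using G.homs_comp [OF Suc _ phi(1)] by (simp only: funpow.simps)
  qed (auto simp: homs_def)
  show "(\<phi> ^^ k) (x i) = x (i + k)" by (induction k) (simp_all add: phi(2))
qed

lemma phi_pow_closed: "g \<in> C \<Longrightarrow> (\<phi> ^^ k) g \<in> C"
  using phi_pow(1) by (auto simp: homs_def)

text \<open>On generators this is the defining relation with \<open>j = 0\<close>. It shows that
  \<open>x 0\<close> conjugates the shifted copy into itself, and it is what makes
  \<open>\<phi>\<close> injective there.\<close>

lemma phi_conj:
  assumes "g \<in> C" shows "iv (x 0) \<cdot> \<phi> g \<cdot> x 0 = (\<phi> ^^ n) g"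
proof (rule homs_eqI [OF G.is_group _ phi_pow(1) _ assms])
  show "(\<lambda>g. iv (x 0) \<cdot> \<phi> g \<cdot> x 0) \<in> homs (F_inf n) C (F_inf n)"
    by (rule G.conj_homs [OF phi(1)]) simp
  fix i
  have "x (Suc i) \<cdot> x 0 = x 0 \<cdot> x (i + n)" using x_rel [of 0 "Suc i"] by simp
  then show "iv (x 0) \<cdot> \<phi> (x i) \<cdot> x 0 = (\<phi> ^^ n) (x i)"
    by (simp add: phi(2) phi_pow(2) G.m_assoc)
qed

lemma phi_pow_fixes: "(\<phi> ^^ k) ` C \<subseteq> fixes_upto k"
  by (rule image_subset_gen [OF phi_pow(1) subgroup_fixes_upto]) (simp add: phi_pow(2) x_mem_fixes_upto)

lemma phi_fixes: "\<phi> ` C \<subseteq> fixes_upto 1" "\<phi> ` \<phi> ` C \<subseteq> fixes_upto 2"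
  using phi_pow_fixes [of 1] phi_pow_fixes [of 2] by (simp_all add: image_image numeral_2_eq_2)

lemma subgroup_phi: "subgroup (\<phi> ` C) (F_inf n)"
  by (rule G.subgroup_homs_image [OF G.subgroup_self G.is_group phi(1)])

theorem asc_phi: "asc (F_inf n) C (\<phi> ` C) (x 0)"
proof (rule G.ascI [OF subgroup_phi])
  fix b assume "b \<in> \<phi> ` C"
  then obtain g where g: "g \<in> C" "b = \<phi> g" by auto
  obtain m where m: "n = Suc m" using n1 by (cases n) auto
  have "iv (x 0) \<cdot> b \<cdot> x 0 = \<phi> ((\<phi> ^^ m) g)"
    unfolding g(2) phi_conj [OF g(1)] by (simp add: m)
  then show "iv (x 0) \<cdot> b \<cdot> x 0 \<in> \<phi> ` C" using phi_pow_closed [OF g(1)] by blast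
next
  fix H assume H: "subgroup H (F_inf n)" "\<phi> ` C \<subseteq> H" "x 0 \<in> H"
  show "C \<subseteq> H"
  proof (rule generated [OF H(1)])
    fix i show "x i \<in> H"
    proof (cases i)
      case (Suc j)
      then have "x i = \<phi> (x j)" by (simp add: phi(2))
      then show ?thesis using H(2) x_closed by blast
    qed (use H in simp)
  qed
next
  fix k :: nat assume "k > 0"
  then show "x 0 \<up> k \<notin> \<phi> ` C" using x_moves [of k 0] phi_fixes(1) by auto
qed simp

text \<open>On its image \<open>\<phi>\<close> is injective: elements \<open>\<phi> g\<close> and
  \<open>\<phi> h\<close> with equal shifts have equal conjugates by \<open>x 0\<close>, because by
  \<open>phi_conj\<close> these are \<open>n\<close>-fold shifts of \<open>g\<close> and
  \<open>h\<close> and \<open>n \<ge> 2\<close>. \<open>asc_inj\<close> extends this to the whole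
  group.\<close>

theorem inj_phi: "inj_on \<phi> C"
proof (rule G.asc_inj [OF asc_phi G.is_group phi(1)])
  define m where "m = n - 2"
  then have m: "n = Suc (Suc m)" using n2 by simp
  show "inj_on \<phi> (\<phi> ` C)"
  proof (rule inj_onI)
    fix a b assume "a \<in> \<phi> ` C" "b \<in> \<phi> ` C" and eq: "\<phi> a = \<phi> b"
    then obtain g h where g: "g \<in> C" "a = \<phi> g" and h: "h \<in> C" "b = \<phi> h" by auto
    have pn: "(\<phi> ^^ n) u = (\<phi> ^^ m) (\<phi> (\<phi> u))" for u
      by (simp add: m funpow_swap1)
    have "iv (x 0) \<cdot> a \<cdot> x 0 = iv (x 0) \<cdot> b \<cdot> x 0"
      unfolding g(2) h(2) phi_conj [OF g(1)] phi_conj [OF h(1)] pn using eq g(2) h(2) by simp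
    then show "a = b" using phi_closed g h by (simp add: G.m_assoc)
  qed
  fix k :: nat assume k: "k > 0"
  show "\<phi> (x 0) \<up> k \<notin> \<phi> ` \<phi> ` C"
    using x_moves [OF k, of 1] phi_fixes(2) by (auto simp: phi(2) numeral_2_eq_2)
qed

lemma asc_phi_phi: "asc (F_inf n) (\<phi> ` C) (\<phi> ` \<phi> ` C) (x 1)"
  using G.asc_image [OF asc_phi G.is_group phi(1) inj_phi] by (simp add: phi(2))

subsection \<open>An element commuting with a shifted copy\<close>

definition c :: "nat word set" where "c = x 0 \<cdot> iv (x 1)"

lemma c_closed [simp]: "c \<in> C" by (simp add: c_def)

text \<open>\<open>x 0\<close> and \<open>x 1\<close> conjugate each generator of index at least 2
  to the same generator, so their quotient \<open>c\<close> centralizes the double shift.\<close>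

lemma c_comm: "g \<in> \<phi> ` \<phi> ` C \<Longrightarrow> c \<cdot> g = g \<cdot> c"
proof -
  have 0: "x (Suc (Suc i)) \<cdot> c = c \<cdot> x (Suc (Suc i))" for i
  proof -
    have 1: "x (Suc (Suc i)) \<cdot> x 0 = x 0 \<cdot> x (Suc i + n)" using x_rel [of 0 "Suc (Suc i)"] by simp
    have "x (Suc (Suc i)) \<cdot> x 1 = x 1 \<cdot> x (Suc i + n)" using x_rel [of 1 "Suc (Suc i)"] by simp
    then have "iv (x 1) \<cdot> (x (Suc (Suc i)) \<cdot> x 1) \<cdot> iv (x 1) = iv (x 1) \<cdot> (x 1 \<cdot> x (Suc i + n)) \<cdot> iv (x 1)" by simp
    then have 2: "x (Suc i + n) \<cdot> iv (x 1) = iv (x 1) \<cdot> x (Suc (Suc i))" by (simp add: G.m_assoc)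
    have "x (Suc (Suc i)) \<cdot> c = (x (Suc (Suc i)) \<cdot> x 0) \<cdot> iv (x 1)" by (simp add: c_def G.m_assoc)
    also have "\<dots> = x 0 \<cdot> (x (Suc i + n) \<cdot> iv (x 1))" unfolding 1 by (simp add: G.m_assoc)
    also have "\<dots> = c \<cdot> x (Suc (Suc i))" unfolding 2 by (simp add: c_def G.m_assoc)
    finally show ?thesis .
  qed
  have s: "subgroup {g \<in> C. \<forall>a\<in>{c}. a \<cdot> g = g \<cdot> a} (F_inf n)" by (rule G.subgroup_centralizer) simp
  have "(\<phi> ^^ 2) ` C \<subseteq> {g \<in> C. \<forall>a\<in>{c}. a \<cdot> g = g \<cdot> a}"
    by (rule image_subset_gen [OF phi_pow(1) s]) (simp add: phi_pow(2) 0)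
  moreover assume "g \<in> \<phi> ` \<phi> ` C"
  then have "g \<in> (\<phi> ^^ 2) ` C" by (simp add: image_image numeral_2_eq_2)
  ultimately show "c \<cdot> g = g \<cdot> c" by blast
qed

lemma c_moves: "k > 0 \<Longrightarrow> c \<up> (k::nat) \<notin> fixes_upto 1"
proof
  assume k: "k > 0" and "c \<up> k \<in> fixes_upto 1"
  then have "act (c \<up> k) 1 = 1" by (simp add: fixes_upto_def)
  \<comment> \<open>The interval from 1 to 2 is invariant: there \<open>c\<close> acts by
    \<open>u \<mapsto> 1 + (u + n - 2) / n\<close>, which never takes the value 1.\<close>
  moreover have "act (c \<up> k) 1 \<in> {1<..2}"
  proof (rule act_pow_mem [of _ _ "{1..2}"])
    fix u :: real assume u: "u \<in> {1..2}"
    have "pl n 0 u = u + real n - 1" using u by (cases rule: pl_cases [of u 0 n]) (auto simp: algebra_simps)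
    then have "act c u = pl_inv n 1 (u + real n - 1)"
      by (simp add: c_def act_mult act(2) act_iv_x)
    also have "\<dots> = 1 + (u + real n - 2) / real n" using u n2 by (simp add: pl_inv_def)
    finally show "act c u \<in> {1<..2}" using u n2 by simp
  qed (use k in auto)
  ultimately show False by simp
qed

subsection \<open>The endomorphism given by a right spine\<close>

text \<open>The product of \<open>x 0\<close>, \<open>x (n - 1)\<close>,
  \<open>x (2 * (n - 1))\<close> and so on: a right spine of \<open>k\<close> carets, each attached
  to the last leaf of the one before.\<close>

primrec S :: "nat \<Rightarrow> nat word set" where
  "S 0 = e1"
| "S (Suc k) = S k \<cdot> x (k * (n - 1))"

lemma S_closed [simp]: "S k \<in> C"
  by (induction k) auto

text \<open>A finite approximation to the conjugate of \<open>x i\<close> by the infinite spine. The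
  spine on the right is longer by one because \<open>x i\<close> moves the later spine letters by
  one place.\<close>

definition th :: "nat \<Rightarrow> nat \<Rightarrow> nat word set" where
  "th k i = S k \<cdot> x i \<cdot> iv (S (Suc k))"

lemma th_closed [simp]: "th k i \<in> C"
  by (simp add: th_def del: S.simps)

text \<open>Passing \<open>x i\<close> turns the next spine letter into the one after it, which
  cancels against the end of the longer spine.\<close>

lemma th_Suc: "i < k * (n - 1) \<Longrightarrow> th (Suc k) i = th k i"
proof -
  assume i: "i < k * (n - 1)"
  have "x (k * (n - 1)) \<cdot> x i = x i \<cdot> x (Suc k * (n - 1))"
    using x_rel [OF i] n1 by (simp add: add.commute)
  then have "x (k * (n - 1)) \<cdot> x i \<cdot> iv (x (Suc k * (n - 1))) = x i" by (simp add: G.m_assoc)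
  moreover have "th (Suc k) i = S k \<cdot> (x (k * (n - 1)) \<cdot> x i \<cdot> iv (x (Suc k * (n - 1)))) \<cdot> iv (S (Suc k))"
    by (simp add: th_def G.group_word)
  ultimately show ?thesis by (simp add: th_def)
qed

lemma th_stable:
  assumes "i < k * (n - 1)" "k \<le> l"
  shows "th l i = th k i"
  using assms(2)
proof (induction l rule: dec_induct)
  case (step l)
  have "i < l * (n - 1)" using assms(1) step(1) by (meson less_le_trans mult_le_mono1)
  then show ?case using th_Suc step by simp
qed simp

lemma lt_mult: "i < k \<Longrightarrow> i < k * (n - 1)"
  using nz by (metis Suc_leI less_le_trans mult.right_neutral mult_le_mono2 One_nat_def)

definition \<theta> :: "nat word set \<Rightarrow> nat word set" where
  "\<theta> = (SOME F. F \<in> homs (F_inf n) C (F_inf n) \<and> (\<forall>i. F (x i) = th (Suc i) i))"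

lemma th_mult: "th k i \<cdot> th (Suc k) j = S k \<cdot> (x i \<cdot> x j) \<cdot> iv (S (Suc (Suc k)))"
  by (simp add: th_def G.m_assoc del: S.simps)

text \<open>By \<open>th_stable\<close> all factors can be taken at consecutive large levels, where
  by \<open>th_mult\<close> a product depends only on \<open>x i \<cdot> x j\<close>. The relations
  thus carry over.\<close>

lemma theta: "\<theta> \<in> homs (F_inf n) C (F_inf n)" "\<theta> (x i) = th (Suc i) i"
proof -
  have "\<exists>F. F \<in> homs (F_inf n) C (F_inf n) \<and> (\<forall>i. F (x i) = th (Suc i) i)"
  proof (rule homs_gen [OF G.is_group])
    fix i j :: nat assume ij: "j < i"
    have st: "th (Suc l) l = th k l" if "Suc l \<le> k" for l k
      using th_stable [OF lt_mult [of l "Suc l"] that] by simp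
    have i: "th (Suc i) i = th (i + n) i" using n1 by (intro st) auto
    have j: "th (Suc j) j = th (Suc (i + n)) j" "th (Suc j) j = th (i + n) j"
      using st [of j "Suc (i + n)"] st [of j "i + n"] ij n1 by simp_all
    have "th (Suc (i + n - 1)) (i + n - 1) = th (Suc (i + n)) (i + n - 1)" by (intro st) auto
    then show "th (Suc i) i \<cdot> th (Suc j) j = th (Suc j) j \<cdot> th (Suc (i + n - 1)) (i + n - 1)"
      using th_mult [of "i + n" i j] th_mult [of "i + n" j "i + n - 1"] x_rel [OF ij] i j by metis
  qed simp
  from someI_ex [OF this] show "\<theta> \<in> homs (F_inf n) C (F_inf n)" "\<theta> (x i) = th (Suc i) i"
    by (auto simp: \<theta>_def)
qed

lemma theta_closed: "g \<in> C \<Longrightarrow> \<theta> g \<in> C"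
  using theta(1) by (auto simp: homs_def)

lemma theta_mult: "g \<in> C \<Longrightarrow> h \<in> C \<Longrightarrow> \<theta> (g \<cdot> h) = \<theta> g \<cdot> \<theta> h"
  using theta(1) by (auto simp: homs_def)

lemma theta_inv: "g \<in> C \<Longrightarrow> \<theta> (iv g) = iv (\<theta> g)"
  using homs_on.inv [OF homs_on_C [OF G.is_group theta(1)]] by simp

lemma theta_x: "i < k * (n - 1) \<Longrightarrow> \<theta> (x i) = th k i"
  using th_stable [of i k "max k (Suc i)"] th_stable [of i "Suc i" "max k (Suc i)"] lt_mult [of i "Suc i"]
  by (simp add: theta(2))

lemma x_S: "0 < j \<Longrightarrow> x j \<cdot> S k = S k \<cdot> x (j + k * (n - 1))"
proof (induction k)
  case (Suc k)
  have "x (j + k * (n - 1)) \<cdot> x (k * (n - 1)) = x (k * (n - 1)) \<cdot> x (j + Suc k * (n - 1))"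
    using x_rel [of "k * (n - 1)" "j + k * (n - 1)"] Suc.prems n1 by (simp add: ac_simps)
  then have "S k \<cdot> (x (j + k * (n - 1)) \<cdot> x (k * (n - 1))) = S k \<cdot> (x (k * (n - 1)) \<cdot> x (j + Suc k * (n - 1)))"
    by simp
  moreover have "x j \<cdot> S (Suc k) = S k \<cdot> (x (j + k * (n - 1)) \<cdot> x (k * (n - 1)))"
    using Suc by (simp flip: G.m_assoc)
  ultimately show ?case by (simp add: G.m_assoc)
qed simp

text \<open>Geometrically the supports are disjoint: the image of \<open>\<theta>\<close> moves only
  points below 1, and \<open>x j\<close> only points above 1. The proof uses the relations, since
  \<open>act\<close> is not shown to be faithful.\<close>

lemma x_theta_comm: "0 < j \<Longrightarrow> x j \<cdot> \<theta> (x i) = \<theta> (x i) \<cdot> x j"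
proof -
  assume j: "0 < j"
  define k where "k = Suc i"
  have ik: "i < k * (n - 1)" unfolding k_def by (rule lt_mult) simp
  have t: "\<theta> (x i) = S k \<cdot> x i \<cdot> iv (S (Suc k))" using theta_x [OF ik] by (simp add: th_def)
  have e: "j + k * (n - 1) + n - 1 = j + Suc k * (n - 1)" using n1 by simp
  have 1: "x (j + k * (n - 1)) \<cdot> x i = x i \<cdot> x (j + Suc k * (n - 1))"
    using x_rel [of i "j + k * (n - 1)"] ik unfolding e by simp
  have 2: "x (j + Suc k * (n - 1)) \<cdot> iv (S (Suc k)) = iv (S (Suc k)) \<cdot> x j"
  proof -
    have "iv (S (Suc k)) \<cdot> (x j \<cdot> S (Suc k)) \<cdot> iv (S (Suc k)) = iv (S (Suc k)) \<cdot> (S (Suc k) \<cdot> x (j + Suc k * (n - 1))) \<cdot> iv (S (Suc k))"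
      unfolding x_S [OF j] by simp
    then show ?thesis by (simp add: G.m_assoc del: S.simps)
  qed
  have "x j \<cdot> \<theta> (x i) = (x j \<cdot> S k) \<cdot> x i \<cdot> iv (S (Suc k))" unfolding t by (simp add: G.m_assoc del: S.simps)
  also have "\<dots> = S k \<cdot> (x (j + k * (n - 1)) \<cdot> x i) \<cdot> iv (S (Suc k))"
    unfolding x_S [OF j] by (simp add: G.m_assoc del: S.simps)
  also have "\<dots> = S k \<cdot> x i \<cdot> (x (j + Suc k * (n - 1)) \<cdot> iv (S (Suc k)))"
    unfolding 1 by (simp add: G.m_assoc del: S.simps)
  also have "\<dots> = \<theta> (x i) \<cdot> x j" unfolding 2 t by (simp add: G.m_assoc del: S.simps)
  finally show ?thesis .
qed

text \<open>The spine letters are evaluated at the levels \<open>K\<close>, \<open>K + 1\<close> and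
  so on, so that the spines between them cancel; the bound keeps all of them in the stable
  range.\<close>

lemma theta_S:
  assumes "k * (n - 1) < K"
  shows "\<theta> (S k) = S K \<cdot> S k \<cdot> iv (S (K + k))"
  using assms
proof (induction k)
  case 0
  then show ?case using homs_on.one [OF homs_on_C [OF G.is_group theta(1)]] by simp
next
  case (Suc k)
  have "k * (n - 1) < K + k" using Suc.prems by simp
  then have "k * (n - 1) < (K + k) * (n - 1)" by (rule lt_mult)
  then have "\<theta> (x (k * (n - 1))) = S (K + k) \<cdot> x (k * (n - 1)) \<cdot> iv (S (K + Suc k))"
    using theta_x by (simp add: th_def)
  moreover have "\<theta> (S k) = S K \<cdot> S k \<cdot> iv (S (K + k))" using Suc by simp
  moreover have "\<theta> (S (Suc k)) = \<theta> (S k) \<cdot> \<theta> (x (k * (n - 1)))" by (simp add: theta_mult)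
  ultimately show ?case by (simp add: G.m_assoc del: S.simps(2)) (simp add: G.m_assoc)
qed

text \<open>On its own image \<open>\<theta>\<close> is conjugation by a finite spine, by
  \<open>theta_S\<close>. All spine letters except \<open>x 0\<close> commute with that image by
  \<open>x_theta_comm\<close>, so only \<open>x 0\<close> survives.\<close>

lemma theta_theta:
  assumes "f \<in> \<theta> ` C" shows "\<theta> f = x 0 \<cdot> f \<cdot> iv (x 0)"
proof -
  obtain g where g: "g \<in> C" "f = \<theta> g" using assms by auto
  have c: "(\<lambda>g. iv (iv (x 0)) \<cdot> \<theta> g \<cdot> iv (x 0)) \<in> homs (F_inf n) C (F_inf n)"
    by (rule G.conj_homs [OF theta(1)]) simp
  have t: "\<theta> \<circ> \<theta> \<in> homs (F_inf n) C (F_inf n)"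
    by (rule G.homs_comp [OF theta(1) _ theta(1)]) (use theta_closed in auto)
  have "(\<theta> \<circ> \<theta>) g = iv (iv (x 0)) \<cdot> \<theta> g \<cdot> iv (x 0)"
  proof (rule homs_eqI [OF G.is_group t c _ g(1)])
    fix i
    \<comment> \<open>\<open>K\<close> exceeds \<open>Suc k * (n - 1)\<close>, so
      \<open>theta_S\<close> applies to both \<open>k\<close> and \<open>Suc k\<close> at the common
      level \<open>K\<close>.\<close>
    define k K where "k = Suc i" and "K = Suc (Suc k * (n - 1))"
    define h where "h = \<theta> (x i)"
    have hc [simp]: "h \<in> C" by (simp add: h_def theta_closed)
    have ik: "i < k * (n - 1)" unfolding k_def by (rule lt_mult) simp
    have h: "h = S k \<cdot> x i \<cdot> iv (S (Suc k))" using theta_x [OF ik] by (simp add: th_def h_def)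
    have "i < (K + k) * (n - 1)" by (rule lt_mult) (simp add: k_def)
    then have t1: "\<theta> (x i) = S (K + k) \<cdot> x i \<cdot> iv (S (Suc (K + k)))" using theta_x by (simp add: th_def)
    have t2: "\<theta> (S k) = S K \<cdot> S k \<cdot> iv (S (K + k))" by (rule theta_S) (simp add: K_def)
    have t3: "\<theta> (S (Suc k)) = S K \<cdot> S (Suc k) \<cdot> iv (S (K + Suc k))" by (rule theta_S) (simp add: K_def)
    have "\<theta> h = \<theta> (S k) \<cdot> \<theta> (x i) \<cdot> iv (\<theta> (S (Suc k)))"
      unfolding h by (simp add: theta_mult theta_inv del: S.simps)
    also have "\<dots> = S K \<cdot> h \<cdot> iv (S K)"
      unfolding t1 t2 t3 h by (simp add: G.group_word del: S.simps)
    also have "\<dots> = x 0 \<cdot> h \<cdot> iv (x 0)"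
    proof -
      have "S (Suc l) \<cdot> h \<cdot> iv (S (Suc l)) = x 0 \<cdot> h \<cdot> iv (x 0)" for l
      proof (induction l)
        case (Suc l)
        have "0 < Suc l * (n - 1)" using nz by simp
        then have cm: "x (Suc l * (n - 1)) \<cdot> h = h \<cdot> x (Suc l * (n - 1))"
          unfolding h_def by (rule x_theta_comm)
        have "S (Suc (Suc l)) \<cdot> h \<cdot> iv (S (Suc (Suc l))) =
            S (Suc l) \<cdot> (x (Suc l * (n - 1)) \<cdot> h) \<cdot> iv (x (Suc l * (n - 1))) \<cdot> iv (S (Suc l))"
          unfolding S.simps(2) [of "Suc l"] by (simp add: G.group_word del: S.simps)
        also have "\<dots> = S (Suc l) \<cdot> h \<cdot> iv (S (Suc l))"
          unfolding cm by (simp add: G.m_assoc del: S.simps)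
        finally show ?case using Suc by simp
      qed simp
      then show ?thesis by (simp add: K_def del: S.simps)
    qed
    finally show "(\<theta> \<circ> \<theta>) (x i) = iv (iv (x 0)) \<cdot> \<theta> (x i) \<cdot> iv (x 0)" by (simp add: h_def)
  qed
  then show ?thesis using g(2) by simp
qed

lemma act_S: "1 \<le> t \<Longrightarrow> act (S k) t = t + k * (real n - 1)"
proof (induction k)
  case (Suc k)
  have "real (k * (n - 1)) = k * (real n - 1)" using n1 by (simp add: of_nat_diff)
  then have "real (k * (n - 1)) + 1 \<le> t + k * (real n - 1)" using Suc.prems by linarith
  then have p: "pl n (k * (n - 1)) (t + k * (real n - 1)) = t + k * (real n - 1) + real n - 1"
    by (cases rule: pl_cases [of "t + k * (real n - 1)" "k * (n - 1)" n]) (auto simp: algebra_simps)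
  have "act (S (Suc k)) t = pl n (k * (n - 1)) (act (S k) t)" by (simp add: act_mult act(2))
  also have "\<dots> = t + k * (real n - 1) + real n - 1" using Suc p by simp
  finally show ?case by (simp add: algebra_simps)
qed simp

text \<open>From 1 on, \<open>S k\<close> followed by \<open>x i\<close> and
  \<open>S (Suc k)\<close> are the same translation when \<open>k = Suc i\<close>.\<close>

lemma theta_fixes: "\<theta> ` C \<subseteq> fixes_from 1"
proof (rule image_subset_gen [OF theta(1) subgroup_fixes_from])
  fix i
  have "act (th (Suc i) i) t = t" if t: "1 \<le> t" for t
  proof -
    define u where "u = t + Suc i * (real n - 1)"
    have "real (Suc i) \<le> Suc i * (real n - 1)" using n2 by (simp add: mult_le_cancel_left1)
    then have "real i + 1 \<le> u" using t unfolding u_def of_nat_Suc by linarith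
    then have "pl n i u = u + real n - 1" by (cases rule: pl_cases [of u i n]) (auto simp: algebra_simps)
    then have "act (x i) (act (S (Suc i)) t) = act (S (Suc (Suc i))) t"
      unfolding act_S [OF t] act(2) by (simp add: u_def algebra_simps)
    then show ?thesis unfolding th_def by (simp add: act_mult act_inv2 del: S.simps)
  qed
  then show "\<theta> (x i) \<in> fixes_from 1" by (simp add: theta(2) fixes_from_def)
qed

lemma moves_from:
  assumes "g \<in> C" "\<And>u. 1 \<le> u \<Longrightarrow> 1 < act g u" "k > 0"
  shows "g \<up> (k::nat) \<notin> fixes_from 1"
proof
  assume "g \<up> k \<in> fixes_from 1"
  then have "act (g \<up> k) 1 = 1" by (simp add: fixes_from_def)
  moreover have "act (g \<up> k) 1 \<in> {1<..}"
    by (rule act_pow_mem [of _ _ "{1..}"]) (use assms in auto)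
  ultimately show False by simp
qed

lemma x0_expands: "1 \<le> u \<Longrightarrow> 1 < act (x 0) u"
  using n2 by (cases rule: pl_cases [of u 0 n]) (auto simp: act(2) algebra_simps)

lemma subgroup_theta: "subgroup (\<theta> ` C) (F_inf n)"
  by (rule G.subgroup_homs_image [OF G.subgroup_self G.is_group theta(1)])

lemma theta_low: "i < n - 1 \<Longrightarrow> \<theta> (x i) = x 0 \<cdot> (x i \<cdot> iv (x (n - 1))) \<cdot> iv (x 0)"
  using theta_x [of i 1] by (simp add: th_def G.group_word)

text \<open>By \<open>theta_theta\<close> the stable letter acts on the base as
  \<open>\<theta>\<close> itself. For generation, \<open>theta_low\<close> and \<open>x 0\<close>
  yield \<open>x i\<close> times the inverse of \<open>x (n - 1)\<close> for
  \<open>i < n - 1\<close>; the case \<open>i = 0\<close> yields \<open>x (n - 1)\<close>, and with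
  it the others.\<close>

theorem asc_theta: "asc (F_inf n) C (\<theta> ` C) (iv (x 0))"
proof (rule G.ascI [OF subgroup_theta])
  fix b assume b: "b \<in> \<theta> ` C"
  then have "b \<in> C" using theta_closed by auto
  then show "iv (iv (x 0)) \<cdot> b \<cdot> iv (x 0) \<in> \<theta> ` C" using theta_theta [OF b] by (metis G.inv_inv imageI x_closed)
next
  fix H assume H: "subgroup H (F_inf n)" "\<theta> ` C \<subseteq> H" "iv (x 0) \<in> H"
  have x0: "x 0 \<in> H" using subgroup.m_inv_closed [OF H(1,3)] by simp
  have low: "x i \<cdot> iv (x (n - 1)) \<in> H" if "i < n - 1" for i
  proof -
    have "\<theta> (x i) \<in> H" using H(2) by auto
    then have "iv (x 0) \<cdot> \<theta> (x i) \<cdot> x 0 \<in> H" using H(1,3) x0 by (simp add: subgroup.m_closed)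
    then show ?thesis unfolding theta_low [OF that] by (simp add: G.m_assoc)
  qed
  have "iv (x 0) \<cdot> (x 0 \<cdot> iv (x (n - 1))) \<in> H" by (rule subgroup.m_closed [OF H(1,3) low [OF nz]])
  then have "iv (x (n - 1)) \<in> H" by simp
  then have xn: "x (n - 1) \<in> H" using subgroup.m_inv_closed [OF H(1)] by (metis G.inv_inv x_closed)
  show "C \<subseteq> H"
  proof (rule generated_low [OF H(1)])
    fix i assume "i < n"
    then consider "i < n - 1" | "i = n - 1" by linarith
    then show "x i \<in> H"
    proof cases
      case 1
      have "x i \<cdot> iv (x (n - 1)) \<cdot> x (n - 1) \<in> H" using low [OF 1] xn H(1) by (simp add: subgroup.m_closed)
      then show ?thesis by (simp add: G.m_assoc)
    qed (use xn in simp)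
  qed
next
  fix k :: nat assume k: "k > 0"
  show "iv (x 0) \<up> k \<notin> \<theta> ` C"
  proof
    assume "iv (x 0) \<up> k \<in> \<theta> ` C"
    then have "iv (x 0 \<up> k) \<in> fixes_from 1" using theta_fixes by (auto simp: G.nat_pow_inv)
    then have "x 0 \<up> k \<in> fixes_from 1"
      using subgroup.m_inv_closed [OF subgroup_fixes_from] by fastforce
    then show False using moves_from [OF x_closed x0_expands k] by simp
  qed
qed simp

text \<open>On its image \<open>\<theta>\<close> is a conjugation, hence injective, and
  \<open>asc_inj\<close> applies. After undoing the conjugation by \<open>x 0\<close>, its other
  condition says that no positive power of \<open>w\<close> lies in the image of
  \<open>\<theta>\<close>; indeed \<open>w\<close> maps every point from 1 on to a point beyond
  1.\<close>

theorem inj_theta: "inj_on \<theta> C"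
proof (rule G.asc_inj [OF asc_theta G.is_group theta(1)])
  show "inj_on \<theta> (\<theta> ` C)"
  proof (rule inj_onI)
    fix a b assume ab: "a \<in> \<theta> ` C" "b \<in> \<theta> ` C" "\<theta> a = \<theta> b"
    have "a \<in> C" "b \<in> C" using ab theta_closed by auto
    moreover have "x 0 \<cdot> a \<cdot> iv (x 0) = x 0 \<cdot> b \<cdot> iv (x 0)"
      using ab(3) theta_theta [OF ab(1)] theta_theta [OF ab(2)] by simp
    ultimately show "a = b" by (simp add: G.m_assoc)
  qed
  fix k :: nat assume k: "k > 0"
  define w where "w = x 0 \<cdot> iv (x (n - 1))"
  have w [simp]: "w \<in> C" by (simp add: w_def)
  have t0: "\<theta> (x 0) = x 0 \<cdot> w \<cdot> iv (x 0)" using theta_low [of 0] nz by (simp add: w_def)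
  have pw: "(x 0 \<cdot> w \<cdot> iv (x 0)) \<up> k = x 0 \<cdot> w \<up> k \<cdot> iv (x 0)"
    by (induction k) (simp_all add: G.m_assoc)
  show "\<theta> (iv (x 0)) \<up> k \<notin> \<theta> ` \<theta> ` C"
  proof
    assume "\<theta> (iv (x 0)) \<up> k \<in> \<theta> ` \<theta> ` C"
    then obtain b where b: "b \<in> \<theta> ` C" "\<theta> (iv (x 0)) \<up> k = \<theta> b" by auto
    have bC: "b \<in> C" using b theta_closed by auto
    have "iv (x 0 \<cdot> w \<up> k \<cdot> iv (x 0)) = x 0 \<cdot> b \<cdot> iv (x 0)"
      using b(2) theta_theta [OF b(1)] by (simp add: theta_inv t0 G.nat_pow_inv pw)
    then have "x 0 \<cdot> (iv (w \<up> k) \<cdot> iv (x 0)) = x 0 \<cdot> (b \<cdot> iv (x 0))"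
      using bC by (simp add: G.group_word)
    then have "iv (w \<up> k) = b" using bC by simp
    then have "w \<up> k = iv b" using G.inv_inv [of "w \<up> k"] by simp
    moreover have "iv b \<in> fixes_from 1"
      using b(1) theta_fixes subgroup.m_inv_closed [OF subgroup_fixes_from] by blast
    moreover have "1 < act w u" if u: "1 \<le> u" for u
    proof -
      have "pl n 0 u = u + real n - 1" using u by (cases rule: pl_cases [of u 0 n]) (auto simp: algebra_simps)
      then have a: "act w u = pl_inv n (n - 1) (u + real n - 1)"
        by (simp add: w_def act_mult act(2) act_iv_x)
      have r: "real (n - 1) = real n - 1" using n1 by (simp add: of_nat_diff)
      define v where "v = u / real n"
      have v: "0 < v" "2 \<le> real n" using u n2 by (simp_all add: v_def)
      have "pl_inv n (n - 1) (u + real n - 1) =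
          (if u \<le> 0 then u + real n - 1 else if u \<le> real n then real n - 1 + v else u)"
        unfolding pl_inv_def r v_def by simp
      then show ?thesis unfolding a using u v by auto
    qed
    ultimately show False using moves_from [OF w _ k] by simp
  qed
qed

end

section \<open>Cost of kernels\<close>

subsection \<open>Counting in finite abelian groups\<close>

lemma (in homs_on) int_pow: "a \<in> A \<Longrightarrow> F (a [^] (k::int)) = F a [^]\<^bsub>E\<^esub> k"
proof (cases k rule: int_cases2)
  case (nonneg m)
  assume a: "a \<in> A"
  show ?thesis using pow [OF a, of m] by (simp add: nonneg int_pow_int)
next
  case (nonpos m)
  assume a: "a \<in> A"
  have "F (inv (a [^] m)) = inv\<^bsub>E\<^esub> (F a [^]\<^bsub>E\<^esub> m)" using inv [OF G.pow_mem [OF sub a, of m]] pow [OF a, of m] by simp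
  then show ?thesis using A_carrier [OF a] closed [OF a] by (simp add: nonpos int_pow_int G.int_pow_neg E.int_pow_neg)
qed

context group
begin

lemma card_coset_image:
  assumes Z: "subgroup Z G" and T: "subgroup T G" "finite T" and ZT: "Z \<subseteq> T"
  shows "card Z * card ((\<lambda>q. Z #> q) ` T) \<le> card T"
proof -
  let ?C = "(\<lambda>q. Z #> q) ` T"
  have CR: "?C \<subseteq> rcosets Z"
    using rcosetsI [OF subgroup.subset [OF Z]] subgroup.mem_carrier [OF T(1)] by blast
  have UT: "\<Union>?C \<subseteq> T"
    using ZT subgroup.m_closed [OF T(1)] by (auto simp: r_coset_def)
  have "card Z * card ?C = card (\<Union>?C)"
  proof (rule card_partition)
    show "finite (\<Union>?C)" by (rule finite_subset [OF UT T(2)])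
    show "card c = card Z" if "c \<in> ?C" for c
      using card_rcosets_equal [OF _ subgroup.subset [OF Z]] CR that by (metis subsetD)
    show "c1 \<inter> c2 = {}" if "c1 \<in> ?C" "c2 \<in> ?C" "c1 \<noteq> c2" for c1 c2
      using rcos_disjoint [OF Z] CR that by (auto simp: pairwise_def disjnt_def)
  qed (use T(2) in auto)
  also have "\<dots> \<le> card T" by (rule card_mono [OF T(2) UT])
  finally show ?thesis .
qed

end

lemma (in comm_group) adjoin:
  assumes S: "subgroup S G" "finite S" and s: "s \<in> carrier G" and b: "b > 0" "s [^] (b::nat) \<in> S"
  shows "\<exists>T. subgroup T G \<and> finite T \<and> S \<subseteq> T \<and> s \<in> T \<and> card T \<le> b * card S"
proof -
  note Sc = subgroup.mem_carrier [OF S(1)]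
  define T where "T = {s [^] (k::nat) \<otimes> q | k q. q \<in> S}"
  have TI: "s [^] (k::nat) \<otimes> q \<in> T" if "q \<in> S" for k q using that by (auto simp: T_def)
  have TE: "\<exists>(k::nat). \<exists>q\<in>S. g = s [^] k \<otimes> q" if "g \<in> T" for g using that by (auto simp: T_def)
  have sb: "s [^] (b * k) \<in> S" for k using pow_mem [OF S(1) b(2), of k] s by (simp add: nat_pow_pow)
  have T: "subgroup T G"
  proof (rule subgroupI)
    show "T \<subseteq> carrier G" using Sc s by (auto simp: T_def)
    show "T \<noteq> {}" using subgroup.one_closed [OF S(1)] by (auto simp: T_def)
    fix g assume "g \<in> T"
    then obtain k q where g: "q \<in> S" "g = s [^] (k::nat) \<otimes> q" using TE by blast
    \<comment> \<open>As \<open>b > 0\<close>, the difference is not truncated. Inverses are thus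
      again non-negative powers of \<open>s\<close> times elements of \<open>S\<close>.\<close>
    have "s [^] k \<otimes> s [^] (b * k - k) = s [^] (b * k)" using s b(1) by (simp add: nat_pow_mult)
    then have "inv (s [^] k) \<otimes> (s [^] k \<otimes> s [^] (b * k - k)) \<otimes> inv (s [^] (b * k)) =
        inv (s [^] k) \<otimes> s [^] (b * k) \<otimes> inv (s [^] (b * k))" by simp
    then have "inv (s [^] k) = s [^] (b * k - k) \<otimes> inv (s [^] (b * k))"
      using s by (simp add: m_assoc)
    moreover have "inv g = inv (s [^] k) \<otimes> inv q"
      using g s Sc [OF g(1)] by (simp add: inv_mult_group m_comm)
    ultimately have "inv g = s [^] (b * k - k) \<otimes> (inv (s [^] (b * k)) \<otimes> inv q)"
      using s Sc [OF g(1)] by (simp add: m_assoc)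
    moreover have "inv (s [^] (b * k)) \<otimes> inv q \<in> S"
      using sb g(1) S(1) by (simp add: subgroup.m_closed subgroup.m_inv_closed)
    ultimately show "inv g \<in> T" using TI by simp
    fix h assume "h \<in> T"
    then obtain l r where h: "r \<in> S" "h = s [^] (l::nat) \<otimes> r" using TE by blast
    have "g \<otimes> h = s [^] (k + l) \<otimes> (q \<otimes> r)"
      using g h s Sc [OF g(1)] Sc [OF h(1)] by (simp add: m_ac flip: nat_pow_mult)
    then show "g \<otimes> h \<in> T" using TI subgroup.m_closed [OF S(1) g(1) h(1)] by simp
  qed
  have sub: "T \<subseteq> (\<lambda>(k, q). s [^] (k::nat) \<otimes> q) ` ({..<b} \<times> S)"
  proof
    fix g assume "g \<in> T"
    then obtain k q where g: "q \<in> S" "g = s [^] (k::nat) \<otimes> q" using TE by blast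
    have "s [^] k = s [^] (k mod b) \<otimes> s [^] (b * (k div b))"
      by (simp only: nat_pow_mult [OF s] mod_mult_div_eq)
    then have "g = s [^] (k mod b) \<otimes> (s [^] (b * (k div b)) \<otimes> q)"
      using g s Sc by (simp add: m_assoc)
    moreover have "s [^] (b * (k div b)) \<otimes> q \<in> S" by (rule subgroup.m_closed [OF S(1) sb g(1)])
    ultimately show "g \<in> (\<lambda>(k, q). s [^] (k::nat) \<otimes> q) ` ({..<b} \<times> S)" using b(1) by force
  qed
  have fin: "finite ({..<b} \<times> S)" using S(2) by simp
  have "card T \<le> card ({..<b} \<times> S)" by (rule surj_card_le [OF fin sub])
  then have cT: "card T \<le> b * card S" by (simp add: card_cartesian_product)
  have fT: "finite T" by (rule finite_subset [OF sub]) (use fin in auto)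
  have "S \<subseteq> T"
  proof
    fix q assume q: "q \<in> S"
    then show "q \<in> T" using TI [OF q, of 0] Sc [OF q] by simp
  qed
  moreover have "s \<in> T" using TI [OF subgroup.one_closed [OF S(1)], of 1] s by simp
  ultimately show ?thesis using T fT cT by blast
qed

context thompson
begin

subsection \<open>Kernels of homomorphisms to finite abelian groups\<close>

text \<open>The successor absorbs the summand 1 of \<open>cost_le_kern\<close>, so that the cost of
  a kernel is at most \<open>\<kappa>\<close> times the index.\<close>

definition \<kappa> :: nat where "\<kappa> = Suc (SOME c. cost_le (F_inf n) C c)"

lemma cost_kern:
  assumes "group Q" "\<pi> \<in> homs (F_inf n) C Q" "finite (\<pi> ` C)"
  shows "cost_le (F_inf n) (kern C Q \<pi>) (card (\<pi> ` C) * \<kappa>)"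
  using G.cost_le_kern [OF G.subgroup_self assms someI_ex [OF cost_F]] by (simp add: \<kappa>_def)

lemma phi_pow_image: "(\<phi> ^^ k) ` C \<subseteq> C"
  using phi_pow_closed by auto

lemma homs_shift: "\<pi> \<in> homs (F_inf n) C Q \<Longrightarrow> \<pi> \<circ> \<phi> ^^ k \<in> homs (F_inf n) C Q"
  by (rule G.homs_comp [OF phi_pow(1) phi_pow_image])

lemma image_shift: "(\<pi> \<circ> \<phi> ^^ k) ` C \<subseteq> \<pi> ` C"
  using phi_pow_image [of k] by (auto simp: image_comp)

lemma asc_kern_phi:
  assumes "group Q" "\<pi> \<in> homs (F_inf n) C Q" "finite (\<pi> ` C)"
  shows "\<exists>t. asc (F_inf n) (kern C Q \<pi>) (kern (\<phi> ` C) Q \<pi>) t"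
  using G.asc_kern_ex [OF asc_phi assms] by blast

lemma phi_image: "\<phi> ` C \<subseteq> C"
  using phi_closed by auto

text \<open>The base of the kernel is the \<open>\<phi>\<close>-image of the kernel of
  \<open>\<pi> \<circ> \<phi>\<close>, and isomorphic to it since \<open>\<phi>\<close> is
  injective.\<close>

lemma cost_shift:
  assumes "group Q" "\<pi> \<in> homs (F_inf n) C Q" "finite (\<pi> ` C)" "cost_le (F_inf n) (kern C Q (\<pi> \<circ> \<phi>)) a"
  shows "cost_le (F_inf n) (kern C Q \<pi>) (2 * a + 1)"
proof -
  obtain t where "asc (F_inf n) (kern C Q \<pi>) (kern (\<phi> ` C) Q \<pi>) t" using asc_kern_phi assms by blast
  moreover have "cost_le (F_inf n) (kern (\<phi> ` C) Q \<pi>) a"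
    by (rule G.cost_le_kern_image [OF G.subgroup_self G.is_group phi(1) inj_phi assms(1) homs_mono [OF assms(2) phi_image] assms(4)])
  ultimately show ?thesis by (rule G.asc_cost)
qed

lemma rank_shift:
  assumes "group Q" "\<pi> \<in> homs (F_inf n) C Q" "finite (\<pi> ` C)" "rank_le (F_inf n) (kern C Q (\<pi> \<circ> \<phi>)) a"
  shows "rank_le (F_inf n) (kern C Q \<pi>) (Suc a)"
proof -
  obtain t where "asc (F_inf n) (kern C Q \<pi>) (kern (\<phi> ` C) Q \<pi>) t" using asc_kern_phi assms by blast
  moreover have "rank_le (F_inf n) (kern (\<phi> ` C) Q \<pi>) a"
    by (rule G.rank_le_kern_image [OF G.subgroup_self G.is_group phi(1) assms(1) homs_mono [OF assms(2) phi_image] assms(4)])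
  ultimately show ?thesis by (rule G.asc_rank)
qed

lemma shift_Suc: "\<pi> \<circ> \<phi> ^^ k \<circ> \<phi> = \<pi> \<circ> \<phi> ^^ Suc k"
  by (simp add: comp_assoc funpow_Suc_right del: funpow.simps)

text \<open>Each step replaces \<open>a\<close> by \<open>2 * a + 1\<close>, which doubles
  \<open>a + 1\<close>.\<close>

lemma cost_shift_pow:
  assumes "group Q" "\<pi> \<in> homs (F_inf n) C Q" "finite (\<pi> ` C)" "cost_le (F_inf n) (kern C Q (\<pi> \<circ> \<phi> ^^ k)) a"
  shows "cost_le (F_inf n) (kern C Q \<pi>) (2 ^ k * (a + 1))"
  using assms(4)
proof (induction k arbitrary: a)
  case 0
  then show ?case by (auto intro: cost_le_mono)
next
  case (Suc k)
  have "cost_le (F_inf n) (kern C Q (\<pi> \<circ> \<phi> ^^ k)) (2 * a + 1)"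
    using Suc.prems by (intro cost_shift assms homs_shift finite_subset [OF image_shift assms(3)]) (simp only: shift_Suc)
  from Suc.IH [OF this] show ?case by (simp add: algebra_simps)
qed

lemma rank_shift_pow:
  assumes "group Q" "\<pi> \<in> homs (F_inf n) C Q" "finite (\<pi> ` C)" "rank_le (F_inf n) (kern C Q (\<pi> \<circ> \<phi> ^^ k)) a"
  shows "rank_le (F_inf n) (kern C Q \<pi>) (a + k)"
  using assms(4)
proof (induction k arbitrary: a)
  case (Suc k)
  have "rank_le (F_inf n) (kern C Q (\<pi> \<circ> \<phi> ^^ k)) (Suc a)"
    using Suc.prems by (intro rank_shift assms homs_shift finite_subset [OF image_shift assms(3)]) (simp only: shift_Suc)
  from Suc.IH [OF this] show ?case by simp
qed simp

text \<open>In an abelian quotient the relations force this for \<open>i > 0\<close> only. One shift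
  removes the exception, as \<open>periodic_phi\<close> shows.\<close>

definition periodic :: "(nat word set \<Rightarrow> 'q) \<Rightarrow> bool" where
  "periodic \<pi> \<longleftrightarrow> (\<forall>i. \<pi> (x (i + (n - 1))) = \<pi> (x i))"

lemma periodic_shift: "periodic \<pi> \<Longrightarrow> periodic (\<pi> \<circ> \<phi> ^^ k)"
  unfolding periodic_def
proof
  fix i assume "\<forall>i. \<pi> (x (i + (n - 1))) = \<pi> (x i)"
  from this [rule_format, of "i + k"] show "(\<pi> \<circ> \<phi> ^^ k) (x (i + (n - 1))) = (\<pi> \<circ> \<phi> ^^ k) (x i)"
    by (simp add: phi_pow(2) ac_simps)
qed

lemma periodic_phi:
  assumes "comm_group Q" "\<pi> \<in> homs (F_inf n) C Q"
  shows "periodic (\<pi> \<circ> \<phi>)"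
  unfolding periodic_def
proof
  fix i
  interpret Q: comm_group Q by fact
  interpret \<pi>: homs_on "F_inf n" Q C \<pi> by (rule homs_on_C [OF Q.is_group assms(2)])
  have "x (Suc i) \<cdot> x 0 = x 0 \<cdot> x (Suc i + (n - 1))" using x_rel [of 0 "Suc i"] n1 by simp
  then have "\<pi> (x (Suc i)) \<otimes>\<^bsub>Q\<^esub> \<pi> (x 0) = \<pi> (x 0) \<otimes>\<^bsub>Q\<^esub> \<pi> (x (Suc i + (n - 1)))"
    using \<pi>.mult [OF x_closed x_closed] by metis
  then have "\<pi> (x 0) \<otimes>\<^bsub>Q\<^esub> \<pi> (x (Suc i)) = \<pi> (x 0) \<otimes>\<^bsub>Q\<^esub> \<pi> (x (Suc i + (n - 1)))"
    using Q.m_comm [of "\<pi> (x (Suc i))" "\<pi> (x 0)"] by simp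
  then show "(\<pi> \<circ> \<phi>) (x (i + (n - 1))) = (\<pi> \<circ> \<phi>) (x i)" by (simp add: phi(2))
qed

lemma periodic_mult:
  assumes "periodic \<pi>" shows "\<pi> (x (i + k * (n - 1))) = \<pi> (x i)"
proof (induction k)
  case (Suc k)
  have "\<pi> (x (i + k * (n - 1) + (n - 1))) = \<pi> (x (i + k * (n - 1)))" using assms by (simp add: periodic_def)
  then show ?case using Suc by (simp add: ac_simps)
qed simp

lemma periodic_pow:
  assumes "group Q" "\<pi> \<in> homs (F_inf n) C Q" "periodic \<pi>" "g \<in> C"
  shows "\<pi> ((\<phi> ^^ (k * (n - 1))) g) = \<pi> g"
  using homs_eqI [OF assms(1) homs_shift [OF assms(2)] assms(2) _ assms(4), of "k * (n - 1)"]
    periodic_mult [OF assms(3)] by (simp add: phi_pow(2))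

text \<open>The shift by \<open>2 * (n - 1)\<close> does not change \<open>\<pi>\<close>, and it is
  at least a double shift because \<open>n \<ge> 2\<close>.\<close>

lemma periodic_onto:
  assumes "group Q" "\<pi> \<in> homs (F_inf n) C Q" "periodic \<pi>"
  shows "\<pi> ` \<phi> ` \<phi> ` C = \<pi> ` C"
proof
  show "\<pi> ` \<phi> ` \<phi> ` C \<subseteq> \<pi> ` C" using phi_closed by auto
  show "\<pi> ` C \<subseteq> \<pi> ` \<phi> ` \<phi> ` C"
  proof
    fix q assume "q \<in> \<pi> ` C"
    then obtain g where g: "g \<in> C" "q = \<pi> g" by auto
    have e: "2 * (n - 1) = Suc (Suc (2 * n - 4))" using n2 by simp
    have "(\<phi> ^^ (2 * (n - 1))) g = \<phi> (\<phi> ((\<phi> ^^ (2 * n - 4)) g))" unfolding e by simp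
    then have "q = \<pi> (\<phi> (\<phi> ((\<phi> ^^ (2 * n - 4)) g)))" using periodic_pow [OF assms g(1), of 2] g(2) by simp
    then show "q \<in> \<pi> ` \<phi> ` \<phi> ` C" using phi_pow_closed [OF g(1)] by blast
  qed
qed

section \<open>The direct product of the powers of \<open>c\<close> and the double shift\<close>

lemma c_int: "c \<up> (k::int) \<in> fixes_upto 1 \<Longrightarrow> k = 0"
proof (rule ccontr)
  assume k: "c \<up> k \<in> fixes_upto 1" "k \<noteq> 0"
  show False
  proof (cases k rule: int_cases2)
    case (nonneg m)
    then show ?thesis using k c_moves [of m] by (simp add: int_pow_int)
  next
    case (nonpos m)
    then have "iv (c \<up> m) \<in> fixes_upto 1" using k by (simp add: int_pow_int G.int_pow_neg)
    then have "c \<up> m \<in> fixes_upto 1"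
      using subgroup.m_inv_closed [OF subgroup_fixes_upto, of "iv (c \<up> m)"] by simp
    then show ?thesis using nonpos k c_moves [of m] by simp
  qed
qed

lemma phi_phi_inj: "g \<in> C \<Longrightarrow> h \<in> C \<Longrightarrow> \<phi> (\<phi> g) = \<phi> (\<phi> h) \<Longrightarrow> g = h"
  using inj_phi phi_closed by (metis inj_onD)

lemma phi_mult: "g \<in> C \<Longrightarrow> h \<in> C \<Longrightarrow> \<phi> (g \<cdot> h) = \<phi> g \<cdot> \<phi> h"
  using phi(1) by (simp add: homs_def)

lemma subgroup_phi_phi: "subgroup (\<phi> ` \<phi> ` C) (F_inf n)"
  using G.subgroup_homs_image [OF subgroup_phi G.is_group homs_mono [OF phi(1) phi_image]] .

lemma phi_phi_carrier: "g \<in> \<phi> ` \<phi> ` C \<Longrightarrow> g \<in> C"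
  using phi_closed by auto

definition cD :: "nat word set set" where
  "cD = {c \<up> (k::int) \<cdot> g | k g. g \<in> \<phi> ` \<phi> ` C}"

lemma cD_I: "g \<in> \<phi> ` \<phi> ` C \<Longrightarrow> c \<up> (k::int) \<cdot> g \<in> cD"
  by (auto simp: cD_def)

lemma cD_E:
  assumes "h \<in> cD"
  obtains k :: int and g where "g \<in> \<phi> ` \<phi> ` C" "h = c \<up> k \<cdot> g"
  using assms unfolding cD_def by blast

lemma c_pow_comm: "g \<in> \<phi> ` \<phi> ` C \<Longrightarrow> g \<cdot> c \<up> (k::int) = c \<up> k \<cdot> g"
  using G.int_pow_comm [OF phi_phi_carrier c_closed] c_comm by metis

lemma cD_mult:
  assumes "g \<in> \<phi> ` \<phi> ` C" "h \<in> \<phi> ` \<phi> ` C"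
  shows "(c \<up> (k::int) \<cdot> g) \<cdot> (c \<up> (l::int) \<cdot> h) = c \<up> (k + l) \<cdot> (g \<cdot> h)"
proof -
  note gc = phi_phi_carrier [OF assms(1)] and hc = phi_phi_carrier [OF assms(2)]
  have "(c \<up> k \<cdot> g) \<cdot> (c \<up> l \<cdot> h) = c \<up> k \<cdot> (g \<cdot> c \<up> l) \<cdot> h"
    using gc hc by (simp add: G.m_assoc)
  also have "\<dots> = (c \<up> k \<cdot> c \<up> l) \<cdot> (g \<cdot> h)"
    unfolding c_pow_comm [OF assms(1)] using gc hc by (simp add: G.m_assoc)
  finally show ?thesis by (simp add: G.int_pow_mult)
qed

lemma cD_inv:
  assumes "g \<in> \<phi> ` \<phi> ` C"
  shows "iv (c \<up> (k::int) \<cdot> g) = c \<up> (- k) \<cdot> iv g"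
proof -
  have "iv g \<in> \<phi> ` \<phi> ` C" by (rule subgroup.m_inv_closed [OF subgroup_phi_phi assms])
  from c_pow_comm [OF this, of "- k"] show ?thesis
    using phi_phi_carrier [OF assms] by (simp add: G.inv_mult_group G.int_pow_neg)
qed

lemma subgroup_cD: "subgroup cD (F_inf n)"
proof (rule G.subgroupI)
  show "cD \<subseteq> C" using phi_phi_carrier by (auto simp: cD_def)
  show "cD \<noteq> {}" using cD_I [OF subgroup.one_closed [OF subgroup_phi_phi]] by blast
  fix a assume "a \<in> cD"
  then obtain k g where g: "g \<in> \<phi> ` \<phi> ` C" "a = c \<up> (k::int) \<cdot> g" by (rule cD_E)
  then show "iv a \<in> cD" using cD_I cD_inv subgroup.m_inv_closed [OF subgroup_phi_phi g(1)] by simp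
  fix b assume "b \<in> cD"
  then obtain l h where h: "h \<in> \<phi> ` \<phi> ` C" "b = c \<up> (l::int) \<cdot> h" by (rule cD_E)
  then show "a \<cdot> b \<in> cD"
    unfolding g(2) h(2) cD_mult [OF g(1) h(1)]
    by (intro cD_I subgroup.m_closed [OF subgroup_phi_phi g(1) h(1)])
qed

lemma cD_unique:
  assumes "g \<in> \<phi> ` \<phi> ` C" "h \<in> \<phi> ` \<phi> ` C"
    "c \<up> (k::int) \<cdot> g = c \<up> (l::int) \<cdot> h"
  shows "k = l" "g = h"
proof -
  note gc = phi_phi_carrier [OF assms(1)] and hc = phi_phi_carrier [OF assms(2)]
  have "iv (c \<up> l) \<cdot> (c \<up> k \<cdot> g) \<cdot> iv g = iv (c \<up> l) \<cdot> (c \<up> l \<cdot> h) \<cdot> iv g"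
    using assms(3) by simp
  then have "iv (c \<up> l) \<cdot> c \<up> k = h \<cdot> iv g"
    using gc hc by (simp add: G.m_assoc)
  moreover have "c \<up> (- l + k) = iv (c \<up> l) \<cdot> c \<up> k"
    using G.int_pow_mult [OF c_closed, of "- l" k] G.int_pow_neg [OF c_closed, of l] by simp
  ultimately have "c \<up> (- l + k) = h \<cdot> iv g" by simp
  moreover have "h \<cdot> iv g \<in> \<phi> ` \<phi> ` C"
    by (intro subgroup.m_closed [OF subgroup_phi_phi assms(2)] subgroup.m_inv_closed [OF subgroup_phi_phi assms(1)])
  moreover have "\<phi> ` \<phi> ` C \<subseteq> fixes_upto 1" using phi_fixes(1) phi_image by blast
  ultimately have "c \<up> (- l + k) \<in> fixes_upto 1" by (metis subsetD)
  then have "- l + k = 0" by (rule c_int)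
  then show kl: "k = l" by simp
  show "g = h" using assms(3) gc hc unfolding kl by simp
qed

text \<open>The part of the kernel inside \<open>\<langle>c\<rangle> \<times> \<phi>\<^sup>2(F)\<close> is a central extension, by a power of \<open>c\<close>, of a
  subgroup of small index.\<close>

lemma cost_cD:
  assumes Q: "comm_group Q" and \<pi>: "\<pi> \<in> homs (F_inf n) C Q" and fin: "finite (\<pi> ` C)"
    and ord: "m > 0" "\<And>k::nat. \<pi> c [^]\<^bsub>Q\<^esub> k = \<one>\<^bsub>Q\<^esub> \<longleftrightarrow> m dvd k"
  shows "\<exists>r. cost_le (F_inf n) (kern C Q \<pi> \<inter> cD) (2 * r * \<kappa> + 1) \<and> m * r \<le> card (\<pi> ` C)"
proof -
  interpret Q: comm_group Q by fact
  interpret \<pi>: homs_on "F_inf n" Q C \<pi> by (rule homs_on_C [OF Q.is_group \<pi>])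
  define s where "s = \<pi> c"
  have s [simp]: "s \<in> carrier Q" by (simp add: s_def)
  define Z where "Z = range (\<lambda>k::int. s [^]\<^bsub>Q\<^esub> k)"
  have \<pi>C: "subgroup (\<pi> ` C) Q" by (rule G.subgroup_homs_image [OF G.subgroup_self Q.is_group \<pi>])
  have ZI: "s [^]\<^bsub>Q\<^esub> (k::int) \<in> Z" for k by (simp add: Z_def)
  have Z: "subgroup Z Q"
  proof (rule Q.subgroupI)
    fix a b assume "a \<in> Z" "b \<in> Z"
    then obtain k l where "a = s [^]\<^bsub>Q\<^esub> (k::int)" "b = s [^]\<^bsub>Q\<^esub> (l::int)" by (auto simp: Z_def)
    then have "a \<otimes>\<^bsub>Q\<^esub> b = s [^]\<^bsub>Q\<^esub> (k + l)" by (simp add: Q.int_pow_mult)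
    then show "a \<otimes>\<^bsub>Q\<^esub> b \<in> Z" using ZI by simp
  next
    fix a assume "a \<in> Z"
    then obtain k where "a = s [^]\<^bsub>Q\<^esub> (k::int)" by (auto simp: Z_def)
    then have "inv\<^bsub>Q\<^esub> a = s [^]\<^bsub>Q\<^esub> (- k)" by (simp add: Q.int_pow_neg)
    then show "inv\<^bsub>Q\<^esub> a \<in> Z" using ZI by simp
  qed (auto simp: Z_def)
  have ZT: "Z \<subseteq> \<pi> ` C"
    using Q.int_pow_mem [OF \<pi>C, of s] by (auto simp: Z_def s_def)
  have pow_int: "s [^]\<^bsub>Q\<^esub> (k::int) = \<one>\<^bsub>Q\<^esub> \<Longrightarrow> int m dvd k" for k
  proof (cases k rule: int_cases2)
    case (nonneg j)
    assume "s [^]\<^bsub>Q\<^esub> k = \<one>\<^bsub>Q\<^esub>"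
    then show ?thesis using ord(2) [of j] by (simp add: nonneg int_pow_int s_def)
  next
    case (nonpos j)
    assume "s [^]\<^bsub>Q\<^esub> k = \<one>\<^bsub>Q\<^esub>"
    then have "inv\<^bsub>Q\<^esub> (s [^]\<^bsub>Q\<^esub> j) = \<one>\<^bsub>Q\<^esub>" by (simp add: nonpos int_pow_int Q.int_pow_neg)
    then have "s [^]\<^bsub>Q\<^esub> j = \<one>\<^bsub>Q\<^esub>" using Q.inv_eq_1_iff [of "s [^]\<^bsub>Q\<^esub> j"] by simp
    then show ?thesis using ord(2) [of j] by (simp add: nonpos s_def)
  qed
  have cardZ: "m \<le> card Z"
  proof -
    have "inj_on (\<lambda>k::nat. s [^]\<^bsub>Q\<^esub> int k) {..<m}"
    proof (rule inj_onI)
      fix k l assume kl: "k \<in> {..<m}" "l \<in> {..<m}" "s [^]\<^bsub>Q\<^esub> int k = s [^]\<^bsub>Q\<^esub> int l"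
      have "s [^]\<^bsub>Q\<^esub> (int k - int l) = s [^]\<^bsub>Q\<^esub> int k \<otimes>\<^bsub>Q\<^esub> inv\<^bsub>Q\<^esub> (s [^]\<^bsub>Q\<^esub> int l)"
        by (rule Q.int_pow_diff [OF s])
      also have "\<dots> = \<one>\<^bsub>Q\<^esub>" unfolding kl(3) by simp
      finally have "int m dvd int k - int l" by (rule pow_int)
      moreover have "\<bar>int k - int l\<bar> < int m" using kl(1,2) by auto
      ultimately have "int k - int l = 0" using zdvd_not_zless [of "\<bar>int k - int l\<bar>" "int m"] by auto
      then show "k = l" by simp
    qed
    then have "card {..<m} \<le> card Z"
      by (rule card_inj_on_le) (use ZI finite_subset [OF ZT fin] in auto)
    then show ?thesis by simp
  qed
  let ?Q' = "Q Mod Z"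
  interpret NZ: normal Z Q by (rule Q.subgroup_imp_normal [OF Z])
  have Q': "group ?Q'" by (rule NZ.factorgroup_is_group)
  define q where "q = (\<lambda>a. Z #>\<^bsub>Q\<^esub> a)"
  have q: "q \<in> homs Q (carrier Q) ?Q'" unfolding homs_carrier q_def by (rule NZ.r_coset_hom_Mod)
  \<comment> \<open>Its kernel \<open>D0\<close> consists of the \<open>d\<close> whose double shift
    is killed by \<open>\<pi>\<close> after multiplication by a suitable power of \<open>c\<close>.
    This is the projection of \<open>P\<close> to the second factor.\<close>
  define \<rho> where "\<rho> = q \<circ> (\<pi> \<circ> \<phi> ^^ 2)"
  have \<rho>: "\<rho> \<in> homs (F_inf n) C ?Q'"
    unfolding \<rho>_def by (rule G.homs_comp [OF homs_shift [OF \<pi>] _ q]) (use phi_pow_closed in auto)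
  have \<rho>v: "\<rho> g = q (\<pi> (\<phi> (\<phi> g)))" for g by (simp add: \<rho>_def numeral_2_eq_2)
  have \<rho>im: "\<rho> ` C \<subseteq> q ` \<pi> ` C" using phi_closed by (auto simp: \<rho>v)
  \<comment> \<open>The index of \<open>D0\<close>. Factoring out the powers of
    \<open>\<pi> c\<close>, at least \<open>m\<close> of them, is what brings it down to at most the
    full index divided by \<open>m\<close>.\<close>
  define r where "r = card (\<rho> ` C)"
  have fq: "finite (q ` \<pi> ` C)" using fin by simp
  have "card Z * card (q ` \<pi> ` C) \<le> card (\<pi> ` C)" unfolding q_def by (rule Q.card_coset_image [OF Z \<pi>C fin ZT])
  moreover have "r \<le> card (q ` \<pi> ` C)" unfolding r_def by (rule card_mono [OF fq \<rho>im])
  ultimately have mr: "m * r \<le> card (\<pi> ` C)" using cardZ by (meson le_trans mult_le_mono)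
  define D0 where "D0 = kern C ?Q' \<rho>"
  have D0: "D0 = {g \<in> C. \<pi> (\<phi> (\<phi> g)) \<in> Z}"
  proof -
    have "q a = Z \<longleftrightarrow> a \<in> Z" if "a \<in> carrier Q" for a
      unfolding q_def using Q.coset_join1 [OF _ that Z] Q.coset_join2 [OF that Z] by blast
    then have "\<rho> g = \<one>\<^bsub>?Q'\<^esub> \<longleftrightarrow> \<pi> (\<phi> (\<phi> g)) \<in> Z" if "g \<in> C" for g
      using phi_closed [OF phi_closed [OF that]] by (simp only: \<rho>v one_FactGroup \<pi>.closed)
    then show ?thesis unfolding D0_def kern_def by blast
  qed
  have costD0: "cost_le (F_inf n) D0 (r * \<kappa>)"
    unfolding D0_def r_def by (rule cost_kern [OF Q' \<rho> finite_subset [OF \<rho>im fq]])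
  define P where "P = kern C Q \<pi> \<inter> cD"
  have K: "subgroup (kern C Q \<pi>) (F_inf n)" by (rule G.subgroup_kern [OF G.subgroup_self Q.is_group \<pi>])
  have P: "subgroup P (F_inf n)" unfolding P_def by (rule G.subgroups_Inter_pair [OF K subgroup_cD])
  \<comment> \<open>The projection to the second factor with the double shift undone;
    \<open>cD_unique\<close> and the injectivity of \<open>\<phi>\<close> make it
    single-valued.\<close>
  define f where "f h = (THE d. d \<in> C \<and> (\<exists>k::int. h = c \<up> k \<cdot> \<phi> (\<phi> d)))" for h
  have f: "f (c \<up> (k::int) \<cdot> \<phi> (\<phi> d)) = d" if d: "d \<in> C" for k d
    unfolding f_def
  proof (rule the_equality)
    show "d \<in> C \<and> (\<exists>k'. c \<up> k \<cdot> \<phi> (\<phi> d) = c \<up> (k'::int) \<cdot> \<phi> (\<phi> d))" using d by blast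
    fix d' assume d': "d' \<in> C \<and> (\<exists>k'. c \<up> k \<cdot> \<phi> (\<phi> d) = c \<up> (k'::int) \<cdot> \<phi> (\<phi> d'))"
    then obtain k' where e: "c \<up> k \<cdot> \<phi> (\<phi> d) = c \<up> (k'::int) \<cdot> \<phi> (\<phi> d')" by blast
    have "\<phi> (\<phi> d) = \<phi> (\<phi> d')" by (rule cD_unique(2) [OF _ _ e]) (use d d' in blast)+
    then show "d' = d" using phi_phi_inj d d' by metis
  qed
  have PE: "\<exists>k d. d \<in> C \<and> h = c \<up> (k::int) \<cdot> \<phi> (\<phi> d) \<and> s [^]\<^bsub>Q\<^esub> k \<otimes>\<^bsub>Q\<^esub> \<pi> (\<phi> (\<phi> d)) = \<one>\<^bsub>Q\<^esub>" if h: "h \<in> P" for h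
  proof -
    have hD: "h \<in> cD" and hp: "\<pi> h = \<one>\<^bsub>Q\<^esub>" using h by (auto simp: P_def kern_def)
    obtain k g where g: "g \<in> \<phi> ` \<phi> ` C" "h = c \<up> (k::int) \<cdot> g" using hD by (rule cD_E)
    obtain d where d: "d \<in> C" "g = \<phi> (\<phi> d)" using g(1) by auto
    have "\<pi> h = s [^]\<^bsub>Q\<^esub> k \<otimes>\<^bsub>Q\<^esub> \<pi> (\<phi> (\<phi> d))"
      unfolding g(2) d(2) s_def using \<pi>.mult [of "c \<up> k" "\<phi> (\<phi> d)"] \<pi>.int_pow [OF c_closed, of k] d(1) phi_closed by simp
    then show ?thesis using g(2) d hp by metis
  qed
  have PI: "c \<up> (k::int) \<cdot> \<phi> (\<phi> d) \<in> P"
    if d: "d \<in> C" and e: "s [^]\<^bsub>Q\<^esub> k \<otimes>\<^bsub>Q\<^esub> \<pi> (\<phi> (\<phi> d)) = \<one>\<^bsub>Q\<^esub>" for k d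
  proof -
    have "\<pi> (c \<up> k \<cdot> \<phi> (\<phi> d)) = s [^]\<^bsub>Q\<^esub> k \<otimes>\<^bsub>Q\<^esub> \<pi> (\<phi> (\<phi> d))"
      unfolding s_def using \<pi>.mult [of "c \<up> k" "\<phi> (\<phi> d)"] \<pi>.int_pow [OF c_closed, of k] d(1) phi_closed by simp
    then show ?thesis unfolding P_def kern_def using e cD_I [of "\<phi> (\<phi> d)" k] d phi_closed by simp
  qed
  have one2: "\<phi> (\<phi> e1) = e1" using homs_on.one [OF homs_on_C [OF G.is_group phi(1)]] by simp
  \<comment> \<open>The projection kills exactly those powers of \<open>c\<close> that
    \<open>\<pi>\<close> kills, hence the powers of \<open>z\<close>.\<close>
  define z where "z = c \<up> (int m)"
  have sm: "s [^]\<^bsub>Q\<^esub> int m = \<one>\<^bsub>Q\<^esub>" using ord(2) [of m] by (simp add: int_pow_int s_def)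
  have zP: "z \<in> P" using PI [of e1 "int m"] sm by (simp add: z_def one2)
  have zc: "z \<in> C" by (simp add: z_def)
  have fz: "f z = e1" using f [of e1 "int m"] by (simp add: z_def one2)
  have fh: "f \<in> homs (F_inf n) P (F_inf n)"
  proof -
    have "f a \<in> C" if "a \<in> P" for a using PE [OF that] f by force
    moreover have "f (a \<cdot> b) = f a \<cdot> f b" if "a \<in> P" "b \<in> P" for a b
    proof -
      obtain k d where d: "d \<in> C" "a = c \<up> (k::int) \<cdot> \<phi> (\<phi> d)" using PE [OF \<open>a \<in> P\<close>] by blast
      obtain k' d' where d': "d' \<in> C" "b = c \<up> (k'::int) \<cdot> \<phi> (\<phi> d')" using PE [OF \<open>b \<in> P\<close>] by blast
      have "a \<cdot> b = c \<up> (k + k') \<cdot> (\<phi> (\<phi> d) \<cdot> \<phi> (\<phi> d'))"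
        unfolding d(2) d'(2) by (rule cD_mult) (use d d' in blast)+
      also have "\<phi> (\<phi> d) \<cdot> \<phi> (\<phi> d') = \<phi> (\<phi> (d \<cdot> d'))" using d d' phi_closed by (simp add: phi_mult)
      finally show ?thesis using f d d' by simp
    qed
    ultimately show ?thesis by (auto simp: homs_def)
  qed
  have fP: "f ` P = D0"
  proof
    show "f ` P \<subseteq> D0"
    proof
      fix d0 assume "d0 \<in> f ` P"
      then obtain h where h: "h \<in> P" "d0 = f h" by auto
      obtain k d where d: "d \<in> C" "h = c \<up> (k::int) \<cdot> \<phi> (\<phi> d)"
        "s [^]\<^bsub>Q\<^esub> k \<otimes>\<^bsub>Q\<^esub> \<pi> (\<phi> (\<phi> d)) = \<one>\<^bsub>Q\<^esub>" using PE [OF h(1)] by blast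
      have pc: "\<pi> (\<phi> (\<phi> d)) \<in> carrier Q" using d(1) phi_closed by simp
      have "s [^]\<^bsub>Q\<^esub> (- k) \<otimes>\<^bsub>Q\<^esub> (s [^]\<^bsub>Q\<^esub> k \<otimes>\<^bsub>Q\<^esub> \<pi> (\<phi> (\<phi> d))) = s [^]\<^bsub>Q\<^esub> (- k)" unfolding d(3) by simp
      then have "\<pi> (\<phi> (\<phi> d)) = s [^]\<^bsub>Q\<^esub> (- k)" using pc by (simp add: Q.int_pow_neg)
      then show "d0 \<in> D0" unfolding D0 h(2) d(2) f [OF d(1)] using d(1) ZI by simp
    qed
    show "D0 \<subseteq> f ` P"
    proof
      fix d assume "d \<in> D0"
      then have d: "d \<in> C" "\<pi> (\<phi> (\<phi> d)) \<in> Z" by (auto simp: D0)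
      then obtain k where k: "\<pi> (\<phi> (\<phi> d)) = s [^]\<^bsub>Q\<^esub> (k::int)" by (auto simp: Z_def)
      have "s [^]\<^bsub>Q\<^esub> (- k) \<otimes>\<^bsub>Q\<^esub> \<pi> (\<phi> (\<phi> d)) = \<one>\<^bsub>Q\<^esub>" unfolding k by (simp add: Q.int_pow_neg)
      from PI [OF d(1) this] f [OF d(1), of "- k"] show "d \<in> f ` P" by force
    qed
  qed
  have cz: "a \<cdot> z = z \<cdot> a" if a: "a \<in> P" for a
  proof -
    obtain k d where d: "d \<in> C" "a = c \<up> (k::int) \<cdot> \<phi> (\<phi> d)" using PE [OF a] by blast
    have dd: "\<phi> (\<phi> d) \<in> \<phi> ` \<phi> ` C" "e1 \<in> \<phi> ` \<phi> ` C"
      using d subgroup.one_closed [OF subgroup_phi_phi] by auto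
    have dc: "\<phi> (\<phi> d) \<in> C" using d phi_closed by simp
    have z: "z = c \<up> (int m) \<cdot> e1" by (simp add: z_def)
    show ?thesis unfolding d(2) z cD_mult [OF dd] cD_mult [OF dd(2,1)] using dc by (simp add: add.commute)
  qed
  have "cost_le (F_inf n) P (2 * (r * \<kappa>) + 1)"
  proof (rule G.central_cost [OF P zP cz G.is_group fh fz])
    fix a assume a: "a \<in> P" "f a = e1"
    obtain k d where d: "d \<in> C" "a = c \<up> (k::int) \<cdot> \<phi> (\<phi> d)"
      "s [^]\<^bsub>Q\<^esub> k \<otimes>\<^bsub>Q\<^esub> \<pi> (\<phi> (\<phi> d)) = \<one>\<^bsub>Q\<^esub>" using PE [OF a(1)] by blast
    have d1: "d = e1" using f [OF d(1), of k] a(2) d(2) by simp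
    have "s [^]\<^bsub>Q\<^esub> k = \<one>\<^bsub>Q\<^esub>" using d(3) by (simp add: d1 one2)
    then obtain l where l: "k = int m * l" using pow_int by (auto elim!: dvdE)
    have "a = z \<up> l" unfolding d(2) d1 one2 z_def l by (simp add: G.int_pow_pow)
    then show "\<exists>k::int. a = z \<up> k" ..
  next
    fix k :: int assume "z \<up> k = e1"
    then have "c \<up> (int m * k) = e1" by (simp add: z_def G.int_pow_pow)
    then have "c \<up> (int m * k) \<in> fixes_upto 1"
      using subgroup.one_closed [OF subgroup_fixes_upto] by simp
    then have "int m * k = 0" by (rule c_int)
    then show "k = 0" using ord(1) by simp
  next
    show "cost_le (F_inf n) (f ` P) (r * \<kappa>)" unfolding fP by (rule costD0)
  qed
  then show ?thesis using mr by (auto simp: P_def mult.assoc)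
qed

text \<open>By \<open>periodic_onto\<close>, \<open>\<pi>\<close> takes all its values on the double
  shift, so \<open>c\<close> and \<open>x 1\<close> can be corrected by elements of it to
  \<open>p\<close> and \<open>t\<close> in the kernel. As \<open>x 0\<close> is
  \<open>c \<cdot> x 1\<close>, the kernel becomes a tower with stable letters \<open>t\<close> and
  \<open>p \<cdot> t\<close>, as in \<open>double_asc_cost\<close>.\<close>

theorem cost_c:
  assumes Q: "comm_group Q" and \<pi>: "\<pi> \<in> homs (F_inf n) C Q" and fin: "finite (\<pi> ` C)" and per: "periodic \<pi>"
    and ord: "m > 0" "\<And>k::nat. \<pi> c [^]\<^bsub>Q\<^esub> k = \<one>\<^bsub>Q\<^esub> \<longleftrightarrow> m dvd k"
  shows "\<exists>r. cost_le (F_inf n) (kern C Q \<pi>) (4 * \<kappa> * r + 2 * n + 2) \<and> m * r \<le> card (\<pi> ` C)"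
proof -
  interpret Q: comm_group Q by fact
  interpret \<pi>: homs_on "F_inf n" Q C \<pi> by (rule homs_on_C [OF Q.is_group \<pi>])
  obtain r where r: "cost_le (F_inf n) (kern C Q \<pi> \<inter> cD) (2 * r * \<kappa> + 1)" "m * r \<le> card (\<pi> ` C)"
    using cost_cD [OF Q \<pi> fin ord] by blast
  define K B D P where "K = kern C Q \<pi>" and "B = kern (\<phi> ` C) Q \<pi>" and "D = kern (\<phi> ` \<phi> ` C) Q \<pi>" and "P = K \<inter> cD"
  have onto: "\<pi> ` \<phi> ` \<phi> ` C = \<pi> ` C" by (rule periodic_onto [OF Q.is_group \<pi> per])
  have \<pi>C: "subgroup (\<pi> ` C) Q" by (rule G.subgroup_homs_image [OF G.subgroup_self Q.is_group \<pi>])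
  have ex: "\<exists>g\<in>\<phi> ` \<phi> ` C. \<pi> (u \<cdot> g) = \<one>\<^bsub>Q\<^esub>" if u: "u \<in> C" for u
  proof -
    have "inv\<^bsub>Q\<^esub> (\<pi> u) \<in> \<pi> ` \<phi> ` \<phi> ` C" unfolding onto using subgroup.m_inv_closed [OF \<pi>C] u by blast
    then obtain g where g: "inv\<^bsub>Q\<^esub> (\<pi> u) = \<pi> g" "g \<in> \<phi> ` \<phi> ` C" by (rule imageE)
    have "\<pi> (u \<cdot> g) = \<one>\<^bsub>Q\<^esub>" using \<pi>.mult [OF u phi_phi_carrier [OF g(2)]] u by (simp flip: g(1))
    then show ?thesis using g(2) by blast
  qed
  obtain g where g: "g \<in> \<phi> ` \<phi> ` C" "\<pi> (x 1 \<cdot> g) = \<one>\<^bsub>Q\<^esub>" using ex [of "x 1"] by auto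
  obtain g' where g': "g' \<in> \<phi> ` \<phi> ` C" "\<pi> (c \<cdot> g') = \<one>\<^bsub>Q\<^esub>" using ex [of c] by auto
  have gC: "g \<in> C" "g' \<in> C" using g(1) g'(1) phi_phi_carrier by auto
  define t p where "t = x 1 \<cdot> g" and "p = c \<cdot> g'"
  have tC: "t \<in> C" and pC: "p \<in> C" using gC by (auto simp: t_def p_def)
  \<comment> \<open>Exponent 1 is available because the image of \<open>x 1\<close> is already
    attained on the base.\<close>
  have BD: "asc (F_inf n) B D t"
    using G.asc_kern [OF asc_phi_phi Q.is_group homs_mono [OF \<pi> phi_image] g(1), of 1] g(2) gC
    by (simp add: B_def D_def t_def)
  have g0: "iv (x 1) \<cdot> g' \<cdot> x 1 \<cdot> g \<in> \<phi> ` C"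
  proof -
    have "iv (x 1) \<cdot> g' \<cdot> x 1 \<in> \<phi> ` \<phi> ` C" by (rule ascD(5) [OF asc_phi_phi g'(1)])
    then have "iv (x 1) \<cdot> g' \<cdot> x 1 \<cdot> g \<in> \<phi> ` \<phi> ` C" by (rule subgroup.m_closed [OF subgroup_phi_phi _ g(1)])
    then show ?thesis using phi_image by blast
  qed
  \<comment> \<open>Moving \<open>g'\<close> past \<open>x 1\<close> and using
    \<open>c \<cdot> x 1 = x 0\<close> gives \<open>x 0\<close> times an element of the shifted
    copy, the form that \<open>asc_kern\<close> expects.\<close>
  have pt: "p \<cdot> t = x 0 \<cdot> (iv (x 1) \<cdot> g' \<cdot> x 1 \<cdot> g)" using gC by (simp add: p_def t_def c_def G.m_assoc)
  have \<pi>pt: "\<pi> (p \<cdot> t) = \<one>\<^bsub>Q\<^esub>" using \<pi>.mult [OF pC tC] g(2) g'(2) by (simp add: p_def t_def)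
  have KB: "asc (F_inf n) K B (p \<cdot> t)"
    using G.asc_kern [OF asc_phi Q.is_group \<pi> g0, of 1] \<pi>pt unfolding pt by (simp add: K_def B_def)
  have K: "subgroup K (F_inf n)" unfolding K_def by (rule G.subgroup_kern [OF G.subgroup_self Q.is_group \<pi>])
  have P: "subgroup P (F_inf n)" unfolding P_def by (rule G.subgroups_Inter_pair [OF K subgroup_cD])
  have ppC: "\<phi> ` \<phi> ` C \<subseteq> cD"
  proof
    fix h assume h: "h \<in> \<phi> ` \<phi> ` C"
    then show "h \<in> cD" using cD_I [OF h, of 0] phi_phi_carrier [OF h] by simp
  qed
  have DK: "D = K \<inter> \<phi> ` \<phi> ` C" using phi_phi_carrier by (auto simp: D_def K_def kern_def)
  have DP: "D \<subseteq> P" using ppC by (auto simp: DK P_def)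
  have p_int: "p = c \<up> (1::int) \<cdot> g'" by (simp add: p_def G.int_pow_1)
  have pK: "p \<in> K" using pC g'(2) by (simp add: K_def kern_def p_def)
  have pP: "p \<in> P" using pK cD_I [OF g'(1), of 1] by (simp add: P_def p_int)
  have D: "subgroup D (F_inf n)" unfolding DK by (rule G.subgroups_Inter_pair [OF K subgroup_phi_phi])
  have conj: "iv p \<cdot> d \<cdot> p \<in> D" if d: "d \<in> D" for d
  proof -
    have dK: "d \<in> K" "d \<in> \<phi> ` \<phi> ` C" using d by (auto simp: DK)
    have dC: "d \<in> C" by (rule phi_phi_carrier [OF dK(2)])
    have "iv p \<cdot> d \<cdot> p \<in> K" using dK pK K by (simp add: subgroup.m_closed subgroup.m_inv_closed)
    moreover have "iv p \<cdot> d \<cdot> p = iv g' \<cdot> (iv c \<cdot> (d \<cdot> c)) \<cdot> g'" using gC dC by (simp add: p_def G.group_word)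
    then have "iv p \<cdot> d \<cdot> p = iv g' \<cdot> d \<cdot> g'" unfolding c_comm [OF dK(2), symmetric] using gC dC by simp
    then have "iv p \<cdot> d \<cdot> p \<in> \<phi> ` \<phi> ` C"
      using g'(1) dK(2) subgroup_phi_phi by (simp add: subgroup.m_closed subgroup.m_inv_closed)
    ultimately show ?thesis by (simp add: DK)
  qed
  have p_pow: "\<exists>h\<in>\<phi> ` \<phi> ` C. p \<up> (k::nat) = c \<up> int k \<cdot> h" for k
  proof (induction k)
    case 0
    then show ?case using subgroup.one_closed [OF subgroup_phi_phi] by (intro bexI [of _ e1]) auto
  next
    case (Suc k)
    then obtain h where h: "h \<in> \<phi> ` \<phi> ` C" "p \<up> k = c \<up> int k \<cdot> h" by blast
    have "p \<up> Suc k = (c \<up> int k \<cdot> h) \<cdot> (c \<up> (1::int) \<cdot> g')"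
      using h(2) p_int by simp
    also have "\<dots> = c \<up> (int k + 1) \<cdot> (h \<cdot> g')" by (rule cD_mult [OF h(1) g'(1)])
    finally have "p \<up> Suc k = c \<up> int (Suc k) \<cdot> (h \<cdot> g')" by (simp add: add.commute)
    then show ?case using subgroup.m_closed [OF subgroup_phi_phi h(1) g'(1)] by blast
  qed
  \<comment> \<open>If \<open>k\<close> is the exponent of \<open>c\<close> in \<open>h\<close>,
    splitting off the \<open>k\<close>-th power of \<open>p\<close> leaves an element of
    \<open>D\<close>. For positive \<open>k\<close> the power stands on the left, for negative
    \<open>k\<close> on the right.\<close>
  have rep: "\<exists>(i::nat) (j::nat). \<exists>d\<in>D. h = p \<up> i \<cdot> d \<cdot> iv (p \<up> j)" if h: "h \<in> P" for h
  proof -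
    have hK: "h \<in> K" and hD: "h \<in> cD" using h by (auto simp: P_def)
    have hC: "h \<in> C" using hK by (simp add: K_def kern_def)
    obtain k u where u: "u \<in> \<phi> ` \<phi> ` C" "h = c \<up> (k::int) \<cdot> u" using hD by (rule cD_E)
    have pkK: "p \<up> j \<in> K" for j :: nat by (rule G.pow_mem [OF K pK])
    show ?thesis
    proof (cases k rule: int_cases2)
      case (nonneg i)
      obtain v where v: "v \<in> \<phi> ` \<phi> ` C" "p \<up> i = c \<up> int i \<cdot> v" using p_pow by blast
      define d where "d = iv (p \<up> i) \<cdot> h"
      have "d = c \<up> (- int i) \<cdot> iv v \<cdot> (c \<up> int i \<cdot> u)"
        unfolding d_def v(2) cD_inv [OF v(1)] u(2) nonneg ..
      also have "\<dots> = c \<up> (- int i + int i) \<cdot> (iv v \<cdot> u)"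
        by (rule cD_mult [OF subgroup.m_inv_closed [OF subgroup_phi_phi v(1)] u(1)])
      finally have "d = iv v \<cdot> u" using phi_phi_carrier [OF v(1)] phi_phi_carrier [OF u(1)] by simp
      then have "d \<in> \<phi> ` \<phi> ` C" using subgroup.m_closed [OF subgroup_phi_phi subgroup.m_inv_closed [OF subgroup_phi_phi v(1)] u(1)] by simp
      moreover have "d \<in> K" unfolding d_def using pkK hK K by (simp add: subgroup.m_closed subgroup.m_inv_closed)
      ultimately have "d \<in> D" by (simp add: DK)
      moreover have "h = p \<up> i \<cdot> d \<cdot> iv (p \<up> (0::nat))" using hC pC by (simp add: d_def)
      ultimately show ?thesis by blast
    next
      case (nonpos j)
      obtain v where v: "v \<in> \<phi> ` \<phi> ` C" "p \<up> j = c \<up> int j \<cdot> v" using p_pow by blast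
      define d where "d = h \<cdot> p \<up> j"
      have "d = c \<up> (- int j) \<cdot> u \<cdot> (c \<up> int j \<cdot> v)"
        unfolding d_def v(2) u(2) nonpos ..
      also have "\<dots> = c \<up> (- int j + int j) \<cdot> (u \<cdot> v)" by (rule cD_mult [OF u(1) v(1)])
      finally have "d = u \<cdot> v" using phi_phi_carrier [OF v(1)] phi_phi_carrier [OF u(1)] by simp
      then have "d \<in> \<phi> ` \<phi> ` C" using subgroup.m_closed [OF subgroup_phi_phi u(1) v(1)] by simp
      moreover have "d \<in> K" unfolding d_def using pkK hK K by (simp add: subgroup.m_closed)
      ultimately have "d \<in> D" by (simp add: DK)
      moreover have "h = p \<up> (0::nat) \<cdot> d \<cdot> iv (p \<up> j)" using hC pC by (simp add: d_def G.m_assoc)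
      ultimately show ?thesis by blast
    qed
  qed
  have tK: "t \<in> K" using tC g(2) by (simp add: K_def kern_def t_def)
  define cP where "cP = 2 * r * \<kappa> + 1"
  have costP: "cost_le (F_inf n) P cP" using r(1) by (simp add: P_def K_def cP_def)
  \<comment> \<open>The rank is bounded before the cost: \<open>P\<close> and \<open>t\<close>
    generate the kernel, and \<open>D\<close> lies in \<open>P\<close>.\<close>
  have rankK: "rank_le (F_inf n) K (Suc cP)"
  proof (rule G.rank_le_add [OF cost_le_rank_le [OF costP] P K _ tK])
    show "P \<subseteq> K" by (simp add: P_def)
    fix H assume H: "subgroup H (F_inf n)" "P \<subseteq> H" "t \<in> H"
    then have "B \<subseteq> H" using G.asc_subset [OF BD H(1)] DP by blast
    moreover have "p \<cdot> t \<in> H" using H pP subgroup.m_closed [OF H(1)] by blast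
    ultimately show "K \<subseteq> H" by (rule G.asc_subset [OF KB H(1)])
  qed
  \<comment> \<open>\<open>D\<close> is the double shift of the kernel of
    \<open>\<pi> \<circ> \<phi> ^^ 2\<close>. Another \<open>2 * n - 4\<close> shifts complete two
    periods and lead back to \<open>K\<close>; each of them costs one generator by
    \<open>rank_shift\<close>.\<close>
  have rankD: "rank_le (F_inf n) D (Suc cP + (2 * n - 4))"
  proof -
    have e: "2 * (n - 1) = (2 * n - 4) + 2" using n2 by simp
    define \<pi>2 where "\<pi>2 = \<pi> \<circ> \<phi> ^^ 2"
    have \<pi>2: "\<pi>2 \<in> homs (F_inf n) C Q" unfolding \<pi>2_def by (rule homs_shift [OF \<pi>])
    have fin2: "finite (\<pi>2 ` C)" unfolding \<pi>2_def by (rule finite_subset [OF image_shift fin])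
    have "(\<pi>2 \<circ> \<phi> ^^ (2 * n - 4)) h = \<pi> h" if "h \<in> C" for h
    proof -
      have "(\<pi>2 \<circ> \<phi> ^^ (2 * n - 4)) h = \<pi> ((\<phi> ^^ (2 * (n - 1))) h)"
        unfolding \<pi>2_def e comp_apply by (simp only: funpow_add comp_apply add.commute [of "2 * n - 4"])
      then show ?thesis using periodic_pow [OF Q.is_group \<pi> per that, of 2] by simp
    qed
    then have "kern C Q (\<pi>2 \<circ> \<phi> ^^ (2 * n - 4)) = K" unfolding K_def kern_def by auto
    then have "rank_le (F_inf n) (kern C Q (\<pi>2 \<circ> \<phi> ^^ (2 * n - 4))) (Suc cP)" using rankK by simp
    then have "rank_le (F_inf n) (kern C Q \<pi>2) (Suc cP + (2 * n - 4))"
      by (rule rank_shift_pow [OF Q.is_group \<pi>2 fin2])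
    then have "rank_le (F_inf n) (kern ((\<phi> ^^ 2) ` C) Q \<pi>) (Suc cP + (2 * n - 4))"
      unfolding \<pi>2_def
      by (rule G.rank_le_kern_image [OF G.subgroup_self G.is_group phi_pow(1) Q.is_group homs_mono [OF \<pi> phi_pow_image]])
    moreover have "(\<phi> ^^ 2) ` C = \<phi> ` \<phi> ` C" by (simp add: image_image numeral_2_eq_2)
    ultimately show ?thesis by (simp add: D_def)
  qed
  have "cost_le (F_inf n) K (cP + (Suc cP + (2 * n - 4)) + 2)"
    by (rule G.double_asc_cost [OF BD KB P DP pP conj rep _ costP rankD]) (auto simp: P_def)
  then have "cost_le (F_inf n) K (4 * \<kappa> * r + 2 * n + 2)"
  proof (rule cost_le_mono)
    have "2 * r * \<kappa> = 2 * (r * \<kappa>)" "4 * \<kappa> * r = 4 * (r * \<kappa>)" by simp_all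
    then show "cP + (Suc cP + (2 * n - 4)) + 2 \<le> 4 * \<kappa> * r + 2 * n + 2" unfolding cP_def using n2 by linarith
  qed
  then show ?thesis using r(2) by (auto simp: K_def)
qed

subsection \<open>Kernels of large index have small cost\<close>

lemma image_subset_subgroup:
  assumes "group Q" "\<pi> \<in> homs (F_inf n) C Q" "subgroup T Q" "\<And>i. \<pi> (x i) \<in> T"
  shows "\<pi> ` C \<subseteq> T"
  using group.generates_subset [OF assms(1) G.generates_image [OF G.subgroup_self assms(1,2) generates_F] assms(3)] assms(4)
  by auto

lemma theta_image: "\<theta> ` C \<subseteq> C"
  using theta_closed by auto

lemma adjoin_chain:
  assumes "comm_group Q" "\<And>i. i < j \<Longrightarrow> s i \<in> carrier Q" "\<And>i. i < j \<Longrightarrow> 0 < b i \<and> b i \<le> M \<and> s i [^]\<^bsub>Q\<^esub> (b i :: nat) = \<one>\<^bsub>Q\<^esub>"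
  shows "\<exists>T. subgroup T Q \<and> finite T \<and> card T \<le> M ^ j \<and> (\<forall>i<j. s i \<in> T)"
  using assms(2,3)
proof (induction j)
  case 0
  interpret Q: comm_group Q by fact
  show ?case by (intro exI [of _ "{\<one>\<^bsub>Q\<^esub>}"]) (auto simp: Q.triv_subgroup)
next
  case (Suc j)
  interpret Q: comm_group Q by fact
  obtain T where T: "subgroup T Q" "finite T" "card T \<le> M ^ j" "\<forall>i<j. s i \<in> T" using Suc by fastforce
  have b: "0 < b j" "b j \<le> M" "s j [^]\<^bsub>Q\<^esub> b j \<in> T"
    using Suc.prems(2) [of j] subgroup.one_closed [OF T(1)] by auto
  obtain T' where T': "subgroup T' Q" "finite T'" "T \<subseteq> T'" "s j \<in> T'" "card T' \<le> b j * card T"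
    using Q.adjoin [OF T(1,2) Suc.prems(1) b(1,3)] by auto
  have "card T' \<le> M * M ^ j" using T'(5) b(2) T(3) by (meson le_trans mult_le_mono)
  moreover have "\<forall>i<Suc j. s i \<in> T'" using T(4) T'(3,4) by (auto simp: less_Suc_eq)
  ultimately show ?case using T'(1,2) by auto
qed

text \<open>Here \<open>m\<close> is the order of \<open>x 0\<close> modulo the image of
  \<open>\<theta>\<close>, and \<open>b i\<close> the order of the \<open>i\<close>-th shift of
  \<open>c\<close>. One that reaches \<open>M\<close> yields the bound. Otherwise the shifts with
  \<open>i < n - 1\<close> generate a group of order at most \<open>M ^ (n - 1)\<close> that
  contains the image of \<open>\<theta>\<close>; adjoining \<open>x 0\<close> contradicts
  \<open>large\<close>.\<close>

theorem periodic_bound: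
  assumes Q: "comm_group Q" and \<pi>: "\<pi> \<in> homs (F_inf n) C Q" and fin: "finite (\<pi> ` C)" and per: "periodic \<pi>"
    and large: "M ^ n < card (\<pi> ` C)"
  shows "\<exists>a. cost_le (F_inf n) (kern C Q \<pi>) a \<and> M * a \<le> 2 ^ n * (4 * \<kappa> * card (\<pi> ` C) + (2 * n + 3) * M)"
proof -
  interpret Q: comm_group Q by fact
  interpret \<pi>: homs_on "F_inf n" Q C \<pi> by (rule homs_on_C [OF Q.is_group \<pi>])
  define N where "N = card (\<pi> ` C)"
  have pow1: "(1::nat) \<le> 2 ^ n" by simp
  obtain m g where m: "m > 0" "m * card (\<pi> ` \<theta> ` C) \<le> card (\<pi> ` C)"
    "\<And>k::nat. \<pi> (iv (x 0)) [^]\<^bsub>Q\<^esub> k \<in> \<pi> ` \<theta> ` C \<longleftrightarrow> m dvd k"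
    and asc: "asc (F_inf n) (kern C Q \<pi>) (kern (\<theta> ` C) Q \<pi>) (iv (x 0) \<up> m \<cdot> g)"
    using G.asc_kern_ex [OF asc_theta Q.is_group \<pi> fin] by metis
  have homs_th: "\<pi> \<circ> \<theta> \<in> homs (F_inf n) C Q" by (rule G.homs_comp [OF theta(1) theta_image \<pi>])
  have "\<forall>i. \<exists>b::nat. b > 0 \<and> (\<forall>k::nat. (\<pi> \<circ> \<phi> ^^ i) c [^]\<^bsub>Q\<^esub> k = \<one>\<^bsub>Q\<^esub> \<longleftrightarrow> b dvd k)"
  proof
    fix i
    obtain b :: nat where "b > 0" "\<And>k::nat. (\<pi> \<circ> \<phi> ^^ i) c [^]\<^bsub>Q\<^esub> k \<in> {\<one>\<^bsub>Q\<^esub>} \<longleftrightarrow> b dvd k"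
      using G.least_pow [OF Q.is_group finite_subset [OF image_shift fin] G.subgroup_self homs_shift [OF \<pi>] Q.triv_subgroup c_closed]
      by metis
    then show "\<exists>b::nat. b > 0 \<and> (\<forall>k::nat. (\<pi> \<circ> \<phi> ^^ i) c [^]\<^bsub>Q\<^esub> k = \<one>\<^bsub>Q\<^esub> \<longleftrightarrow> b dvd k)" by auto
  qed
  then obtain b where b: "\<And>i. (b i::nat) > 0" "\<And>i (k::nat). (\<pi> \<circ> \<phi> ^^ i) c [^]\<^bsub>Q\<^esub> k = \<one>\<^bsub>Q\<^esub> \<longleftrightarrow> b i dvd k" by metis
  consider "M \<le> m" | i where "i < n - 1" "M \<le> b i" | "m < M" "\<And>i. i < n - 1 \<Longrightarrow> b i < M" by (meson not_le)
  then show ?thesis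
  proof cases
    case 1
    define r where "r = card (\<pi> ` \<theta> ` C)"
    have im: "(\<pi> \<circ> \<theta>) ` C = \<pi> ` \<theta> ` C" by (simp add: image_comp)
    have f: "finite ((\<pi> \<circ> \<theta>) ` C)" unfolding im by (rule finite_subset [OF image_mono [OF theta_image] fin])
    have "cost_le (F_inf n) (kern C Q (\<pi> \<circ> \<theta>)) (r * \<kappa>)"
      using cost_kern [OF Q.is_group homs_th f] by (simp only: im r_def)
    then have "cost_le (F_inf n) (kern (\<theta> ` C) Q \<pi>) (r * \<kappa>)"
      by (rule G.cost_le_kern_image [OF G.subgroup_self G.is_group theta(1) inj_theta Q.is_group homs_mono [OF \<pi> theta_image]])
    then have cost: "cost_le (F_inf n) (kern C Q \<pi>) (2 * (r * \<kappa>) + 1)" by (rule G.asc_cost [OF asc])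
    have "M * r \<le> N" using 1 m(2) unfolding r_def N_def by (meson le_trans mult_le_mono1)
    then have "(M * r) * (2 * \<kappa>) \<le> N * (2 * \<kappa>)" by (rule mult_le_mono1)
    then have "M * (2 * (r * \<kappa>) + 1) \<le> 2 * \<kappa> * N + M" by (simp add: algebra_simps)
    also have "\<dots> \<le> 1 * (4 * \<kappa> * N + (2 * n + 3) * M)" by (simp add: algebra_simps)
    also have "\<dots> \<le> 2 ^ n * (4 * \<kappa> * N + (2 * n + 3) * M)" by (rule mult_le_mono1 [OF pow1])
    finally show ?thesis using cost by (auto simp: N_def)
  next
    case 2
    obtain r where r: "cost_le (F_inf n) (kern C Q (\<pi> \<circ> \<phi> ^^ i)) (4 * \<kappa> * r + 2 * n + 2)" "b i * r \<le> card ((\<pi> \<circ> \<phi> ^^ i) ` C)"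
      using cost_c [OF Q homs_shift [OF \<pi>] finite_subset [OF image_shift fin] periodic_shift [OF per] b] by blast
    have "card ((\<pi> \<circ> \<phi> ^^ i) ` C) \<le> N" unfolding N_def by (rule card_mono [OF fin image_shift])
    then have Mr: "M * r \<le> N" using r(2) 2(2) by (meson le_trans mult_le_mono1)
    have "cost_le (F_inf n) (kern C Q \<pi>) (2 ^ i * (4 * \<kappa> * r + 2 * n + 2 + 1))"
      by (rule cost_shift_pow [OF Q.is_group \<pi> fin r(1)])
    moreover have "M * (2 ^ i * (4 * \<kappa> * r + 2 * n + 2 + 1)) \<le> 2 ^ n * (4 * \<kappa> * N + (2 * n + 3) * M)"
    proof -
      have "(M * r) * (4 * \<kappa>) \<le> N * (4 * \<kappa>)" using Mr by (rule mult_le_mono1)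
      then have 1: "M * (4 * \<kappa> * r + 2 * n + 2 + 1) \<le> 4 * \<kappa> * N + (2 * n + 3) * M" by (simp add: algebra_simps)
      have "(2::nat) ^ i \<le> 2 ^ n" using 2(1) by (intro power_increasing) auto
      then have "2 ^ i * (M * (4 * \<kappa> * r + 2 * n + 2 + 1)) \<le> 2 ^ n * (4 * \<kappa> * N + (2 * n + 3) * M)"
        using 1 by (rule mult_le_mono)
      then show ?thesis by (simp only: mult.left_commute)
    qed
    ultimately show ?thesis by (auto simp: N_def)
  next
    case 3
    obtain T where T: "subgroup T Q" "finite T" "card T \<le> M ^ (n - 1)" "\<And>i. i < n - 1 \<Longrightarrow> (\<pi> \<circ> \<phi> ^^ i) c \<in> T"
    proof -
      have "(\<pi> \<circ> \<phi> ^^ i) c \<in> carrier Q" for i using phi_pow_closed [OF c_closed] by simp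
      moreover have "0 < b i \<and> b i \<le> M \<and> (\<pi> \<circ> \<phi> ^^ i) c [^]\<^bsub>Q\<^esub> b i = \<one>\<^bsub>Q\<^esub>" if "i < n - 1" for i
        using b(1) [of i] b(2) [of i "b i"] 3(2) [OF that] by simp
      ultimately show ?thesis
        using adjoin_chain [OF Q, of "n - 1" "\<lambda>i. (\<pi> \<circ> \<phi> ^^ i) c" b M] that by blast
    qed
    \<comment> \<open>Periodicity reduces every shift of \<open>c\<close> to one of the first
      \<open>n - 1\<close>.\<close>
    have cT: "(\<pi> \<circ> \<phi> ^^ i) c \<in> T" for i
    proof -
      define k r where "k = i div (n - 1)" and "r = i mod (n - 1)"
      have i: "i = r + k * (n - 1)" by (simp only: k_def r_def mod_div_mult_eq)
      have "(\<pi> \<circ> \<phi> ^^ i) c = (\<pi> \<circ> \<phi> ^^ r) ((\<phi> ^^ (k * (n - 1))) c)" unfolding i by (simp only: funpow_add comp_apply)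
      also have "\<dots> = (\<pi> \<circ> \<phi> ^^ r) c"
        by (rule periodic_pow [OF Q.is_group homs_shift [OF \<pi>] periodic_shift [OF per] c_closed])
      finally show ?thesis using T(4) [of r] nz by (simp add: r_def)
    qed
    have px: "\<pi> (x i) \<in> carrier Q" for i by simp
    have c_val: "(\<pi> \<circ> \<phi> ^^ i) c = \<pi> (x i) \<otimes>\<^bsub>Q\<^esub> inv\<^bsub>Q\<^esub> (\<pi> (x (Suc i)))" for i
    proof -
      interpret P: homs_on "F_inf n" "F_inf n" C "\<phi> ^^ i" by (rule homs_on_C [OF G.is_group phi_pow(1)])
      have "(\<phi> ^^ i) c = x i \<cdot> iv (x (Suc i))"
        unfolding c_def using P.mult [of "x 0" "iv (x 1)"] P.inv [of "x 1"] by (simp add: phi_pow(2))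
      then show ?thesis using \<pi>.mult [of "x i" "iv (x (Suc i))"] \<pi>.inv [of "x (Suc i)"] by simp
    qed
    \<comment> \<open>A telescoping product of shifts of \<open>c\<close>.\<close>
    have u: "\<pi> (x 0) \<otimes>\<^bsub>Q\<^esub> inv\<^bsub>Q\<^esub> (\<pi> (x i)) \<in> T" for i
    proof (induction i)
      case 0
      then show ?case using subgroup.one_closed [OF T(1)] by simp
    next
      case (Suc i)
      have "(\<pi> (x 0) \<otimes>\<^bsub>Q\<^esub> inv\<^bsub>Q\<^esub> (\<pi> (x i))) \<otimes>\<^bsub>Q\<^esub> (\<pi> (x i) \<otimes>\<^bsub>Q\<^esub> inv\<^bsub>Q\<^esub> (\<pi> (x (Suc i)))) \<in> T"
        using subgroup.m_closed [OF T(1) Suc] cT [of i] unfolding c_val .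
      then show ?case by (simp add: Q.m_assoc)
    qed
    have ui: "\<pi> (x i) \<otimes>\<^bsub>Q\<^esub> inv\<^bsub>Q\<^esub> (\<pi> (x 0)) \<in> T" for i
      using subgroup.m_inv_closed [OF T(1) u [of i]] by (simp add: Q.inv_mult_group)
    have "(\<pi> \<circ> \<theta>) ` C \<subseteq> T"
    proof (rule image_subset_subgroup [OF Q.is_group homs_th T(1)])
      fix i
      define k where "k = Suc i"
      have s: "\<pi> (S k) \<in> carrier Q" by simp
      \<comment> \<open>The letter by which \<open>S (Suc k)\<close> exceeds \<open>S k\<close> has
        the same image as \<open>x 0\<close>. So \<open>\<theta> (x i)\<close> is sent to the
        quotient of the images of \<open>x i\<close> and \<open>x 0\<close>.\<close>
      have "\<pi> (x (k * (n - 1))) = \<pi> (x 0)" using periodic_mult [OF per, of 0 k] by simp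
      then have sk: "\<pi> (S (Suc k)) = \<pi> (S k) \<otimes>\<^bsub>Q\<^esub> \<pi> (x 0)" using \<pi>.mult [of "S k" "x (k * (n - 1))"] by simp
      have "\<pi> (\<theta> (x i)) = \<pi> (S k) \<otimes>\<^bsub>Q\<^esub> \<pi> (x i) \<otimes>\<^bsub>Q\<^esub> inv\<^bsub>Q\<^esub> (\<pi> (S (Suc k)))"
        unfolding theta(2) th_def k_def [symmetric]
        using \<pi>.mult [of "S k \<cdot> x i" "iv (S (Suc k))"] \<pi>.mult [of "S k" "x i"] \<pi>.inv [of "S (Suc k)"]
        by (simp del: S.simps)
      also have "\<dots> = \<pi> (S k) \<otimes>\<^bsub>Q\<^esub> \<pi> (x i) \<otimes>\<^bsub>Q\<^esub> (inv\<^bsub>Q\<^esub> (\<pi> (x 0)) \<otimes>\<^bsub>Q\<^esub> inv\<^bsub>Q\<^esub> (\<pi> (S k)))"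
        unfolding sk using s px by (simp add: Q.inv_mult_group)
      also have "\<dots> = \<pi> (S k) \<otimes>\<^bsub>Q\<^esub> (\<pi> (x i) \<otimes>\<^bsub>Q\<^esub> inv\<^bsub>Q\<^esub> (\<pi> (x 0))) \<otimes>\<^bsub>Q\<^esub> inv\<^bsub>Q\<^esub> (\<pi> (S k))"
        using s px by (simp add: Q.m_assoc)
      also have "\<dots> = (\<pi> (x i) \<otimes>\<^bsub>Q\<^esub> inv\<^bsub>Q\<^esub> (\<pi> (x 0))) \<otimes>\<^bsub>Q\<^esub> \<pi> (S k) \<otimes>\<^bsub>Q\<^esub> inv\<^bsub>Q\<^esub> (\<pi> (S k))"
        using Q.m_comm [of "\<pi> (S k)" "\<pi> (x i) \<otimes>\<^bsub>Q\<^esub> inv\<^bsub>Q\<^esub> (\<pi> (x 0))"] s px by simp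
      also have "\<dots> = \<pi> (x i) \<otimes>\<^bsub>Q\<^esub> inv\<^bsub>Q\<^esub> (\<pi> (x 0))" using s px by (simp add: Q.m_assoc)
      finally show "(\<pi> \<circ> \<theta>) (x i) \<in> T" using ui by simp
    qed
    moreover have "\<pi> (iv (x 0)) [^]\<^bsub>Q\<^esub> m \<in> \<pi> ` \<theta> ` C" using m(3) [of m] by simp
    ultimately have "\<pi> (iv (x 0)) [^]\<^bsub>Q\<^esub> m \<in> T" by (auto simp: image_comp)
    then obtain T' where T': "subgroup T' Q" "finite T'" "T \<subseteq> T'" "\<pi> (iv (x 0)) \<in> T'" "card T' \<le> m * card T"
      using Q.adjoin [OF T(1,2) _ m(1), of "\<pi> (iv (x 0))"] by auto
    have "inv\<^bsub>Q\<^esub> (\<pi> (iv (x 0))) \<in> T'" by (rule subgroup.m_inv_closed [OF T'(1,4)])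
    then have x0: "\<pi> (x 0) \<in> T'" using \<pi>.inv [of "x 0"] by simp
    have "\<pi> (x i) \<in> T'" for i
    proof -
      have "(\<pi> (x i) \<otimes>\<^bsub>Q\<^esub> inv\<^bsub>Q\<^esub> (\<pi> (x 0))) \<otimes>\<^bsub>Q\<^esub> \<pi> (x 0) \<in> T'"
        using subgroup.m_closed [OF T'(1) _ x0] ui T'(3) by blast
      then show ?thesis by (simp add: Q.m_assoc)
    qed
    then have "\<pi> ` C \<subseteq> T'" by (rule image_subset_subgroup [OF Q.is_group \<pi> T'(1)])
    then have "card (\<pi> ` C) \<le> card T'" by (rule card_mono [OF T'(2)])
    also have "\<dots> \<le> m * card T" by (rule T'(5))
    also have "\<dots> \<le> M * M ^ (n - 1)" using 3(1) T(3) by (intro mult_le_mono) auto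
    also have "\<dots> = M ^ n" using n1 by (simp flip: power_Suc)
    finally show ?thesis using large by simp
  qed
qed

text \<open>Either \<open>x 0\<close> has order at least \<open>M\<close> modulo the image of the
  shifted copy, or that image has more than \<open>M ^ n\<close> elements and
  \<open>periodic_bound\<close> applies to \<open>\<pi> \<circ> \<phi>\<close>; hence the exponent
  \<open>n + 1\<close>. Going back through \<open>cost_shift\<close> doubles the bound and adds
  \<open>M\<close>.\<close>

theorem kern_bound:
  assumes Q: "comm_group Q" and \<pi>: "\<pi> \<in> homs (F_inf n) C Q" and fin: "finite (\<pi> ` C)"
    and large: "M ^ (n + 1) < card (\<pi> ` C)"
  shows "\<exists>a. cost_le (F_inf n) (kern C Q \<pi>) a \<and> M * a \<le> 2 * (2 ^ n * (4 * \<kappa> * card (\<pi> ` C) + (2 * n + 3) * M)) + M"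
proof -
  interpret Q: comm_group Q by fact
  interpret \<pi>: homs_on "F_inf n" Q C \<pi> by (rule homs_on_C [OF Q.is_group \<pi>])
  define N N1 where "N = card (\<pi> ` C)" and "N1 = card (\<pi> ` \<phi> ` C)"
  have pow1: "(1::nat) \<le> 2 ^ n" by simp
  have im: "(\<pi> \<circ> \<phi>) ` C = \<pi> ` \<phi> ` C" by (simp add: image_comp)
  have sub: "\<pi> ` \<phi> ` C \<subseteq> \<pi> ` C" by (rule image_mono [OF phi_image])
  have fin1: "finite (\<pi> ` \<phi> ` C)" by (rule finite_subset [OF sub fin])
  have fin1': "finite ((\<pi> \<circ> \<phi>) ` C)" unfolding im by (rule fin1)
  have homs1: "\<pi> \<circ> \<phi> \<in> homs (F_inf n) C Q" by (rule G.homs_comp [OF phi(1) phi_image \<pi>])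
  have N1: "N1 \<le> N" unfolding N_def N1_def by (rule card_mono [OF fin sub])
  obtain m g where m: "m > 0" "m * N1 \<le> N" "\<And>k::nat. \<pi> (x 0) [^]\<^bsub>Q\<^esub> k \<in> \<pi> ` \<phi> ` C \<longleftrightarrow> m dvd k"
    using G.asc_kern_ex [OF asc_phi Q.is_group \<pi> fin] unfolding N_def N1_def by metis
  show ?thesis
  proof (cases "M \<le> m")
    case True
    have "cost_le (F_inf n) (kern C Q (\<pi> \<circ> \<phi>)) (N1 * \<kappa>)"
      using cost_kern [OF Q.is_group homs1 fin1'] by (simp only: im N1_def)
    then have cost: "cost_le (F_inf n) (kern C Q \<pi>) (2 * (N1 * \<kappa>) + 1)" by (rule cost_shift [OF Q.is_group \<pi> fin])
    have "M * N1 \<le> N" using True m(2) by (meson le_trans mult_le_mono1)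
    then have "(M * N1) * (2 * \<kappa>) \<le> N * (2 * \<kappa>)" by (rule mult_le_mono1)
    then have "M * (2 * (N1 * \<kappa>) + 1) \<le> 2 * \<kappa> * N + M" by (simp add: algebra_simps)
    also have "\<dots> \<le> 2 * (1 * (4 * \<kappa> * N + (2 * n + 3) * M)) + M" by (simp add: algebra_simps)
    also have "\<dots> \<le> 2 * (2 ^ n * (4 * \<kappa> * N + (2 * n + 3) * M)) + M"
      by (intro add_le_mono1 mult_le_mono2 mult_le_mono1 [OF pow1])
    finally show ?thesis using cost by (auto simp: N_def)
  next
    case False
    have S: "subgroup (\<pi> ` \<phi> ` C) Q"
      by (rule G.subgroup_homs_image [OF subgroup_phi Q.is_group homs_mono [OF \<pi> phi_image]])
    have "\<pi> (x 0) [^]\<^bsub>Q\<^esub> m \<in> \<pi> ` \<phi> ` C" using m(3) [of m] by simp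
    then obtain T where T: "subgroup T Q" "finite T" "\<pi> ` \<phi> ` C \<subseteq> T" "\<pi> (x 0) \<in> T" "card T \<le> m * N1"
      using Q.adjoin [OF S fin1 _ m(1), of "\<pi> (x 0)"] unfolding N1_def by auto
    have "\<pi> (x i) \<in> T" for i
    proof (cases i)
      case (Suc j)
      have "\<pi> (x i) \<in> \<pi> ` \<phi> ` C" unfolding Suc phi(2) [symmetric] by (intro imageI x_closed)
      then show ?thesis using T(3) by blast
    qed (use T(4) in simp)
    then have "\<pi> ` C \<subseteq> T" by (rule image_subset_subgroup [OF Q.is_group \<pi> T(1)])
    then have "N \<le> card T" unfolding N_def by (rule card_mono [OF T(2)])
    also have "\<dots> \<le> m * N1" by (rule T(5))
    also have "\<dots> \<le> M * N1" using False by (intro mult_le_mono1) simp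
    finally have le: "N \<le> M * N1" .
    have "M ^ (n + 1) = M * M ^ n" by simp
    then have "M * M ^ n < M * N1" using large le unfolding N_def by linarith
    then have "M ^ n < card ((\<pi> \<circ> \<phi>) ` C)" unfolding im N1_def by simp
    then obtain a where a: "cost_le (F_inf n) (kern C Q (\<pi> \<circ> \<phi>)) a"
      "M * a \<le> 2 ^ n * (4 * \<kappa> * card ((\<pi> \<circ> \<phi>) ` C) + (2 * n + 3) * M)"
      using periodic_bound [OF Q homs1 fin1' periodic_phi [OF Q \<pi>]] by blast
    have "M * a \<le> 2 ^ n * (4 * \<kappa> * N1 + (2 * n + 3) * M)" using a(2) unfolding im N1_def .
    also have "\<dots> \<le> 2 ^ n * (4 * \<kappa> * N + (2 * n + 3) * M)"
      by (intro mult_le_mono2 add_le_mono1 N1)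
    finally have "M * (2 * a + 1) \<le> 2 * (2 ^ n * (4 * \<kappa> * N + (2 * n + 3) * M)) + M" by simp
    moreover have "cost_le (F_inf n) (kern C Q \<pi>) (2 * a + 1)" by (rule cost_shift [OF Q.is_group \<pi> fin a(1)])
    ultimately show ?thesis by (auto simp: N_def)
  qed
qed

end

section \<open>Deficiency and cost\<close>

definition Z2 :: "bool monoid" where
  "Z2 = \<lparr>carrier = UNIV, mult = (\<noteq>), one = False\<rparr>"

lemma group_Z2: "group Z2"
  by (rule groupI) (auto simp: Z2_def)

lemma inv_Z2: "inv\<^bsub>Z2\<^esub> a = a"
  by (rule group.inv_equality [OF group_Z2]) (auto simp: Z2_def)

lemma ev_Z2_Nil: "ev Z2 f [] = False"
  and ev_Z2_Cons: "ev Z2 f (a # w) = (f (snd a) \<noteq> ev Z2 f w)"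
  by (simp_all add: inv_Z2) (simp_all add: Z2_def)

lemma ev_Z2_add: "ev Z2 (\<lambda>i. f i \<noteq> g i) w = (ev Z2 f w \<noteq> ev Z2 g w)"
  by (induction w) (auto simp: ev_Z2_Nil ev_Z2_Cons simp del: ev.simps)

text \<open>Counting homomorphisms to the group of order two: a presentation with \<open>k\<close> generators and relators \<open>R\<close>
  yields at least \<open>2 ^ (k - card R)\<close> of them, a generating set \<open>X\<close> allows at most \<open>2 ^ card X\<close>.\<close>

lemma (in group) generators_le:
  assumes A: "subgroup A G" and pr: "presents G A y {..<k} R" and R: "finite R"
    and gen: "generates G A z X" and X: "finite X"
  shows "k \<le> card R + card X"
proof -
  define Fs where "Fs = PiE {..<k} (\<lambda>_. UNIV :: bool set)"
  define ps where "ps f = restrict (\<lambda>r. ev Z2 f r) R" for f :: "nat \<Rightarrow> bool"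
  define Sol where "Sol = {f \<in> Fs. \<forall>r\<in>R. \<not> ev Z2 f r}"
  define V where "V = PiE R (\<lambda>_. UNIV :: bool set)"
  have card_Fs: "card Fs = 2 ^ k" by (simp add: Fs_def card_PiE)
  have fin_Fs: "finite Fs" unfolding Fs_def by (intro finite_PiE) auto
  have card_V: "card V = 2 ^ card R" using R by (simp add: V_def card_PiE)
  have fin_V: "finite V" unfolding V_def by (intro finite_PiE R) auto
  have fin_Sol: "finite Sol" using fin_Fs by (simp add: Sol_def)
  \<comment> \<open>\<open>ps\<close> is linear over the field with two elements, so adding a point
    \<open>f0\<close> of a fibre maps the fibre injectively into the kernel
    \<open>Sol\<close>.\<close>
  have fibre: "card {f \<in> Fs. ps f = v} \<le> card Sol" for v
  proof (cases "{f \<in> Fs. ps f = v} = {}")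
    case False
    then obtain f0 where f0: "f0 \<in> Fs" "ps f0 = v" by blast
    define add where "add f = restrict (\<lambda>i. f i \<noteq> f0 i) {..<k}" for f :: "nat \<Rightarrow> bool"
    have "inj_on add {f \<in> Fs. ps f = v}"
    proof (rule inj_onI)
      fix f g assume fg: "f \<in> {f \<in> Fs. ps f = v}" "g \<in> {f \<in> Fs. ps f = v}" "add f = add g"
      show "f = g"
      proof (rule PiE_ext)
        show "f \<in> PiE {..<k} (\<lambda>_. UNIV)" "g \<in> PiE {..<k} (\<lambda>_. UNIV)" using fg by (auto simp: Fs_def)
        fix i assume "i \<in> {..<k}"
        then show "f i = g i" using fun_cong [OF fg(3), of i] by (auto simp: add_def)
      qed
    qed
    moreover have "add ` {f \<in> Fs. ps f = v} \<subseteq> Sol"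
    proof
      fix h assume "h \<in> add ` {f \<in> Fs. ps f = v}"
      then obtain f where f: "f \<in> Fs" "ps f = v" "h = add f" by blast
      have "\<not> ev Z2 h r" if r: "r \<in> R" for r
      proof -
        have "ev Z2 h r = ev Z2 (\<lambda>i. f i \<noteq> f0 i) r"
          using presentsD(3) [OF pr] r by (intro ev_cong [of "{..<k}"]) (auto simp: f(3) add_def)
        moreover have "ev Z2 f r = ev Z2 f0 r"
        proof -
          have "ps f r = ps f0 r" using f(2) f0(2) by simp
          then show ?thesis using r by (simp add: ps_def)
        qed
        ultimately show ?thesis using ev_Z2_add [of f f0 r] by simp
      qed
      moreover have "h \<in> Fs" unfolding f(3) add_def Fs_def by auto
      ultimately show "h \<in> Sol" by (simp add: Sol_def)
    qed
    ultimately show ?thesis using fin_Sol by (rule card_inj_on_le)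
  next
    case True
    show ?thesis unfolding True by simp
  qed
  have "Fs = (\<Union>v\<in>V. {f \<in> Fs. ps f = v})" by (auto simp: V_def ps_def)
  then have "card Fs = card (\<Union>v\<in>V. {f \<in> Fs. ps f = v})" by simp
  also have "\<dots> \<le> (\<Sum>v\<in>V. card {f \<in> Fs. ps f = v})" by (rule card_UN_le [OF fin_V])
  also have "\<dots> \<le> (\<Sum>v\<in>V. card Sol)" by (intro sum_mono fibre)
  finally have 1: "2 ^ k \<le> 2 ^ card R * card Sol" by (simp add: card_Fs card_V)
  \<comment> \<open>A solution kills all relators and so defines a homomorphism, which in turn is
    determined by its values on the other generating set \<open>X\<close>.\<close>
  have "\<exists>F. F \<in> homs G A Z2 \<and> (\<forall>i<k. F (y i) = f i)" if f: "f \<in> Sol" for f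
  proof -
    have "ev Z2 f r = \<one>\<^bsub>Z2\<^esub>" if "r \<in> R" for r using f that by (auto simp: Sol_def Z2_def)
    moreover have "f ` {..<k} \<subseteq> carrier Z2" by (simp add: Z2_def)
    ultimately obtain F where "F \<in> homs G A Z2" "\<And>i. i \<in> {..<k} \<Longrightarrow> F (y i) = f i"
      using presents_hom [OF A pr group_Z2] by metis
    then show ?thesis by auto
  qed
  then obtain E where E: "\<And>f. f \<in> Sol \<Longrightarrow> E f \<in> homs G A Z2 \<and> (\<forall>i<k. E f (y i) = f i)" by metis
  define U where "U = PiE X (\<lambda>_. UNIV :: bool set)"
  have card_U: "card U = 2 ^ card X" using X by (simp add: U_def card_PiE)
  have fin_U: "finite U" unfolding U_def by (intro finite_PiE X) auto
  have "inj_on (\<lambda>f. restrict (\<lambda>x. E f (z x)) X) Sol"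
  proof (rule inj_onI)
    fix f g assume fg: "f \<in> Sol" "g \<in> Sol" "restrict (\<lambda>x. E f (z x)) X = restrict (\<lambda>x. E g (z x)) X"
    have zz: "E f (z x) = E g (z x)" if "x \<in> X" for x using fun_cong [OF fg(3), of x] that by simp
    have eq: "E f a = E g a" if "a \<in> A" for a
    proof (rule homs_eq [OF A gen group_Z2 _ _ _ that])
      show "E f \<in> homs G A Z2" "E g \<in> homs G A Z2" using E fg by auto
    qed (rule zz)
    show "f = g"
    proof (rule PiE_ext)
      show "f \<in> PiE {..<k} (\<lambda>_. UNIV)" "g \<in> PiE {..<k} (\<lambda>_. UNIV)" using fg by (auto simp: Fs_def Sol_def)
      fix i assume i: "i \<in> {..<k}"
      then have "y i \<in> A" using presentsD(2) [OF pr] by auto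
      then show "f i = g i" using eq [of "y i"] E [OF fg(1)] E [OF fg(2)] i by auto
    qed
  qed
  moreover have "(\<lambda>f. restrict (\<lambda>x. E f (z x)) X) ` Sol \<subseteq> U" by (auto simp: U_def)
  ultimately have "card Sol \<le> card U" using fin_U by (rule card_inj_on_le)
  then have "2 ^ card R * card Sol \<le> 2 ^ card R * 2 ^ card X" unfolding card_U by (rule mult_le_mono2)
  with 1 have "(2::nat) ^ k \<le> 2 ^ card R * 2 ^ card X" by (rule order_trans)
  then have "(2::nat) ^ k \<le> 2 ^ (card R + card X)" by (simp only: power_add)
  then show ?thesis by simp
qed

text \<open>For the upper bound, \<open>generators_le\<close> compares an arbitrary presentation
  with the generators of the given one. For the lower bound, the given presentation takes part in
  the supremum once its generators are numbered from 0.\<close>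

lemma (in group) deficiency_bounds:
  assumes A: "subgroup A G" and cost: "cost_le G A a"
  shows "- ereal (real a) \<le> deficiency (G\<lparr>carrier := A\<rparr>)" "deficiency (G\<lparr>carrier := A\<rparr>) \<le> ereal (real a)"
proof -
  obtain X :: "nat set" and R y where X: "finite X" "finite R" "card X + card R \<le> a" and pr: "presents G A y X R"
    using cost by (auto simp: cost_le_def)
  let ?H = "G\<lparr>carrier := A\<rparr>"
  have up: "ereal (real k - real (card S)) \<le> ereal (real a)"
    if S: "finite S" "S \<subseteq> words_on {..<k}" "pres_group {..<k} S \<cong> ?H" for k S
  proof -
    let ?E = "pres_group {..<k} S"
    interpret E: group ?E by (rule group_pres_group)
    obtain h where h: "h \<in> hom ?E ?H" "bij_betw h (carrier ?E) A"
      using S(3) by (auto simp: is_iso_def iso_def)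
    have "h \<in> homs ?E (carrier ?E) G" using h(1) subgroup.subset [OF A] by (auto simp: homs_def hom_def Pi_def)
    then have "presents G (h ` carrier ?E) (h \<circ> pgen {..<k} S) {..<k} S"
      by (rule E.presents_image [OF E.subgroup_self is_group _ bij_betw_imp_inj_on [OF h(2)] presents_pres_group [OF S(2)]])
    then have "presents G A (h \<circ> pgen {..<k} S) {..<k} S" using bij_betw_imp_surj_on [OF h(2)] by simp
    from generators_le [OF A this S(1) presentsD(1) [OF pr] X(1)] show ?thesis using X(3) by simp
  qed
  show "deficiency ?H \<le> ereal (real a)"
    unfolding deficiency_def by (rule SUP_least) (use up in auto)
  obtain b where b: "bij_betw b X {..<card X}"
    using ex_bij_betw_finite_nat [OF X(1)] by (auto simp: atLeast0LessThan)
  define k S z where "k = card X" and "S = rename b ` R" and "z = y \<circ> inv_into X b"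
  have bX: "b ` X = {..<k}" using bij_betw_imp_surj_on [OF b] by (simp add: k_def)
  have pz: "presents G A z {..<k} S"
    using presents_rename [OF bij_betw_imp_inj_on [OF b] pr] by (simp only: bX S_def z_def)
  have fS: "finite S" "card S \<le> card R" using X(2) by (auto simp: S_def card_image_le)
  let ?E = "pres_group {..<k} S"
  interpret E: group ?E by (rule group_pres_group)
  have zA: "z ` {..<k} \<subseteq> A" by (rule presentsD(2) [OF pz])
  then have zc: "z ` {..<k} \<subseteq> carrier G" using subgroup.subset [OF A] by blast
  obtain F where F: "F \<in> homs ?E (carrier ?E) G" "\<And>w. w \<in> words_on {..<k} \<Longrightarrow> F (ev ?E (pgen {..<k} S) w) = ev G z w"
    using E.presents_hom [OF E.subgroup_self presents_pres_group [OF presentsD(3) [OF pz]] is_group zc presentsD(4) [OF pz]] by metis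
  have Fw: "F (pres_class {..<k} S w) = ev G z w" if "w \<in> words_on {..<k}" for w
    using F(2) [OF that] ev_pgen [OF that] by simp
  have im: "F ` carrier ?E = A"
  proof
    show "F ` carrier ?E \<subseteq> A"
    proof
      fix g assume "g \<in> F ` carrier ?E"
      then obtain w where "w \<in> words_on {..<k}" "g = F (pres_class {..<k} S w)" by (auto elim: pres_group_cases)
      then show "g \<in> A" using Fw ev_closed [OF A zA] by simp
    qed
    show "A \<subseteq> F ` carrier ?E"
    proof
      fix g assume "g \<in> A"
      then obtain w where w: "w \<in> words_on {..<k}" "ev G z w = g" using presentsD(6) [OF pz] by blast
      then have "g = F (pres_class {..<k} S w)" using Fw by simp
      then show "g \<in> F ` carrier ?E" using pres_class_in_carrier [OF w(1)] by blast
    qed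
  qed
  have inj: "inj_on F (carrier ?E)"
  proof (rule inj_onI)
    fix g h assume gh: "g \<in> carrier ?E" "h \<in> carrier ?E" "F g = F h"
    obtain u where u: "u \<in> words_on {..<k}" "g = pres_class {..<k} S u" using gh(1) by (rule pres_group_cases)
    obtain v where v: "v \<in> words_on {..<k}" "h = pres_class {..<k} S v" using gh(2) by (rule pres_group_cases)
    have "ev G z (u @ inv_word v) = \<one>"
      using gh(3) u v Fw ev_in_carrier [OF zc v(1)] by (simp add: ev_append [OF zc] ev_inv_word [OF zc])
    then have "pres_eq S (u @ inv_word v) []" using presentsD(5) [OF pz] u(1) v(1) by simp
    then have "pres_eq S ((u @ inv_word v) @ v) ([] @ v)" by (rule pres_eq_append_right)
    moreover have "pres_eq S (u @ (inv_word v @ v)) (u @ [])" by (intro pres_eq_append_left pres_eq_inv_left)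
    ultimately have "pres_eq S u v" using pres_sym pres_trans by fastforce
    then show "g = h" using u v by (simp add: pres_class_eq_iff)
  qed
  have "F \<in> hom ?E ?H" using F(1) im by (auto simp: homs_def hom_def)
  then have "?E \<cong> ?H" using im inj by (auto simp: is_iso_def iso_def bij_betw_def)
  then have "(k, S) \<in> {(k, R). finite R \<and> R \<subseteq> words_on {..<k} \<and> pres_group {..<k} R \<cong> ?H}"
    using fS(1) presentsD(3) [OF pz] by simp
  then have "ereal (real (fst (k, S)) - real (card (snd (k, S)))) \<le> deficiency ?H"
    unfolding deficiency_def by (rule SUP_upper)
  moreover have "- real a \<le> real k - real (card S)" using fS(2) X(3) by simp
  then have "- ereal (real a) \<le> ereal (real k - real (card S))" by simp
  ultimately show "- ereal (real a) \<le> deficiency ?H" by (metis fst_conv order_trans snd_conv)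
qed

section \<open>Subgroups of finite index\<close>

context thompson
begin

text \<open>Some power of \<open>x 0\<close> fixes all cosets of \<open>H\<close>, so the action of \<open>x i\<close> on the cosets depends only on \<open>i\<close>
  modulo a multiple of \<open>n - 1\<close>, and the relations make all \<open>x i\<close> commute in this action.\<close>

lemma finite_index_commute:
  assumes H: "subgroup H (F_inf n)" and fin: "finite (rcosets\<^bsub>F_inf n\<^esub> H)"
    and w: "w \<in> rcosets\<^bsub>F_inf n\<^esub> H" and g: "g \<in> C" "h \<in> C"
  shows "w #>\<^bsub>F_inf n\<^esub> (g \<cdot> h) = w #>\<^bsub>F_inf n\<^esub> (h \<cdot> g)"
proof -
  define W where "W = rcosets\<^bsub>F_inf n\<^esub> H"
  define A where "A w g = w #>\<^bsub>F_inf n\<^esub> g" for w g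
  have Wc: "w \<subseteq> C" if "w \<in> W" for w
    using G.rcosets_subset_PowG [OF H] that by (auto simp: W_def)
  have Wm: "A w g \<in> W" if w: "w \<in> W" and g: "g \<in> C" for w g
  proof -
    obtain a where a: "a \<in> C" "w = H #>\<^bsub>F_inf n\<^esub> a" using w by (auto simp: W_def RCOSETS_def)
    then have "A w g = H #>\<^bsub>F_inf n\<^esub> (a \<cdot> g)"
      using G.coset_mult_assoc [OF subgroup.subset [OF H] a(1) g] by (simp add: A_def)
    then show ?thesis using G.rcosetsI [OF subgroup.subset [OF H], of "a \<cdot> g"] a(1) g by (simp add: W_def)
  qed
  have Aa: "A (A w g) h = A w (g \<cdot> h)" if "w \<in> W" "g \<in> C" "h \<in> C" for w g h
    using G.coset_mult_assoc [OF Wc [OF that(1)] that(2,3)] by (simp add: A_def)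
  have A1: "A w e1 = w" if "w \<in> W" for w using G.coset_mult_one [OF Wc [OF that]] by (simp add: A_def)
  \<comment> \<open>The finite set \<open>W\<close> has only finitely many self-maps, so two powers
    of \<open>x 0\<close> act alike.\<close>
  obtain r :: nat where r: "r > 0" "\<And>w. w \<in> W \<Longrightarrow> A w (x 0 \<up> r) = w"
  proof -
    have "range (\<lambda>k::nat. restrict (\<lambda>w. A w (x 0 \<up> k)) W) \<subseteq> PiE W (\<lambda>_. W)"
      using Wm by auto
    moreover have "finite (PiE W (\<lambda>_. W))" using fin by (intro finite_PiE) (auto simp: W_def)
    ultimately have "finite (range (\<lambda>k::nat. restrict (\<lambda>w. A w (x 0 \<up> k)) W))" by (rule finite_subset)
    then have "\<not> inj (\<lambda>k::nat. restrict (\<lambda>w. A w (x 0 \<up> k)) W)"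
      using finite_imageD infinite_UNIV_nat by blast
    then obtain i' j' :: nat where ij': "i' \<noteq> j'"
      "restrict (\<lambda>w. A w (x 0 \<up> i')) W = restrict (\<lambda>w. A w (x 0 \<up> j')) W"
      unfolding inj_def by blast
    define i j where "i = min i' j'" and "j = max i' j'"
    have ij: "i < j" "restrict (\<lambda>w. A w (x 0 \<up> i)) W = restrict (\<lambda>w. A w (x 0 \<up> j)) W"
      using ij' unfolding i_def j_def by (auto simp: min_def max_def)
    have "A w (x 0 \<up> (j - i)) = w" if w: "w \<in> W" for w
    proof -
      have "A w (x 0 \<up> i) = A w (x 0 \<up> j)" using fun_cong [OF ij(2), of w] w by simp
      then have "A (A w (x 0 \<up> j)) (iv (x 0 \<up> i)) = w"
        using Aa [OF w, of "x 0 \<up> i" "iv (x 0 \<up> i)"] A1 [OF w] by simp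
      moreover have "x 0 \<up> j \<cdot> iv (x 0 \<up> i) = x 0 \<up> (j - i)"
      proof -
        have "x 0 \<up> j = x 0 \<up> (j - i) \<cdot> x 0 \<up> i"
          using ij(1) by (simp add: G.nat_pow_mult)
        then show ?thesis by (simp add: G.m_assoc)
      qed
      ultimately show ?thesis using Aa [OF w, of "x 0 \<up> j" "iv (x 0 \<up> i)"] by simp
    qed
    then show ?thesis using that [of "j - i"] ij(1) by simp
  qed
  have pow: "x (Suc i) \<cdot> x 0 \<up> k = x 0 \<up> k \<cdot> x (Suc i + k * (n - 1))" for i k :: nat
  proof (induction k)
    case (Suc k)
    have "x (Suc i + k * (n - 1)) \<cdot> x 0 = x 0 \<cdot> x (Suc i + Suc k * (n - 1))"
      using x_rel [of 0 "Suc i + k * (n - 1)"] n1 by (simp add: ac_simps)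
    moreover have "x (Suc i) \<cdot> x 0 \<up> Suc k = x 0 \<up> k \<cdot> (x (Suc i + k * (n - 1)) \<cdot> x 0)"
      using Suc by (simp flip: G.m_assoc)
    ultimately show ?case by (simp add: G.m_assoc)
  qed simp
  have per: "A w (x (Suc i + r * (n - 1))) = A w (x (Suc i))" if w: "w \<in> W" for w i
  proof -
    have "A w (x (Suc i + r * (n - 1))) = A (A w (x 0 \<up> r)) (x (Suc i + r * (n - 1)))" using r(2) [OF w] by simp
    also have "\<dots> = A w (x (Suc i) \<cdot> x 0 \<up> r)" using Aa [OF w] pow [of i r] by simp
    also have "\<dots> = A w (x (Suc i))" 
      using Aa [OF w, of "x (Suc i)" "x 0 \<up> r"] r(2) [OF Wm [OF w x_closed]] by simp
    finally show ?thesis .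
  qed
  have per': "A w (x (Suc i + k * (r * (n - 1)))) = A w (x (Suc i))" if w: "w \<in> W" for w i k
  proof (induction k)
    case (Suc k)
    have "Suc i + Suc k * (r * (n - 1)) = Suc (i + k * (r * (n - 1))) + r * (n - 1)" by simp
    then show ?case using per [OF w, of "i + k * (r * (n - 1))"] Suc by (metis add_Suc)
  qed simp
  \<comment> \<open>Raising an index past \<open>j\<close> without changing the action frees the
    relation from its condition on the order of the indices.\<close>
  have big: "\<exists>l>j. \<forall>w\<in>W. A w (x l) = A w (x (Suc i)) \<and> A w (x (l + n - 1)) = A w (x (Suc i + n - 1))" for i j
  proof -
    define l where "l = Suc i + Suc j * (r * (n - 1))"
    have "Suc j * 1 \<le> Suc j * (r * (n - 1))" using r(1) nz by (intro mult_le_mono2) simp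
    then have "j < l" by (simp add: l_def)
    moreover have "A w (x l) = A w (x (Suc i))" if "w \<in> W" for w unfolding l_def by (rule per' [OF that])
    moreover have "A w (x (l + n - 1)) = A w (x (Suc i + n - 1))" if "w \<in> W" for w
    proof -
      have "l + n - 1 = Suc (i + (n - 1)) + Suc j * (r * (n - 1))" "Suc i + n - 1 = Suc (i + (n - 1))"
        using n1 by (auto simp: l_def)
      then show ?thesis using per' [OF that, of "i + (n - 1)" "Suc j"] by simp
    qed
    ultimately show ?thesis by blast
  qed
  have rel: "A w (x (Suc i) \<cdot> x j) = A w (x j \<cdot> x (Suc i + n - 1))" if w: "w \<in> W" for w i j
  proof -
    obtain l where l: "j < l" "\<And>w. w \<in> W \<Longrightarrow> A w (x l) = A w (x (Suc i)) \<and> A w (x (l + n - 1)) = A w (x (Suc i + n - 1))"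
      using big by blast
    have "A w (x (Suc i) \<cdot> x j) = A (A w (x l)) (x j)" using Aa [OF w] l(2) [OF w] by simp
    also have "\<dots> = A w (x j \<cdot> x (l + n - 1))" using Aa [OF w] x_rel [OF l(1)] by simp
    also have "\<dots> = A (A w (x j)) (x (Suc i + n - 1))" using Aa [OF w] l(2) [OF Wm [OF w x_closed]] by simp
    finally show ?thesis using Aa [OF w] by simp
  qed
  have onto: "\<exists>w'\<in>W. A w' g = w" if "w \<in> W" "g \<in> C" for w g
    using Wm [OF that(1), of "iv g"] Aa [OF that(1), of "iv g" g] A1 [OF that(1)] that(2) by auto
  \<comment> \<open>In \<open>rel\<close> with \<open>j = Suc i\<close> both products begin with
    \<open>x (Suc i)\<close>, which acts surjectively and therefore cancels.\<close>
  have per1: "A w (x (Suc i + n - 1)) = A w (x (Suc i))" if w: "w \<in> W" for w i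
  proof -
    obtain w' where w': "w' \<in> W" "A w' (x (Suc i)) = w" using onto [OF w x_closed] by blast
    show ?thesis using rel [OF w'(1), of i "Suc i"] Aa [OF w'(1)] w'(2) by (metis x_closed)
  qed
  have comm1: "A w (x i \<cdot> x j) = A w (x j \<cdot> x i)" if w: "w \<in> W" for w i j
  proof -
    have 1: "A w (x (Suc k) \<cdot> x l) = A w (x l \<cdot> x (Suc k))" for k l
      using rel [OF w, of k l] per1 [OF Wm [OF w x_closed], of l k] Aa [OF w] by simp
    show ?thesis
    proof (cases i)
      case (Suc k)
      show ?thesis unfolding Suc by (rule 1)
    next
      case i: 0
      show ?thesis
      proof (cases j)
        case (Suc l)
        show ?thesis unfolding i Suc by (rule 1 [symmetric])
      qed (simp add: i)
    qed
  qed
  \<comment> \<open>Commutation is demanded at all cosets at once because the closure proofs move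
    the coset. Applied to the generators and then to all of \<open>C\<close>, it extends commutation
    one argument at a time.\<close>
  define Cen where "Cen S = {g \<in> C. \<forall>w\<in>W. \<forall>s\<in>S. A w (g \<cdot> s) = A w (s \<cdot> g)}" for S
  have Cen: "subgroup (Cen S) (F_inf n)" if S: "S \<subseteq> C" for S
  proof (rule G.subgroupI)
    show "Cen S \<subseteq> C" by (auto simp: Cen_def)
    have "e1 \<in> Cen S" using S by (auto simp: Cen_def subset_iff)
    then show "Cen S \<noteq> {}" by blast
    fix g assume g: "g \<in> Cen S"
    then have gC: "g \<in> C" by (simp add: Cen_def)
    have "A w (iv g \<cdot> s) = A w (s \<cdot> iv g)" if w: "w \<in> W" and s: "s \<in> S" for w s
    proof -
      have sC: "s \<in> C" using S s by blast
      define w' where "w' = A w (iv g)"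
      have w': "w' \<in> W" "A w' g = w" using Wm [OF w] Aa [OF w, of "iv g" g] A1 [OF w] gC by (auto simp: w'_def)
      have "A w (s \<cdot> iv g) = A (A w' (g \<cdot> s)) (iv g)"
        using Aa [OF w sC, of "iv g"] Aa [OF w'(1) gC sC] w'(2) gC by simp
      also have "\<dots> = A (A w' (s \<cdot> g)) (iv g)" using g w'(1) s by (simp add: Cen_def)
      also have "\<dots> = A w' (s \<cdot> g \<cdot> iv g)" using Aa [OF w'(1), of "s \<cdot> g" "iv g"] sC gC by simp
      also have "\<dots> = A w' s" using sC gC by (simp add: G.m_assoc)
      also have "\<dots> = A w (iv g \<cdot> s)" using Aa [OF w, of "iv g" s] sC gC by (simp add: w'_def)
      finally show ?thesis by simp
    qed
    then show "iv g \<in> Cen S" using gC by (simp add: Cen_def)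
    fix h assume h: "h \<in> Cen S"
    then have hC: "h \<in> C" by (simp add: Cen_def)
    have "A w (g \<cdot> h \<cdot> s) = A w (s \<cdot> (g \<cdot> h))" if w: "w \<in> W" and s: "s \<in> S" for w s
    proof -
      have sC: "s \<in> C" using S s by blast
      have "A w (g \<cdot> h \<cdot> s) = A (A w g) (h \<cdot> s)" using Aa [OF w gC, of "h \<cdot> s"] gC hC sC by (simp add: G.m_assoc)
      also have "\<dots> = A (A w g) (s \<cdot> h)" using h Wm [OF w gC] s by (simp add: Cen_def)
      also have "\<dots> = A (A w (g \<cdot> s)) h" using Aa [OF w gC, of "s \<cdot> h"] Aa [OF w, of "g \<cdot> s" h] gC hC sC by (simp add: G.m_assoc)
      also have "\<dots> = A (A w (s \<cdot> g)) h" using g w s by (simp add: Cen_def)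
      also have "\<dots> = A w (s \<cdot> (g \<cdot> h))" using Aa [OF w, of "s \<cdot> g" h] gC hC sC by (simp add: G.m_assoc)
      finally show ?thesis .
    qed
    then show "g \<cdot> h \<in> Cen S" using gC hC by (simp add: Cen_def)
  qed
  have rx: "range x \<subseteq> C" by auto
  have "C \<subseteq> Cen (range x)" by (rule generated [OF Cen [OF rx]]) (auto simp: Cen_def comm1)
  then have gx: "A w (g \<cdot> x i) = A w (x i \<cdot> g)" if "w \<in> W" "g \<in> C" for w g i using that by (auto simp: Cen_def)
  have "C \<subseteq> Cen C" by (rule generated [OF Cen [OF subset_refl]]) (auto simp: Cen_def gx)
  then show ?thesis using w g unfolding Cen_def W_def A_def by blast
qed

text \<open>Commuting the last factor of \<open>g \<cdot> h \<cdot> iv g\<close> to the front shows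
  that this element has the same coset as \<open>h\<close>, namely \<open>H\<close>.\<close>

theorem finite_index_normal:
  assumes H: "subgroup H (F_inf n)" and fin: "finite (rcosets\<^bsub>F_inf n\<^esub> H)"
  shows "H \<lhd> F_inf n" "comm_group (F_inf n Mod H)"
proof -
  have HW: "H \<in> rcosets\<^bsub>F_inf n\<^esub> H" by (rule subgroup.subgroup_in_rcosets [OF H G.is_group])
  note comm = finite_index_commute [OF H fin HW]
  show N: "H \<lhd> F_inf n"
  proof (rule G.normal_invI [OF H])
    fix g h assume g: "g \<in> C" and h: "h \<in> H"
    have hC: "h \<in> C" by (rule subgroup.mem_carrier [OF H h])
    have ic: "iv g \<cdot> (g \<cdot> h) = h" using g hC by simp
    have "H #>\<^bsub>F_inf n\<^esub> (g \<cdot> h \<cdot> iv g) = H #>\<^bsub>F_inf n\<^esub> h"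
      using comm [of "g \<cdot> h" "iv g"] g hC by (simp add: ic)
    also have "\<dots> = H" by (rule G.coset_join2 [OF hC H h])
    finally show "g \<cdot> h \<cdot> iv g \<in> H" by (rule G.coset_join1 [OF _ _ H]) (use g hC in simp)
  qed
  interpret N: normal H "F_inf n" by (rule N)
  show "comm_group (F_inf n Mod H)"
  proof (rule group.group_comm_groupI [OF N.factorgroup_is_group])
    fix a b assume "a \<in> carrier (F_inf n Mod H)" "b \<in> carrier (F_inf n Mod H)"
    then obtain g h where "g \<in> C" "a = H #>\<^bsub>F_inf n\<^esub> g" "h \<in> C" "b = H #>\<^bsub>F_inf n\<^esub> h"
      by (auto simp: FactGroup_def RCOSETS_def)
    then show "a \<otimes>\<^bsub>F_inf n Mod H\<^esub> b = b \<otimes>\<^bsub>F_inf n Mod H\<^esub> a"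
      by (simp add: N.rcos_sum comm)
  qed
qed

lemma finite_index_cost:
  assumes H: "subgroup H (F_inf n)" and fin: "finite (rcosets\<^bsub>F_inf n\<^esub> H)"
  shows "0 < group_index (F_inf n) H" "\<exists>a. cost_le (F_inf n) H a"
    "M ^ (n + 1) < group_index (F_inf n) H \<Longrightarrow> \<exists>a. cost_le (F_inf n) H a \<and>
       M * a \<le> 2 * (2 ^ n * (4 * \<kappa> * group_index (F_inf n) H + (2 * n + 3) * M)) + M"
proof -
  interpret N: normal H "F_inf n" by (rule finite_index_normal(1) [OF H fin])
  define \<pi> where "\<pi> = (\<lambda>a. H #>\<^bsub>F_inf n\<^esub> a)"
  have Q: "comm_group (F_inf n Mod H)" by (rule finite_index_normal(2) [OF H fin])
  have Qg: "group (F_inf n Mod H)" by (rule N.factorgroup_is_group)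
  have \<pi>: "\<pi> \<in> homs (F_inf n) C (F_inf n Mod H)"
    unfolding homs_carrier \<pi>_def by (rule N.r_coset_hom_Mod)
  have im: "\<pi> ` C = rcosets\<^bsub>F_inf n\<^esub> H" by (auto simp: \<pi>_def RCOSETS_def)
  have card: "card (\<pi> ` C) = group_index (F_inf n) H" by (simp add: im group_index_def)
  have fin': "finite (\<pi> ` C)" unfolding im by (rule fin)
  have kern: "kern C (F_inf n Mod H) \<pi> = H"
  proof -
    have "\<pi> a = H \<longleftrightarrow> a \<in> H" if "a \<in> C" for a
      unfolding \<pi>_def using G.coset_join1 [OF _ that H] G.coset_join2 [OF that H] by blast
    then show ?thesis unfolding kern_def one_FactGroup using subgroup.subset [OF H] by blast
  qed
  have "\<pi> ` C \<noteq> {}" using G.one_closed by blast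
  then show "0 < group_index (F_inf n) H" using fin' by (simp add: card_gt_0_iff flip: card)
  show "\<exists>a. cost_le (F_inf n) H a" using cost_kern [OF Qg \<pi> fin'] unfolding kern by blast
  show "M ^ (n + 1) < group_index (F_inf n) H \<Longrightarrow> \<exists>a. cost_le (F_inf n) H a \<and>
       M * a \<le> 2 * (2 ^ n * (4 * \<kappa> * group_index (F_inf n) H + (2 * n + 3) * M)) + M"
    using kern_bound [OF Q \<pi> fin', of M] unfolding kern card .
qed

end

theorem theoremB:
  fixes n :: nat and Gs :: "nat \<Rightarrow> nat word set set"
  assumes "n \<ge> 2"
    and "\<And>s. subgroup (Gs s) (F_inf n)"
    and "\<And>s. finite (rcosets\<^bsub>F_inf n\<^esub> (Gs s))"
    and "filterlim (\<lambda>s. group_index (F_inf n) (Gs s)) at_top sequentially"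
  shows "((\<lambda>s. deficiency ((F_inf n)\<lparr>carrier := Gs s\<rparr>)
              / ereal (real (group_index (F_inf n) (Gs s)))) \<longlongrightarrow> 0) sequentially"
proof -
  interpret thompson n by unfold_locales (rule assms(1))
  define N where "N s = group_index (F_inf n) (Gs s)" for s
  define D where "D s = deficiency ((F_inf n)\<lparr>carrier := Gs s\<rparr>)" for s
  define d where "d s = real_of_ereal (D s)" for s
  note cost = finite_index_cost [OF assms(2,3)]
  have N0: "0 < N s" for s using cost(1) by (simp add: N_def)
  have bounds: "- ereal (real a) \<le> D s" "D s \<le> ereal (real a)" if "cost_le (F_inf n) (Gs s) a" for s a
    using G.deficiency_bounds [OF assms(2) that] by (simp_all add: D_def)
  \<comment> \<open>A finite cost bounds the deficiency on both sides, so the argument can proceed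
    in the reals.\<close>
  have Dd: "D s = ereal (d s)" for s
  proof -
    obtain a where "cost_le (F_inf n) (Gs s) a" using cost(2) by blast
    from bounds [OF this] show ?thesis unfolding d_def by (cases "D s") auto
  qed
  have dle: "\<bar>d s\<bar> \<le> real a" if "cost_le (F_inf n) (Gs s) a" for s a
    using bounds [OF that] unfolding Dd by (simp add: abs_le_iff)
  \<comment> \<open>The constants of \<open>finite_index_cost\<close>, arranged so that some cost is
    at most \<open>A * N s / M + B\<close> for positive \<open>M\<close> once the index exceeds
    \<open>M ^ (n + 1)\<close>.\<close>
  define A B where "A = 2 * 2 ^ n * (4 * real \<kappa>)" and "B = 2 * 2 ^ n * (2 * real n + 3) + 1"
  have AB: "A \<ge> 0" "B \<ge> 0" by (simp_all add: A_def B_def)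
  have "(\<lambda>s. d s / real (N s)) \<longlonglongrightarrow> 0"
  proof (rule LIMSEQ_I)
    fix \<epsilon> :: real assume \<epsilon>: "0 < \<epsilon>"
    \<comment> \<open>\<open>M\<close> makes \<open>A / M\<close> smaller than half of
      \<open>\<epsilon>\<close>, and an index of at least \<open>L\<close> does the same for
      \<open>B / N s\<close>.\<close>
    obtain M :: nat where M: "2 * A / \<epsilon> < real M" using reals_Archimedean2 by blast
    obtain L :: nat where L: "2 * B / \<epsilon> < real L" using reals_Archimedean2 by blast
    have M0: "0 < real M" using M AB \<epsilon> by (meson divide_nonneg_pos le_less_trans mult_nonneg_nonneg zero_le_numeral)
    have "eventually (\<lambda>s. max (Suc (M ^ (n + 1))) L \<le> N s) sequentially"
      using assms(4) unfolding filterlim_at_top N_def by blast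
    then obtain s0 where s0: "\<And>s. s \<ge> s0 \<Longrightarrow> max (Suc (M ^ (n + 1))) L \<le> N s"
      unfolding eventually_sequentially by blast
    show "\<exists>s0. \<forall>s\<ge>s0. norm (d s / real (N s) - 0) < \<epsilon>"
    proof (intro exI allI impI)
      fix s assume s: "s0 \<le> s"
      have big: "M ^ (n + 1) < N s" "L \<le> N s" using s0 [OF s] by auto
      obtain a where a: "cost_le (F_inf n) (Gs s) a"
        "M * a \<le> 2 * (2 ^ n * (4 * \<kappa> * N s + (2 * n + 3) * M)) + M"
        using cost(3) [of M s] big(1) unfolding N_def by blast
      have "real (M * a) \<le> real (2 * (2 ^ n * (4 * \<kappa> * N s + (2 * n + 3) * M)) + M)"
        using a(2) by (simp only: of_nat_le_iff)
      also have "\<dots> = A * real (N s) + B * real M" by (simp add: A_def B_def algebra_simps)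
      finally have 1: "real M * real a \<le> A * real (N s) + B * real M" by simp
      have "2 * A < \<epsilon> * real M" "2 * B < \<epsilon> * real L" using M L \<epsilon> by (simp_all add: field_simps)
      moreover have "\<epsilon> * real L \<le> \<epsilon> * real (N s)" using big(2) \<epsilon> by simp
      ultimately have 2: "A < \<epsilon> * real M / 2" "B < \<epsilon> * real (N s) / 2" by simp_all
      have "A * real (N s) < \<epsilon> * real M / 2 * real (N s)" using 2(1) N0 by (intro mult_strict_right_mono) auto
      moreover have "B * real M < \<epsilon> * real (N s) / 2 * real M" using 2(2) M0 by (intro mult_strict_right_mono) auto
      ultimately have "real M * real a < real M * (\<epsilon> * real (N s))" using 1 by (simp add: algebra_simps)
      then have "real a < \<epsilon> * real (N s)" using M0 by simp
      then have "\<bar>d s\<bar> < \<epsilon> * real (N s)" using dle [OF a(1)] by linarith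
      then show "norm (d s / real (N s) - 0) < \<epsilon>" using N0 [of s] by (simp add: abs_divide pos_divide_less_eq)
    qed
  qed
  then have "(\<lambda>s. ereal (d s / real (N s))) \<longlonglongrightarrow> ereal 0" by (simp only: tendsto_ereal)
  moreover have "ereal (d s / real (N s)) = D s / ereal (real (N s))" for s
    using N0 [of s] by (simp add: Dd)
  ultimately have "(\<lambda>s. D s / ereal (real (N s))) \<longlonglongrightarrow> ereal 0" by (simp only:)
  then show ?thesis by (simp only: D_def N_def zero_ereal_def)
qed

end
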